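(* Let $t>1$, let $V$ be a three-dimensional vector space, and let $X$ be the blow-up of $\mathbb{P}V\cong\mathbb{P}^2$ in $t$ distinct points. Let $A$ be the path algebra (without relations) of the quiver $Q$ described in the context, let $A_X$ be the endomorphism algebra of $\mathcal{O}_X\oplus\bigoplus_{i=1}^t\mathcal{O}(R_i)\oplus\mathcal{O}(H)\oplus\mathcal{O}(2H)$, and let $I_X\subset A$ be the kernel of the natural surjection $A\to A_X$, so that $A_X\cong A/I_X$. Then $I_X$ is generated, as a two-sided ideal of $A$, by: $$\ker\big(H_i\otimes V^*\longrightarrow S^2V^*\big)\subset e_{t+3}Ae_i \quad\text{for } 1\le i\le t,$$ $$\ker\Big(\bigoplus_{i=1}^t H_i\longrightarrow V^*\Big)\subset e_{t+2}Ae_{t+1},$$ $$\ker\big(V^*\otimes V^*\longrightarrow S^2V^*\big),$$ where the elements of the last kernel are understood as relations among paths from $e_{t+1}$ to $e_{t+3}$, i.e. one takes all elements of $e_{t+3}Ae_{t+1}=\big(\bigoplus_{i=1}^t H_i\big)\otimes V^*$ whose image in $V^*\otimes V^*$ under the map induced by $\bigoplus_{i=1}^t H_i\to V^*$ lies in $\ker(V^*\otimes V^*\to S^2V^* )$.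
   Context: The base field is algebraically closed. $\mathbb{P}V$ is the projective space of lines in $V$, so $V^*=\Gamma(\mathbb{P}^2,\mathcal{O}(1))$. $H$ denotes the pull-back to $X$ of the class of a line in $\mathbb{P}^2$, and $R_1,\dots,R_t$ are the classes of the exceptional divisors over the $t$ blown-up points $x_1,\dots,x_t$. Pull-back of sections identifies $\Gamma(X,\mathcal{O}(H))=V^*$ and $\Gamma(X,\mathcal{O}(2H))=S^2V^*$. Set $H_i:=\Gamma(X,\mathcal{O}(H-R_i))$; via multiplication by the canonical section of $\mathcal{O}(R_i)$ it is identified with the two-dimensional subspace of $V^*$ of linear forms vanishing at $x_i$. The quiver $Q$ has vertices $e_1,\dots,e_{t+3}$, where $e_{t+1}$ corresponds to $\mathcal{O}_X$, $e_i$ to $\mathcal{O}(R_i)$ for $1\le i\le t$, $e_{t+2}$ to $\mathcal{O}(H)$, and $e_{t+3}$ to $\mathcal{O}(2H)$. Its arrows are: for each $1\le i\le t$, one arrow from $e_{t+1}$ to $e_i$ (corresponding to the canonical section of $\mathcal{O}(R_i)$); for each $1\le i\le t$, two arrows from $e_i$ to $e_{t+2}$ (corresponding to a basis of $H_i$); three arrows from $e_{t+2}$ to $e_{t+3}$ (corresponding to a basis of $V^*=\Gamma(X,\mathcal{O}(H))$). Sending each arrow to the corresponding morphism between invertible sheaves defines the natural surjection $A\to A_X$. The symbols $e_j$ also denote the corresponding idempotents, and $e_jAe_i$ is the span of paths from $e_i$ to $e_j$. Hence $e_{t+3}Ae_i=H_i\otimes V^*$ for $1\le i\le t$, $e_{t+2}Ae_{t+1}=\bigoplus_{i=1}^t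 H_i$, and $e_{t+3}Ae_{t+1}=\big(\bigoplus_{i=1}^t H_i\big)\otimes V^*$. The map $\bigoplus_i H_i\to V^*$ is the sum of the inclusions $H_i\subset V^*$, and the maps $H_i\otimes V^*\to S^2V^*$ and $V^*\otimes V^*\to S^2V^*$ are the multiplication maps. *)

theory Defs
  imports
    "HOL-Algebra.RingHom"
    "HOL-Computational_Algebra.Polynomial"
    "HOL-Library.FuncSet"
    "HOL-Library.Function_Algebras"
    "Graph_Theory.Arc_Walk"
begin

section \<open>Path algebras of quivers\<close>

text \<open>
  A quiver is a directed multigraph. A path is a triple \<open>(u, p, v)\<close> of its start vertex, the
  list of its arrows in the order in which they are traversed, and its end vertex; the empty
  lists are the paths of length zero. Products are written like compositions of maps: \<open>b * a\<close>
  is "first \<open>a\<close>, then \<open>b\<close>", so that \<open>e\<^sub>j A e\<^sub>i\<close> is the span of the paths from \<open>i\<close> to \<open>j\<close>.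
\<close>

definition paths :: "('a, 'b) pre_digraph \<Rightarrow> ('a \<times> 'b list \<times> 'a) set" where
  "paths Q = {(u, p, v). pre_digraph.awalk Q u p v}"

fun path_start :: "'a \<times> 'b list \<times> 'a \<Rightarrow> 'a" where
  "path_start (u, p, v) = u"

fun path_end :: "'a \<times> 'b list \<times> 'a \<Rightarrow> 'a" where
  "path_end (u, p, v) = v"

fun path_comp :: "'a \<times> 'b list \<times> 'a \<Rightarrow> 'a \<times> 'b list \<times> 'a \<Rightarrow> 'a \<times> 'b list \<times> 'a" where
  "path_comp (u', q, v') (u, p, v) = (u, p @ q, v')"

definition path_algebra ::
  "('a, 'b) pre_digraph \<Rightarrow> ('a \<times> 'b list \<times> 'a \<Rightarrow> 'k::field) ring" where
  "path_algebra Q =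
    \<lparr>carrier = {f. finite {r. f r \<noteq> 0} \<and> {r. f r \<noteq> 0} \<subseteq> paths Q},
     monoid.mult = (\<lambda>f g r. \<Sum>(b, a) \<in> {(b, a). b \<in> paths Q \<and> a \<in> paths Q \<and>
                       path_end a = path_start b \<and> path_comp b a = r}. f b * g a),
     one = (\<lambda>r. if r \<in> {(u, [], u) |u. u \<in> verts Q} then 1 else 0),
     zero = 0,
     add = (+)\<rparr>"

definition path_space ::
  "('a, 'b) pre_digraph \<Rightarrow> 'a \<Rightarrow> 'a \<Rightarrow> ('a \<times> 'b list \<times> 'a \<Rightarrow> 'k::field) set" where
  "path_space Q i j = {f \<in> carrier (path_algebra Q).
     \<forall>r. f r \<noteq> 0 \<longrightarrow> path_start r = i \<and> path_end r = j}"


section \<open>Linear forms and tensors\<close>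

definition fscale :: "'k::field \<Rightarrow> ('a \<Rightarrow> 'k) \<Rightarrow> ('a \<Rightarrow> 'k)" where
  "fscale c f = (\<lambda>a. c * f a)"

definition basis_family :: "nat \<Rightarrow> (nat \<Rightarrow> 'a \<Rightarrow> 'k::field) \<Rightarrow> ('a \<Rightarrow> 'k) set \<Rightarrow> bool" where
  "basis_family n b W \<longleftrightarrow> inj_on b {..<n} \<and> \<not> module.dependent fscale (b ` {..<n}) \<and>
     module.span fscale (b ` {..<n}) = W"

definition dual_space :: "('k::field \<Rightarrow> 'v::ab_group_add \<Rightarrow> 'v) \<Rightarrow> ('v \<Rightarrow> 'k) set" where
  "dual_space scale = {f. Vector_Spaces.linear scale (*) f}"

text \<open>
  As \<open>V\<close> is finite-dimensional, \<open>V\<^sup>* \<otimes> V\<^sup>*\<close> is the space of bilinear forms on \<open>V\<close>.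
\<close>

definition tensor :: "('v \<Rightarrow> 'k::field) \<Rightarrow> ('v \<Rightarrow> 'k) \<Rightarrow> ('v \<times> 'v \<Rightarrow> 'k)" where
  "tensor f g = (\<lambda>(u, w). f u * g w)"

text \<open>
  \<open>S\<^sup>2V\<^sup>*\<close> is the quotient of \<open>V\<^sup>* \<otimes> V\<^sup>*\<close> by the span of the tensors \<open>f \<otimes> g - g \<otimes> f\<close>, and
  the multiplication map \<open>V\<^sup>* \<otimes> V\<^sup>* \<longrightarrow> S\<^sup>2V\<^sup>*\<close> is the quotient map. Its kernel is therefore:
\<close>

definition sym2_kernel :: "('k::field \<Rightarrow> 'v::ab_group_add \<Rightarrow> 'v) \<Rightarrow> ('v \<times> 'v \<Rightarrow> 'k) set" where
  "sym2_kernel scale = module.span fscale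
     {tensor f g - tensor g f |f g. f \<in> dual_space scale \<and> g \<in> dual_space scale}"


section \<open>The blow-up of a projective plane in points\<close>

definition proj_space :: "('k::field \<Rightarrow> 'v::ab_group_add \<Rightarrow> 'v) \<Rightarrow> 'v set set" where
  "proj_space scale = {p. module.subspace scale p \<and> vector_space.dim scale p = 1}"

definition forms_through ::
  "('k::field \<Rightarrow> 'v::ab_group_add \<Rightarrow> 'v) \<Rightarrow> 'v set \<Rightarrow> ('v \<Rightarrow> 'k) set" where
  "forms_through scale p = {f \<in> dual_space scale. \<forall>v\<in>p. f v = 0}"

type_synonym 'v bpoint = "'v set \<times> (nat \<Rightarrow> 'v set)"

text \<open>
  A section over a set of points of \<open>X\<close> assigns to a point over \<open>p \<in> P(V)\<close> a function on the
  line \<open>p \<subset> V\<close>. All sections are extended by zero outside of their domain.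
\<close>

type_synonym ('k, 'v) bsection = "'v bpoint \<Rightarrow> 'v \<Rightarrow> 'k"

locale blown_up_plane = vector_space scale
  for scale :: "'k::alg_closed_field \<Rightarrow> 'v::ab_group_add \<Rightarrow> 'v" +
  fixes t :: nat and x :: "nat \<Rightarrow> 'v set"
begin

subsection \<open>The variety\<close>

text \<open>
  The lines of \<open>P(V)\<close> are given by the two-dimensional subspaces of \<open>V\<close>. The blow-up of \<open>P(V)\<close>
  in one point \<open>x\<^sub>i\<close> is the incidence variety of the pairs \<open>(p, L)\<close> of a point and a line with
  \<open>x\<^sub>i, p \<in> L\<close>, and the blow-up in distinct points is the fibre product of these over \<open>P(V)\<close>.
\<close>

definition points :: "'v bpoint set" where
  "points = {(p, l). p \<in> proj_space scale \<and>
     l \<in> (\<Pi>\<^sub>E i\<in>{1..t}. {L. subspace L \<and> dim L = 2 \<and> x i \<subseteq> L \<and> p \<subseteq> L})}"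

definition exc :: "nat \<Rightarrow> 'v bpoint set" where
  "exc i = {z \<in> points. fst z = x i}"

text \<open>
  \<open>X\<close> is a closed subvariety of \<open>P(V) \<times> (P(V\<^sup>*))\<^sup>t\<close>: homogeneous coordinates of \<open>(p, l)\<close> are a
  spanning vector of \<open>p\<close> and, for each \<open>i\<close>, a linear form with kernel \<open>l i\<close>.
\<close>

definition coords :: "'v bpoint \<Rightarrow> ('v \<times> (nat \<Rightarrow> 'v \<Rightarrow> 'k)) set" where
  "coords z = {(v, \<eta>). v \<in> fst z \<and> v \<noteq> 0 \<and>
     (\<forall>i\<in>{1..t}. \<eta> i \<in> dual_space scale \<and> snd z i = {u. \<eta> i u = 0})}"

text \<open>
  \<open>multihom m e F\<close>: \<open>F\<close> is a multihomogeneous polynomial function on \<open>V \<times> (V\<^sup>*)\<^sup>t\<close>, of degree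
  \<open>m\<close> in the first and of degree \<open>e i\<close> in the \<open>i\<close>-th of the further variables. The linear
  forms on \<open>V\<^sup>*\<close> are the evaluations at the vectors \<open>u\<close> of \<open>V\<close>.
\<close>

inductive multihom :: "nat \<Rightarrow> (nat \<Rightarrow> nat) \<Rightarrow> ('v \<times> (nat \<Rightarrow> 'v \<Rightarrow> 'k) \<Rightarrow> 'k) \<Rightarrow> bool" where
  const: "multihom 0 (\<lambda>_. 0) (\<lambda>_. c)"
| vec: "f \<in> dual_space scale \<Longrightarrow> multihom 1 (\<lambda>_. 0) (\<lambda>(v, \<eta>). f v)"
| covec: "i \<in> {1..t} \<Longrightarrow> multihom 0 (\<lambda>j. if j = i then 1 else 0) (\<lambda>(v, \<eta>). \<eta> i u)"
| add: "multihom m e F \<Longrightarrow> multihom m e G \<Longrightarrow> multihom m e (\<lambda>c. F c + G c)"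
| mult: "multihom m e F \<Longrightarrow> multihom m' e' G \<Longrightarrow>
    multihom (m + m') (\<lambda>j. e j + e' j) (\<lambda>c. F c * G c)"

definition zopen :: "'v bpoint set \<Rightarrow> bool" where
  "zopen U \<longleftrightarrow> (\<exists>S. (\<forall>F\<in>S. \<exists>m e. multihom m e F) \<and>
     U = {z \<in> points. \<exists>F\<in>S. \<exists>c\<in>coords z. F c \<noteq> 0})"

subsection \<open>Invertible sheaves\<close>

text \<open>
  \<open>line_sheaf d\<close> is the pull-back \<open>\<O>(dH)\<close> of \<open>\<O>(d)\<close>, for \<open>d \<ge> 0\<close>. The fibre of \<open>\<O>(d)\<close> at
  \<open>p\<close> is the space of homogeneous functions of degree \<open>d\<close> on the line \<open>p\<close>; the value
  of a section is recorded on the nonzero vectors of \<open>p\<close>. In particular, \<open>line_sheaf 0\<close> is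
  the structure sheaf.
\<close>

definition line_sheaf :: "nat \<Rightarrow> 'v bpoint set \<Rightarrow> ('k, 'v) bsection set" where
  "line_sheaf d U = {s.
     (\<forall>z v. \<not> (z \<in> U \<and> v \<in> fst z \<and> v \<noteq> 0) \<longrightarrow> s z v = 0) \<and>
     (\<forall>z\<in>U. \<exists>W F G m e. zopen W \<and> z \<in> W \<and> W \<subseteq> U \<and>
        multihom (m + d) e F \<and> multihom m e G \<and>
        (\<forall>w\<in>W. \<forall>c\<in>coords w. G c \<noteq> 0 \<and> s w (fst c) = F c / G c))}"

definition exc_ideal :: "nat \<Rightarrow> 'v bpoint set \<Rightarrow> ('k, 'v) bsection set" where
  "exc_ideal i U = {g \<in> line_sheaf 0 U. \<forall>z \<in> U \<inter> exc i. g z = 0}"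

text \<open>
  \<open>\<O>(R\<^sub>i)\<close> is the inverse of the invertible ideal sheaf \<open>\<O>(-R\<^sub>i)\<close> of \<open>R\<^sub>i\<close>: the sheaf of the functions
  on the complement of \<open>R\<^sub>i\<close> whose products with all local functions vanishing on \<open>R\<^sub>i\<close>
  extend to regular functions.
\<close>

definition exc_sheaf :: "nat \<Rightarrow> 'v bpoint set \<Rightarrow> ('k, 'v) bsection set" where
  "exc_sheaf i U = {f \<in> line_sheaf 0 (U - exc i).
     \<forall>W g. zopen W \<and> W \<subseteq> U \<and> g \<in> exc_ideal i W \<longrightarrow>
       (\<exists>k \<in> line_sheaf 0 W. \<forall>z \<in> W - exc i. k z = f z * g z)}"

definition restrict_to :: "'v bpoint set \<Rightarrow> ('k, 'v) bsection \<Rightarrow> ('k, 'v) bsection" where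
  "restrict_to W s = (\<lambda>z. if z \<in> W then s z else 0)"

text \<open>The numbering of the sheaves is that of the vertices of the quiver.\<close>

definition summand :: "nat \<Rightarrow> 'v bpoint set \<Rightarrow> ('k, 'v) bsection set" where
  "summand j = (if j = t + 1 then line_sheaf 0
     else if j = t + 2 then line_sheaf 1
     else if j = t + 3 then line_sheaf 2
     else exc_sheaf j)"

definition sum_sheaf :: "'v bpoint set \<Rightarrow> (nat \<Rightarrow> ('k, 'v) bsection) set" where
  "sum_sheaf U = {\<sigma>. \<forall>j. if j \<in> {1..t+3} then \<sigma> j \<in> summand j U else \<sigma> j = 0}"

subsection \<open>The endomorphism algebra\<close>

text \<open>
  Endomorphisms of the \<open>\<O>\<^sub>X\<close>-module \<open>sum_sheaf\<close>, extended by zero to arguments that are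
  not sections over open sets so that they are determined by their values on sections.
\<close>

definition endos ::
  "('v bpoint set \<Rightarrow> (nat \<Rightarrow> ('k, 'v) bsection) \<Rightarrow> (nat \<Rightarrow> ('k, 'v) bsection)) set" where
  "endos = {\<phi>.
     (\<forall>U \<sigma>. \<not> (zopen U \<and> \<sigma> \<in> sum_sheaf U) \<longrightarrow> \<phi> U \<sigma> = 0) \<and>
     (\<forall>U. zopen U \<longrightarrow>
        (\<forall>\<sigma>\<in>sum_sheaf U. \<phi> U \<sigma> \<in> sum_sheaf U) \<and>
        (\<forall>\<sigma>\<in>sum_sheaf U. \<forall>\<tau>\<in>sum_sheaf U. \<phi> U (\<sigma> + \<tau>) = \<phi> U \<sigma> + \<phi> U \<tau>) \<and>
        (\<forall>r\<in>line_sheaf 0 U. \<forall>\<sigma>\<in>sum_sheaf U. \<phi> U (\<lambda>j. r * \<sigma> j) = (\<lambda>j. r * \<phi> U \<sigma> j)) \<and>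
        (\<forall>W. zopen W \<and> W \<subseteq> U \<longrightarrow> (\<forall>\<sigma>\<in>sum_sheaf U.
           \<phi> W (\<lambda>j. restrict_to W (\<sigma> j)) = (\<lambda>j. restrict_to W (\<phi> U \<sigma> j)))))}"

definition end_algebra ::
  "('v bpoint set \<Rightarrow> (nat \<Rightarrow> ('k, 'v) bsection) \<Rightarrow> (nat \<Rightarrow> ('k, 'v) bsection)) ring" where
  "end_algebra =
    \<lparr>carrier = endos,
     monoid.mult = (\<lambda>\<phi> \<psi> U \<sigma>. \<phi> U (\<psi> U \<sigma>)),
     one = (\<lambda>U \<sigma>. if zopen U \<and> \<sigma> \<in> sum_sheaf U then \<sigma> else 0),
     zero = 0,
     add = (+)\<rparr>"

end


section \<open>The quiver and the natural map\<close>

text \<open>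
  \<open>Exc i\<close> is the arrow from \<open>t + 1\<close> to \<open>i\<close>, \<open>Lin i b\<close> for \<open>b < 2\<close> are the arrows from \<open>i\<close>
  to \<open>t + 2\<close>, and \<open>Coord a\<close> for \<open>a < 3\<close> are the arrows from \<open>t + 2\<close> to \<open>t + 3\<close>.
\<close>

datatype arrow = Exc nat | Lin nat nat | Coord nat

definition quiver :: "nat \<Rightarrow> (nat, arrow) pre_digraph" where
  "quiver t =
    \<lparr>verts = {1..t+3},
     arcs = {Exc i |i. i \<in> {1..t}} \<union> {Lin i b |i b. i \<in> {1..t} \<and> b < 2} \<union> {Coord a |a. a < 3},
     tail = (\<lambda>a. case a of Exc i \<Rightarrow> t + 1 | Lin i b \<Rightarrow> i | Coord a \<Rightarrow> t + 2),
     head = (\<lambda>a. case a of Exc i \<Rightarrow> i | Lin i b \<Rightarrow> t + 2 | Coord a \<Rightarrow> t + 3)\<rparr>"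

text \<open>
  The definitions below are meaningful when \<open>V\<close> has dimension 3, \<open>x 1, \<dots>, x t\<close> are distinct
  points of \<open>P(V)\<close>, \<open>h i 0, h i 1\<close> is a basis of the space \<open>H\<^sub>i \<subseteq> V\<^sup>*\<close> of the forms vanishing
  at \<open>x i\<close>, and \<open>y 0, y 1, y 2\<close> is a basis of \<open>V\<^sup>*\<close>.
\<close>

locale blown_up_plane_bases = blown_up_plane scale t x
  for scale :: "'k::alg_closed_field \<Rightarrow> 'v::ab_group_add \<Rightarrow> 'v" and t x +
  fixes h :: "nat \<Rightarrow> nat \<Rightarrow> 'v \<Rightarrow> 'k" and y :: "nat \<Rightarrow> 'v \<Rightarrow> 'k"
begin

text \<open>
  The canonical section of \<open>\<O>(R\<^sub>i)\<close> is the constant function 1, so \<open>\<O>\<^sub>X \<longrightarrow> \<O>(R\<^sub>i)\<close> is the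
  restriction to the complement of \<open>R\<^sub>i\<close>. A form \<open>h \<in> H\<^sub>i\<close> gives the morphism
  \<open>\<O>(R\<^sub>i) \<longrightarrow> \<O>(H)\<close> whose composition with it is multiplication by \<open>h\<close>: it sends \<open>f\<close> to the
  unique section of \<open>\<O>(H)\<close> that extends \<open>h * f\<close> across \<open>R\<^sub>i\<close>.
\<close>

fun arrow_map :: "arrow \<Rightarrow> 'v bpoint set \<Rightarrow> ('k, 'v) bsection \<Rightarrow> ('k, 'v) bsection" where
  "arrow_map (Exc i) U s = restrict_to (U - exc i) s"
| "arrow_map (Lin i b) U s =
     (THE g. g \<in> line_sheaf 1 U \<and> (\<forall>z \<in> U - exc i. g z = (\<lambda>v. h i b v * s z v)))"
| "arrow_map (Coord a) U s = (\<lambda>z v. y a v * s z v)"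

definition vertex_endo ::
  "nat \<Rightarrow> 'v bpoint set \<Rightarrow> (nat \<Rightarrow> ('k, 'v) bsection) \<Rightarrow> (nat \<Rightarrow> ('k, 'v) bsection)" where
  "vertex_endo i U \<sigma> = (if zopen U \<and> \<sigma> \<in> sum_sheaf U
     then (\<lambda>j. if j = i then \<sigma> i else 0) else 0)"

definition arrow_endo ::
  "arrow \<Rightarrow> 'v bpoint set \<Rightarrow> (nat \<Rightarrow> ('k, 'v) bsection) \<Rightarrow> (nat \<Rightarrow> ('k, 'v) bsection)" where
  "arrow_endo a U \<sigma> = (if zopen U \<and> \<sigma> \<in> sum_sheaf U
     then (\<lambda>j. if j = head (quiver t) a then arrow_map a U (\<sigma> (tail (quiver t) a)) else 0)
     else 0)"

fun path_endo :: "nat \<times> arrow list \<times> nat \<Rightarrow>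
    'v bpoint set \<Rightarrow> (nat \<Rightarrow> ('k, 'v) bsection) \<Rightarrow> (nat \<Rightarrow> ('k, 'v) bsection)" where
  "path_endo (i, p, j) = foldl (\<lambda>\<phi> a U \<sigma>. arrow_endo a U (\<phi> U \<sigma>)) (vertex_endo i) p"

definition natural_map :: "(nat \<times> arrow list \<times> nat \<Rightarrow> 'k) \<Rightarrow>
    'v bpoint set \<Rightarrow> (nat \<Rightarrow> ('k, 'v) bsection) \<Rightarrow> (nat \<Rightarrow> ('k, 'v) bsection)" where
  "natural_map f = (\<lambda>U \<sigma> j z v. \<Sum>r | f r \<noteq> 0. f r * path_endo r U \<sigma> j z v)"

definition I_X :: "(nat \<times> arrow list \<times> nat \<Rightarrow> 'k) set" where
  "I_X = a_kernel (path_algebra (quiver t)) end_algebra natural_map"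

subsection \<open>The relations\<close>

definition relations_exc :: "nat \<Rightarrow> (nat \<times> arrow list \<times> nat \<Rightarrow> 'k) set" where
  "relations_exc i = {f \<in> path_space (quiver t) i (t + 3).
     (\<Sum>b<2. \<Sum>a<3. fscale (f (i, [Lin i b, Coord a], t + 3)) (tensor (h i b) (y a)))
       \<in> sym2_kernel scale}"

definition relations_lin :: "(nat \<times> arrow list \<times> nat \<Rightarrow> 'k) set" where
  "relations_lin = {f \<in> path_space (quiver t) (t + 1) (t + 2).
     (\<Sum>i=1..t. \<Sum>b<2. fscale (f (t + 1, [Exc i, Lin i b], t + 2)) (h i b)) = 0}"

definition relations_quad :: "(nat \<times> arrow list \<times> nat \<Rightarrow> 'k) set" where
  "relations_quad = {f \<in> path_space (quiver t) (t + 1) (t + 3).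
     (\<Sum>i=1..t. \<Sum>b<2. \<Sum>a<3.
        fscale (f (t + 1, [Exc i, Lin i b, Coord a], t + 3)) (tensor (h i b) (y a)))
       \<in> sym2_kernel scale}"

end

end

theory Submission
  imports Defs
begin

text \<open>
  A path \<open>r\<close> carries a polynomial function \<open>w\<^sub>r\<close> on \<open>V\<close>, the product of the linear forms of its
  arrows. An element \<open>f\<close> of \<open>A\<close> is thereby sent to a matrix of polynomial functions, whose entry from
  \<open>i\<close> to \<open>j\<close> is the sum of \<open>f r * w\<^sub>r\<close> over the paths \<open>r\<close> from \<open>i\<close> to \<open>j\<close>, and products are sent to
  matrix products. Off the exceptional divisors the natural map is multiplication by this
  matrix. The complement of the exceptional divisors is dense in \<open>X\<close>, as every point of \<open>R\<^sub>i\<close> lies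
  on the strict transform of a line through \<open>x\<^sub>i\<close>; hence \<open>I\<^sub>X\<close> is the set of all \<open>f\<close> with vanishing matrix.
  The entries from \<open>i \<le> t\<close> or \<open>t + 1\<close> to \<open>t + 3\<close> and from \<open>t + 1\<close> to \<open>t + 2\<close> vanish exactly on the given
  relations, because a bilinear form on \<open>V\<close> lies in the kernel of the multiplication to
  \<open>S\<^sup>2V\<^sup>*\<close> iff it is alternating. For the other entries the functions of the paths are linearly independent.
\<close>

section \<open>Path algebras\<close>

text \<open>Sections are known only as local fractions of multihomogeneous functions. Density is
  therefore tested on curves given by polynomial functions of one parameter, where it becomes the
  fact that a polynomial function over an infinite field with cofinitely many zeros is zero. The
  same fact passes from the vectors off all \<open>x i\<close> to all vectors of \<open>V\<close>.
  The delicate arrow is \<open>Lin i b\<close>, given by a definite description. Its value exists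
  because \<open>h i b\<close> is divisible by a local equation of the exceptional divisor, and it
  is unique by density. That \<open>I_X\<close> is a two-sided ideal is read off from the matrices:
  an entry of a product is a combination of entries of either factor. Generation then takes only
  addition: a matrix vanishes entry by entry, so the part of \<open>f\<close> between two vertices
  stays in \<open>I_X\<close>, and each part is zero or itself a relation. Alternating means zero on
  the diagonal, so all characteristics are covered.\<close>

lemma path_algebra_sel [simp]:
  "carrier (path_algebra Q) = {f. finite {r. f r \<noteq> 0} \<and> {r. f r \<noteq> 0} \<subseteq> paths Q}"
  "zero (path_algebra Q) = 0"
  "add (path_algebra Q) = (+)"
  by (simp_all add: path_algebra_def)

definition factorizations ::
  "('a, 'b) pre_digraph \<Rightarrow> 'a \<times> 'b list \<times> 'a \<Rightarrow> (('a \<times> 'b list \<times> 'a) \<times> ('a \<times> 'b list \<times> 'a)) set" where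
  "factorizations Q r = {(b, a). b \<in> paths Q \<and> a \<in> paths Q \<and> path_end a = path_start b \<and> path_comp b a = r}"

lemma path_algebra_mult:
  "monoid.mult (path_algebra Q) f g r = (\<Sum>(b, a)\<in>factorizations Q r. f b * g a)"
  by (simp add: path_algebra_def factorizations_def)

section \<open>The ring axioms for a path algebra\<close>

context wf_digraph
begin

lemma paths_appendI:
  "(u, p, v) \<in> paths G \<Longrightarrow> (v, q, w) \<in> paths G \<Longrightarrow> (u, p @ q, w) \<in> paths G"
  by (auto simp: paths_def simp del: awalk_append_iff intro: awalk_appendI)

lemma path_comp_in_paths:
  assumes "b \<in> paths G" "a \<in> paths G" "path_end a = path_start b"
  shows "path_comp b a \<in> paths G"
  using assms by (cases a; cases b) (auto intro: paths_appendI)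

text \<open>A factorization is determined by the length of its first factor, because the middle
  vertex is the end of the walk along that prefix.\<close>

lemma finite_factorizations: "finite (factorizations G r)"
proof -
  obtain u p v where r: "r = (u, p, v)" by (cases r)
  let ?F = "\<lambda>n. ((awlast u (take n p), drop n p, v), (u, take n p, awlast u (take n p)))"
  have "factorizations G r \<subseteq> ?F ` {..length p}"
  proof
    fix x assume "x \<in> factorizations G r"
    then obtain q1 q2 w where x: "x = ((w, q2, v), (u, q1, w))" "p = q1 @ q2" "awalk u q1 w"
      by (auto simp: factorizations_def paths_def r)
    have "awlast u q1 = w" using x(3) by auto
    then have "x = ?F (length q1)" using x by simp
    moreover have "length q1 \<in> {..length p}" using x(2) by simp
    ultimately show "x \<in> ?F ` {..length p}" by (rule image_eqI)
  qed
  then show ?thesis by (rule finite_subset) simp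
qed

text \<open>Both sides run over the ways to cut a path into three. The bijection trades a cut of the
  later factor for a cut of the earlier one.\<close>

lemma path_mult_assoc:
  fixes f g h :: "'a \<times> 'b list \<times> 'a \<Rightarrow> 'k::field"
  defines "m \<equiv> monoid.mult (path_algebra G)"
  shows "m (m f g) h = m f (m g h)"
proof
  fix r
  let ?D = "factorizations G"
  have "m (m f g) h r = (\<Sum>x\<in>?D r. \<Sum>y\<in>?D (fst x). f (fst y) * g (snd y) * h (snd x))"
    by (simp add: m_def path_algebra_mult sum_distrib_right case_prod_beta)
  also have "\<dots> = (\<Sum>(x, y)\<in>Sigma (?D r) (\<lambda>x. ?D (fst x)). f (fst y) * g (snd y) * h (snd x))"
    by (rule sum.Sigma) (simp_all add: finite_factorizations)
  also have "\<dots> = (\<Sum>(x, y)\<in>Sigma (?D r) (\<lambda>x. ?D (snd x)). f (fst x) * (g (fst y) * h (snd y)))"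
    by (rule sum.reindex_bij_witness[where
          i = "\<lambda>(x, y). ((path_comp (fst x) (fst y), snd y), (fst x, fst y))" and
          j = "\<lambda>(x, y). ((fst y, path_comp (snd y) (snd x)), (snd y, snd x))"])
       (auto simp: factorizations_def mult.assoc intro: paths_appendI)
  also have "\<dots> = (\<Sum>x\<in>?D r. \<Sum>y\<in>?D (snd x). f (fst x) * (g (fst y) * h (snd y)))"
    by (rule sum.Sigma[symmetric]) (simp_all add: finite_factorizations)
  also have "\<dots> = m f (m g h) r"
    by (simp add: m_def path_algebra_mult sum_distrib_left case_prod_beta)
  finally show "m (m f g) h r = m f (m g h) r" .
qed

lemma factorizationsE:
  assumes "x \<in> factorizations G (u, p, v)"
  obtains q1 q2 z where "x = ((z, q2, v), (u, q1, z))" "p = q1 @ q2" "awalk u q1 z" "awalk z q2 v"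
  using assms by (auto simp: factorizations_def paths_def)

lemma factorizations_nonpath: "r \<notin> paths G \<Longrightarrow> factorizations G r = {}"
  using path_comp_in_paths by (auto simp: factorizations_def)

lemma path_algebra_one:
  "one (path_algebra G) (u, p, v) = (if u \<in> verts G \<and> p = [] \<and> v = u then 1 else 0)"
  by (auto simp: path_algebra_def)

text \<open>On a path only the factorization \<open>?l\<close> (or \<open>?r\<close>), whose trivial
  factor sits at the end (or start) of the path, contributes. Off the paths there is no
  factorization and \<open>f\<close> is zero.\<close>

lemma path_one_mult:
  fixes f :: "'a \<times> 'b list \<times> 'a \<Rightarrow> 'k::field"
  assumes "f \<in> carrier (path_algebra G)"
  shows "monoid.mult (path_algebra G) (one (path_algebra G)) f = f" (is ?left)
    and "monoid.mult (path_algebra G) f (one (path_algebra G)) = f" (is ?right)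
proof -
  have zero: "f r = 0" if "r \<notin> paths G" for r
    using assms that by auto
  have "monoid.mult (path_algebra G) (one (path_algebra G)) f (u, p, v) = f (u, p, v) \<and>
      monoid.mult (path_algebra G) f (one (path_algebra G)) (u, p, v) = f (u, p, v)" for u p v
  proof (cases "(u, p, v) \<in> paths G")
    case True
    let ?F = "factorizations G (u, p, v)"
    let ?l = "((v, [], v), (u, p, v))" and ?r = "((u, p, v), (u, [], u))"
    have v: "v \<in> verts G" and u: "u \<in> verts G"
      using True unfolding paths_def mem_Collect_eq prod.case
      by (rule awalk_last_in_verts, rule awalk_hd_in_verts)
    have l: "?l \<in> ?F" and r: "?r \<in> ?F"
      using True u v by (simp_all add: factorizations_def paths_def awalk_Nil_iff)
    have n1: "one (path_algebra G) (fst x) * f (snd x) = 0" if m: "x \<in> ?F - {?l}" for x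
    proof -
      obtain q1 q2 z where x: "x = ((z, q2, v), (u, q1, z))" "p = q1 @ q2"
        using factorizationsE[of x u p v] m by blast
      have "x = ?l" if "q2 = [] \<and> z = v"
        using that x by simp
      then have "\<not> (q2 = [] \<and> z = v)" using m by blast
      then show ?thesis unfolding x(1) by (auto simp: path_algebra_one simp del: mult_eq_0_iff)
    qed
    have s1: "(\<Sum>x\<in>?F. one (path_algebra G) (fst x) * f (snd x)) =
        (\<Sum>x\<in>{?l}. one (path_algebra G) (fst x) * f (snd x))"
      using l by (intro sum.mono_neutral_right[OF finite_factorizations] ballI n1) auto
    have n2: "f (fst x) * one (path_algebra G) (snd x) = 0" if m: "x \<in> ?F - {?r}" for x
    proof -
      obtain q1 q2 z where x: "x = ((z, q2, v), (u, q1, z))" "p = q1 @ q2"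
        using factorizationsE[of x u p v] m by blast
      have "x = ?r" if "q1 = [] \<and> z = u"
        using that x by simp
      then have "\<not> (q1 = [] \<and> z = u)" using m by blast
      then show ?thesis unfolding x(1) by (auto simp: path_algebra_one simp del: mult_eq_0_iff)
    qed
    have s2: "(\<Sum>x\<in>?F. f (fst x) * one (path_algebra G) (snd x)) =
        (\<Sum>x\<in>{?r}. f (fst x) * one (path_algebra G) (snd x))"
      using r by (intro sum.mono_neutral_right[OF finite_factorizations] ballI n2) auto
    show ?thesis using u v s1 s2 by (simp add: path_algebra_mult case_prod_beta path_algebra_one)
  next
    case False
    then show ?thesis
      using zero[OF False] by (simp add: path_algebra_mult factorizations_nonpath)
  qed
  then show ?left ?right
    by (simp_all add: fun_eq_iff)
qed

text \<open>The support of a product consists of compositions of paths from the two supports, which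
  are finite.\<close>

lemma path_mult_closed:
  fixes f g :: "'a \<times> 'b list \<times> 'a \<Rightarrow> 'k::field"
  assumes "f \<in> carrier (path_algebra G)" "g \<in> carrier (path_algebra G)"
  shows "monoid.mult (path_algebra G) f g \<in> carrier (path_algebra G)"
proof -
  let ?S = "{r. monoid.mult (path_algebra G) f g r \<noteq> 0}"
  have *: "r \<in> (\<lambda>(b, a). path_comp b a) ` ({r. f r \<noteq> 0} \<times> {r. g r \<noteq> 0}) \<and> r \<in> paths G"
    if "r \<in> ?S" for r
  proof -
    from that have "(\<Sum>(b, a)\<in>factorizations G r. f b * g a) \<noteq> 0"
      by (simp add: path_algebra_mult)
    then obtain x where x: "x \<in> factorizations G r" "(case x of (b, a) \<Rightarrow> f b * g a) \<noteq> 0"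
      by (rule sum.not_neutral_contains_not_neutral)
    have "r = (\<lambda>(b, a). path_comp b a) x"
      using x(1) by (auto simp: factorizations_def)
    moreover have "x \<in> {r. f r \<noteq> 0} \<times> {r. g r \<noteq> 0}"
      using x(2) by (simp add: case_prod_beta mem_Times_iff)
    ultimately have "r \<in> (\<lambda>(b, a). path_comp b a) ` ({r. f r \<noteq> 0} \<times> {r. g r \<noteq> 0})"
      by (rule image_eqI)
    moreover have "r \<in> paths G"
      using x(1) factorizations_nonpath by blast
    ultimately show ?thesis ..
  qed
  have "finite ({r. f r \<noteq> 0} \<times> {r. g r \<noteq> 0})" using assms by simp
  then have "finite ((\<lambda>(b, a). path_comp b a) ` ({r. f r \<noteq> 0} \<times> {r. g r \<noteq> 0}))"
    by (rule finite_imageI)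
  then have "finite ?S" by (rule rev_finite_subset) (use * in blast)
  then show ?thesis using * by auto
qed

text \<open>The unit is the sum of the trivial paths, so finiteness of the vertex set is what gives
  it finite support.\<close>

lemma ring_path_algebra:
  assumes "finite (verts G)"
  shows "ring (path_algebra G :: ('a \<times> 'b list \<times> 'a \<Rightarrow> 'k::field) ring)" (is "ring ?A")
proof (rule ringI)
  have add: "f + g \<in> carrier ?A" if "f \<in> carrier ?A" "g \<in> carrier ?A" for f g
  proof -
    have "{r. (f + g) r \<noteq> 0} \<subseteq> {r. f r \<noteq> 0} \<union> {r. g r \<noteq> 0}" by auto
    then show ?thesis using that by (auto intro: finite_subset)
  qed
  show "abelian_group ?A"
  proof (rule abelian_groupI)
    fix f assume f: "f \<in> carrier ?A"
    show "\<exists>g\<in>carrier ?A. add ?A g f = zero ?A"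
      using f by (intro bexI[of _ "- f"]) auto
  qed (use add in \<open>simp_all add: ac_simps del: path_algebra_sel(1)\<close>, simp_all)
  show "monoid ?A"
  proof (rule monoidI)
    have "one ?A \<in> carrier ?A \<longleftrightarrow> True"
    proof -
      have "{r. one ?A r \<noteq> 0} = (\<lambda>u. (u, [], u)) ` verts G"
        by (auto simp: path_algebra_def)
      then show ?thesis using assms by (auto simp: paths_def awalk_Nil_iff)
    qed
    then show "one ?A \<in> carrier ?A" by simp
  qed (simp_all only: path_mult_closed path_mult_assoc path_one_mult)
qed (auto simp: path_algebra_mult fun_eq_iff case_prod_beta algebra_simps sum.distrib)

end

subsection \<open>Representations\<close>

text \<open>
  A multiplicative weight on paths turns an element of the path algebra into a matrix indexed by
  the vertices; composition of paths becomes matrix multiplication.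
\<close>

definition path_sum ::
  "('a, 'b) pre_digraph \<Rightarrow> ('a \<times> 'b list \<times> 'a \<Rightarrow> 'k::field) \<Rightarrow> ('a \<times> 'b list \<times> 'a \<Rightarrow> 'k) \<Rightarrow> 'a \<Rightarrow> 'a \<Rightarrow> 'k" where
  "path_sum Q w f i j = (\<Sum>r | r \<in> paths Q \<and> path_start r = i \<and> path_end r = j. f r * w r)"

locale weighted_quiver = wf_digraph G for G :: "('a, 'b) pre_digraph" +
  fixes w :: "'a \<times> 'b list \<times> 'a \<Rightarrow> 'k::field"
  assumes finite_paths: "finite (paths G)"
    and weight_comp: "b \<in> paths G \<Longrightarrow> a \<in> paths G \<Longrightarrow> path_end a = path_start b \<Longrightarrow>
      w (path_comp b a) = w b * w a"
begin

lemma weight_append: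
  "(u, p, v) \<in> paths G \<Longrightarrow> (v, q, z) \<in> paths G \<Longrightarrow> w (u, p @ q, z) = w (v, q, z) * w (u, p, v)"
  using weight_comp[of "(v, q, z)" "(u, p, v)"] by simp

lemma path_sum_mult:
  "path_sum G w (monoid.mult (path_algebra G) f g) i j =
    (\<Sum>(b, a) | b \<in> paths G \<and> a \<in> paths G \<and> path_end a = path_start b \<and> path_start a = i \<and> path_end b = j.
      f b * w b * (g a * w a))"
proof -
  let ?P = "{r. r \<in> paths G \<and> path_start r = i \<and> path_end r = j}"
  have "path_sum G w (monoid.mult (path_algebra G) f g) i j =
      (\<Sum>r\<in>?P. \<Sum>x\<in>factorizations G r. f (fst x) * g (snd x) * w r)"
    by (simp add: path_sum_def path_algebra_mult sum_distrib_right case_prod_beta)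
  also have "\<dots> = (\<Sum>(r, x)\<in>Sigma ?P (factorizations G). f (fst x) * g (snd x) * w r)"
    by (rule sum.Sigma) (simp_all add: finite_factorizations finite_paths)
  also have "\<dots> = (\<Sum>(b, a) | b \<in> paths G \<and> a \<in> paths G \<and> path_end a = path_start b \<and>
      path_start a = i \<and> path_end b = j. f b * w b * (g a * w a))"
    by (rule sum.reindex_bij_witness[where i = "\<lambda>(b, a). (path_comp b a, (b, a))" and j = snd])
       (auto simp: factorizations_def weight_append intro: paths_appendI)
  finally show ?thesis .
qed

text \<open>Collecting pairs by the later factor \<open>b\<close> exhibits an entry of the product
  as a combination of entries of the matrix of \<open>g\<close>, so it vanishes with that matrix.
  \<open>path_sum_mult_right\<close> collects by the earlier factor and does the same for
  \<open>f\<close>.\<close>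

lemma path_sum_mult_left:
  "path_sum G w (monoid.mult (path_algebra G) f g) i j =
    (\<Sum>b | b \<in> paths G \<and> path_end b = j. f b * w b * path_sum G w g i (path_start b))"
proof -
  have "(\<Sum>b | b \<in> paths G \<and> path_end b = j. f b * w b * path_sum G w g i (path_start b)) =
      (\<Sum>b | b \<in> paths G \<and> path_end b = j.
        \<Sum>a | a \<in> paths G \<and> path_start a = i \<and> path_end a = path_start b. f b * w b * (g a * w a))"
    by (simp add: path_sum_def sum_distrib_left)
  also have "\<dots> = (\<Sum>(b, a)\<in>Sigma {b. b \<in> paths G \<and> path_end b = j}
      (\<lambda>b. {a. a \<in> paths G \<and> path_start a = i \<and> path_end a = path_start b}). f b * w b * (g a * w a))"
    by (rule sum.Sigma) (simp_all add: finite_paths)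
  finally show ?thesis
    unfolding path_sum_mult by (simp add: Sigma_def) (rule sum.cong; auto)
qed

lemma path_sum_mult_right:
  "path_sum G w (monoid.mult (path_algebra G) f g) i j =
    (\<Sum>a | a \<in> paths G \<and> path_start a = i. path_sum G w f (path_end a) j * (g a * w a))"
proof -
  have "(\<Sum>a | a \<in> paths G \<and> path_start a = i. path_sum G w f (path_end a) j * (g a * w a)) =
      (\<Sum>a | a \<in> paths G \<and> path_start a = i.
        \<Sum>b | b \<in> paths G \<and> path_start b = path_end a \<and> path_end b = j. f b * w b * (g a * w a))"
    by (simp add: path_sum_def sum_distrib_right)
  also have "\<dots> = (\<Sum>(a, b)\<in>Sigma {a. a \<in> paths G \<and> path_start a = i}
      (\<lambda>a. {b. b \<in> paths G \<and> path_start b = path_end a \<and> path_end b = j}). f b * w b * (g a * w a))"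
    by (rule sum.Sigma) (simp_all add: finite_paths)
  also have "\<dots> = (\<Sum>(b, a) | b \<in> paths G \<and> a \<in> paths G \<and> path_end a = path_start b \<and>
      path_start a = i \<and> path_end b = j. f b * w b * (g a * w a))"
    by (rule sum.reindex_bij_witness[where i = prod.swap and j = prod.swap]) auto
  finally show ?thesis
    unfolding path_sum_mult ..
qed

end

lemma path_sum_add: "path_sum G w (f + g) i j = path_sum G w f i j + path_sum G w g i j"
  by (simp add: path_sum_def algebra_simps sum.distrib)

lemma path_sum_minus: "path_sum G w (- f) i j = - path_sum G w f i j"
  by (simp add: path_sum_def sum_negf)

text \<open>A matrix of polynomial functions is handled pointwise: each parameter \<open>s\<close>,
  later a vector of \<open>V\<close>, has its own field-valued weight, and the kernels are
  intersected over all of them.\<close>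

lemma ideal_path_sum_kernel:
  assumes "\<And>s. s \<in> S \<Longrightarrow> weighted_quiver G (w s)" "wf_digraph G" "finite (verts G)"
  shows "ideal {f \<in> carrier (path_algebra G). \<forall>s\<in>S. \<forall>i j. path_sum G (w s) f i j = 0} (path_algebra G)"
    (is "ideal ?I ?A")
proof (rule idealI)
  show r: "ring ?A" by (rule wf_digraph.ring_path_algebra[OF assms(2,3)])
  then interpret ring ?A .
  have inv: "a_inv ?A f = - f" if f: "f \<in> carrier ?A" for f
    by (rule minus_equality) (use f in auto)
  show "subgroup ?I (add_monoid ?A)"
  proof (rule add.subgroupI)
    show "?I \<noteq> {}" by (auto intro!: exI[of _ 0] simp: path_sum_def)
    fix f assume f: "f \<in> ?I"
    then have "- f \<in> carrier ?A" by auto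
    moreover have "a_inv ?A f = - f" using f by (intro inv) blast
    ultimately show "a_inv ?A f \<in> ?I" using f by (simp add: path_sum_minus)
  next
    fix f g assume fg: "f \<in> ?I" "g \<in> ?I"
    then have "f \<in> carrier ?A" "g \<in> carrier ?A" by blast+
    then have "add ?A f g \<in> carrier ?A" by (rule a_closed)
    then show "add ?A f g \<in> ?I" using fg by (simp add: path_sum_add)
  qed auto
  fix f g assume fg: "f \<in> ?I" "g \<in> carrier ?A"
  then have "f \<in> carrier ?A" by blast
  then have "monoid.mult ?A g f \<in> carrier ?A" "monoid.mult ?A f g \<in> carrier ?A"
    using fg(2) by (rule m_closed[rotated], rule m_closed)
  moreover have "path_sum G (w s) (monoid.mult ?A g f) i j = 0" if "s \<in> S" for s i j
    unfolding weighted_quiver.path_sum_mult_left[OF assms(1)[OF that]] using fg(1) that by simp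
  moreover have "path_sum G (w s) (monoid.mult ?A f g) i j = 0" if "s \<in> S" for s i j
    unfolding weighted_quiver.path_sum_mult_right[OF assms(1)[OF that]] using fg(1) that by simp
  ultimately show "monoid.mult ?A g f \<in> ?I" "monoid.mult ?A f g \<in> ?I"
    by blast+
qed

section \<open>Linear forms and polynomial curves\<close>

lemma sum_fun_apply: "(\<Sum>a\<in>A. f a) x = (\<Sum>a\<in>A. f a x)"
  by (induction A rule: infinite_finite_induct) auto

section \<open>Spaces of functions and their indexed bases\<close>

lemma vector_space_fscale: "vector_space (fscale :: 'k::field \<Rightarrow> ('a \<Rightarrow> 'k) \<Rightarrow> _)"
  by unfold_locales (auto simp: fscale_def fun_eq_iff algebra_simps)

lemma vector_space_mult: "vector_space ((*) :: 'k::field \<Rightarrow> 'k \<Rightarrow> 'k)"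
  by unfold_locales (auto simp: algebra_simps)

lemma basis_family_mem:
  assumes "basis_family n b W" "i < n" shows "b i \<in> W"
proof -
  interpret fs: vector_space fscale by (rule vector_space_fscale)
  show ?thesis using assms fs.span_superset[of "b ` {..<n}"] by (auto simp: basis_family_def)
qed

lemma basis_family_coeffs:
  fixes b :: "nat \<Rightarrow> 'a \<Rightarrow> 'k::field"
  assumes "basis_family n b W" "f \<in> W"
  obtains c where "f = (\<lambda>v. \<Sum>i<n. c i * b i v)"
proof -
  interpret fs: vector_space "fscale :: 'k \<Rightarrow> ('a \<Rightarrow> 'k) \<Rightarrow> _" by (rule vector_space_fscale)
  have inj: "inj_on b {..<n}" and "f \<in> fs.span (b ` {..<n})"
    using assms by (auto simp: basis_family_def)
  then obtain u where "f = (\<Sum>g\<in>b ` {..<n}. fscale (u g) g)"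
    by (auto simp: fs.span_finite)
  then have "f = (\<Sum>i<n. fscale (u (b i)) (b i))"
    by (simp add: sum.reindex[OF inj])
  then have "f = (\<lambda>v. \<Sum>i<n. u (b i) * b i v)"
    by (simp add: fun_eq_iff fscale_def sum_fun_apply)
  then show ?thesis by (rule that)
qed

lemma basis_family_independent:
  fixes b :: "nat \<Rightarrow> 'a \<Rightarrow> 'k::field"
  assumes "basis_family n b W" "\<And>v. (\<Sum>i<n. c i * b i v) = 0" "i < n"
  shows "c i = 0"
proof -
  interpret fs: vector_space "fscale :: 'k \<Rightarrow> ('a \<Rightarrow> 'k) \<Rightarrow> _" by (rule vector_space_fscale)
  have inj: "inj_on b {..<n}" and ind: "fs.independent (b ` {..<n})"
    using assms by (auto simp: basis_family_def)
  \<comment> \<open>Independence is a property of the set of basis vectors, so the coefficients are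
    carried from indices to vectors along the inverse of \<open>b\<close>.\<close>
  define u where "u = (\<lambda>g. c (the_inv_into {..<n} b g))"
  have u: "u (b i) = c i" if "i < n" for i
    using the_inv_into_f_f[OF inj] that by (simp add: u_def)
  have "(\<Sum>g\<in>b ` {..<n}. fscale (u g) g) = (\<Sum>i<n. fscale (c i) (b i))"
    by (simp add: sum.reindex[OF inj] u)
  also have "\<dots> = 0"
    using assms(2) by (simp add: fun_eq_iff fscale_def sum_fun_apply)
  finally have "u (b i) = 0"
    using fs.independentD[OF ind, of "b ` {..<n}" u "b i"] assms(3) by simp
  then show ?thesis using u[OF assms(3)] by simp
qed

section \<open>Linear forms and points of the projective space\<close>

context vector_space
begin

lemma dual_space_iff:
  "f \<in> dual_space scale \<longleftrightarrow> (\<forall>u v. f (u + v) = f u + f v) \<and> (\<forall>c v. f (scale c v) = c * f v)"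
  by (simp add: dual_space_def Vector_Spaces.linear_iff vector_space_axioms vector_space_mult)

lemma dual_add: "f \<in> dual_space scale \<Longrightarrow> f (u + v) = f u + f v"
  and dual_scale: "f \<in> dual_space scale \<Longrightarrow> f (scale c v) = c * f v"
  by (auto simp: dual_space_iff)

lemma dual_zero: "f \<in> dual_space scale \<Longrightarrow> f 0 = 0"
  using dual_scale[of f 0 0] by simp

lemma dual_diff: "f \<in> dual_space scale \<Longrightarrow> f (u - v) = f u - f v"
  using dual_add[of f "u - v" v] by simp

lemma subspace_dual_kernel: "f \<in> dual_space scale \<Longrightarrow> subspace {u. f u = 0}"
  by (auto simp: subspace_def dual_add dual_scale dual_zero)

lemma dual_space_combine:
  "f \<in> dual_space scale \<Longrightarrow> g \<in> dual_space scale \<Longrightarrow> (\<lambda>u. a * f u + b * g u) \<in> dual_space scale"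
  by (simp add: dual_space_iff algebra_simps)

text \<open>Since \<open>v\<close> extends a basis of \<open>S\<close> to an independent set, a form
  may be prescribed as 1 at \<open>v\<close> and 0 on that basis.\<close>

lemma separating_form:
  assumes "subspace S" "v \<notin> S"
  obtains f where "f \<in> dual_space scale" "f v = 1" "\<And>u. u \<in> S \<Longrightarrow> f u = 0"
proof -
  interpret vp: vector_space_pair scale "(*) :: 'a \<Rightarrow> 'a \<Rightarrow> 'a"
    using vector_space_axioms vector_space_mult by (simp add: vector_space_pair_def)
  obtain B where B: "B \<subseteq> S" "independent B" "S \<subseteq> span B"
    using basis_exists by metis
  have "span B = S" using B assms(1) by (simp add: span_subspace)
  then have ind: "independent (insert v B)" "v \<notin> B"
    using B assms(2) independent_insertI span_superset by auto
  obtain f where f: "Vector_Spaces.linear scale (*) f" "\<forall>u\<in>insert v B. f u = (if u = v then 1 else 0)"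
    using vp.linear_independent_extend[OF ind(1), of "\<lambda>u. if u = v then 1 else 0"] by auto
  then have fd: "f \<in> dual_space scale" by (simp add: dual_space_def)
  have "B \<subseteq> {u. f u = 0}" using f(2) ind(2) by auto
  then have "span B \<subseteq> {u. f u = 0}"
    using subspace_dual_kernel[OF fd] by (rule span_minimal)
  then show ?thesis using that[OF fd] f(2) \<open>span B = S\<close> by auto
qed

text \<open>Every vector differs from a multiple of a fixed \<open>w\<close> off the kernel by an
  element of the common kernel. This is the uniqueness up to scaling of the covector coordinates of
  a point.\<close>

lemma dual_proportional:
  assumes "f \<in> dual_space scale" "g \<in> dual_space scale" "{u. f u = 0} = {u. g u = 0}"
  obtains c where "c \<noteq> 0" "g = (\<lambda>u. c * f u)"
proof (cases "\<exists>w. f w \<noteq> 0")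
  case True
  then obtain w where w: "f w \<noteq> 0" "g w \<noteq> 0" using assms(3) by auto
  have "g u = g w / f w * f u" for u
  proof -
    have "f (u - scale (f u / f w) w) = 0"
      using w assms(1) by (simp add: dual_diff dual_scale)
    then have "g (u - scale (f u / f w) w) = 0" using assms(3) by auto
    then show ?thesis using w assms(2) by (simp add: dual_diff dual_scale)
  qed
  then have "g = (\<lambda>u. g w / f w * f u)" by blast
  moreover have "g w / f w \<noteq> 0" using w by simp
  ultimately show ?thesis using that by blast
next
  case False
  then have "g u = 0" "f u = 0" for u using assms(3) by auto
  then show ?thesis by (intro that[of 1]) auto
qed

lemma proj_space_subspace: "p \<in> proj_space scale \<Longrightarrow> subspace p"
  by (simp add: proj_space_def)

lemma proj_space_span:
  assumes "v \<noteq> 0" shows "span {v} \<in> proj_space scale"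
proof -
  have "dim (span {v}) = card {v}"
    by (rule dim_span_eq_card_independent) (use assms in simp)
  then show ?thesis by (simp add: proj_space_def)
qed

lemma proj_space_eq_span:
  assumes "p \<in> proj_space scale" "v \<in> p" "v \<noteq> 0"
  shows "p = span {v}"
proof -
  obtain B where B: "B \<subseteq> p" "independent B" "p \<subseteq> span B" "card B = dim p"
    using basis_exists by metis
  then have "card B = 1" using assms by (simp add: proj_space_def)
  then obtain b where b: "B = {b}" by (auto simp: card_1_singleton_iff)
  obtain c where c: "v = scale c b"
    using B b assms by (auto simp: span_singleton)
  then have "b = scale (inverse c) v" using assms by auto
  then have "b \<in> span {v}" by (simp add: span_base span_scale)
  then have "span B \<subseteq> span {v}" using b by (simp add: span_minimal)
  moreover have "span {v} \<subseteq> p"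
    using assms by (simp add: span_minimal proj_space_def)
  ultimately show ?thesis using B by auto
qed

lemma proj_space_nonzero:
  assumes "p \<in> proj_space scale" obtains v where "v \<in> p" "v \<noteq> 0"
proof -
  have "p \<noteq> {0}"
  proof
    assume "p = {0}"
    then have "dim p = 0" using dim_eq_card[of "{}" p] independent_empty by simp
    then show False using assms by (simp add: proj_space_def)
  qed
  moreover have "0 \<in> p" using assms subspace_0 by (auto simp: proj_space_def)
  ultimately show ?thesis using that by auto
qed

lemma proj_space_inter:
  assumes "p \<in> proj_space scale" "q \<in> proj_space scale" "v \<in> p" "v \<in> q" "v \<noteq> 0"
  shows "p = q"
  using assms proj_space_eq_span by metis

end

text \<open>Expand the form in the coordinate functions \<theta> of a basis \<open>p\<close>,
  \<open>q\<close>, \<open>r\<close>: with zero diagonal and hence skew, only the three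
  antisymmetrized tensors of the \<theta> remain. The hypothesis concerns the diagonal because that
  is what a path sum evaluates, and because skewness is weaker in characteristic 2.\<close>

lemma alternating_in_sym2_kernel:
  fixes scale :: "'k::field \<Rightarrow> 'v::ab_group_add \<Rightarrow> 'v"
  assumes "vector_space scale" "vector_space.dim scale (UNIV :: 'v set) = 3"
    and fin: "finite S" and dual: "\<And>s. s \<in> S \<Longrightarrow> f s \<in> dual_space scale \<and> g s \<in> dual_space scale"
    and alt: "\<And>v. (\<Sum>s\<in>S. c s * (f s v * g s v)) = 0"
  shows "(\<Sum>s\<in>S. fscale (c s) (tensor (f s) (g s))) \<in> sym2_kernel scale"
proof -
  interpret vector_space scale by fact
  interpret fs: vector_space "fscale :: 'k \<Rightarrow> ('v \<times> 'v \<Rightarrow> 'k) \<Rightarrow> _" by (rule vector_space_fscale)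
  define b where "b = (\<lambda>u v. \<Sum>s\<in>S. c s * (f s u * g s v))"
  have add1: "b (u + u') v = b u v + b u' v" and add2: "b v (u + u') = b v u + b v u'" for u u' v
    unfolding b_def sum.distrib[symmetric]
    by (rule sum.cong; simp add: dual dual_add algebra_simps)+
  have scale1: "b (scale a u) v = a * b u v" and scale2: "b v (scale a u) = a * b v u" for a u v
    unfolding b_def sum_distrib_left
    by (rule sum.cong; simp add: dual dual_scale algebra_simps)+
  have zero: "b u u = 0" for u using alt by (simp add: b_def)
  have skew: "b u v = - b v u" for u v
  proof -
    have "0 = b u u + b v u + (b u v + b v v)"
      using zero[of "u + v"] by (simp only: add1 add2)
    then show ?thesis by (simp add: zero eq_neg_iff_add_eq_0 add.commute)
  qed
  obtain B where B: "independent B" "span B = UNIV" "card B = 3"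
    using basis_exists[of UNIV] assms(2) by (metis top.extremum_uniqueI)
  obtain p q r where pqr: "B = {p, q, r}" "p \<noteq> q" "q \<noteq> r" "p \<noteq> r"
    using B(3) by (auto simp: card_3_iff)
  define \<theta> where "\<theta> = (\<lambda>e v. representation B v e)"
  have \<theta>: "\<theta> e \<in> dual_space scale" for e
    using B by (simp add: \<theta>_def dual_space_iff representation_add representation_scale)
  have expand: "scale (\<theta> p v) p + scale (\<theta> q v) q + scale (\<theta> r v) r = v" for v
    using sum_representation_eq[of B v B] B pqr by (auto simp: \<theta>_def add.assoc)
  have b_eq: "b u v = b p q * (\<theta> p u * \<theta> q v - \<theta> q u * \<theta> p v) +
     b p r * (\<theta> p u * \<theta> r v - \<theta> r u * \<theta> p v) + b q r * (\<theta> q u * \<theta> r v - \<theta> r u * \<theta> q v)" for u v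
  proof -
    have "b u v = b (scale (\<theta> p u) p + scale (\<theta> q u) q + scale (\<theta> r u) r)
        (scale (\<theta> p v) p + scale (\<theta> q v) q + scale (\<theta> r v) r)"
      by (simp only: expand)
    also have "\<dots> = b p q * (\<theta> p u * \<theta> q v - \<theta> q u * \<theta> p v) +
        b p r * (\<theta> p u * \<theta> r v - \<theta> r u * \<theta> p v) + b q r * (\<theta> q u * \<theta> r v - \<theta> r u * \<theta> q v)"
      by (simp add: add1 add2 scale1 scale2 zero skew[of q p] skew[of r p] skew[of r q] algebra_simps)
    finally show ?thesis .
  qed
  have "(\<Sum>s\<in>S. fscale (c s) (tensor (f s) (g s))) = (\<lambda>(u, v). b u v)"
    by (auto simp: fun_eq_iff fscale_def tensor_def sum_fun_apply b_def)
  also have "\<dots> =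
      fscale (b p q) (tensor (\<theta> p) (\<theta> q) - tensor (\<theta> q) (\<theta> p)) +
      fscale (b p r) (tensor (\<theta> p) (\<theta> r) - tensor (\<theta> r) (\<theta> p)) +
      fscale (b q r) (tensor (\<theta> q) (\<theta> r) - tensor (\<theta> r) (\<theta> q))"
    by (simp add: fun_eq_iff fscale_def tensor_def) (intro allI b_eq)
  also have "\<dots> \<in> sym2_kernel scale"
    unfolding sym2_kernel_def
    by (intro fs.span_add fs.span_scale fs.span_base) (use \<theta> in auto)
  finally show ?thesis .
qed

lemma sym2_kernel_diagonal:
  fixes scale :: "'k::field \<Rightarrow> 'v::ab_group_add \<Rightarrow> 'v"
  assumes "B \<in> sym2_kernel scale" shows "B (v, v) = 0"
proof -
  interpret fs: vector_space "fscale :: 'k \<Rightarrow> ('v \<times> 'v \<Rightarrow> 'k) \<Rightarrow> _" by (rule vector_space_fscale)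
  have "sym2_kernel scale \<subseteq> {B. B (v, v) = 0}"
    unfolding sym2_kernel_def
    by (rule fs.span_minimal) (auto simp: tensor_def fs.subspace_def fscale_def)
  then show ?thesis using assms by auto
qed

subsection \<open>Polynomial functions of one variable\<close>

text \<open>As a predicate on functions it is closed under pointwise operations, so multihomogeneous
  functions can be composed with a curve without writing down polynomials.\<close>

definition poly_fun :: "('k::field \<Rightarrow> 'k) \<Rightarrow> bool" where
  "poly_fun \<phi> \<longleftrightarrow> (\<exists>q. \<phi> = poly q)"

lemma poly_fun_const: "poly_fun (\<lambda>_. c)"
  unfolding poly_fun_def by (rule exI[of _ "[:c:]"]) auto

lemma poly_fun_ident: "poly_fun (\<lambda>s. s)"
  unfolding poly_fun_def by (rule exI[of _ "[:0, 1:]"]) auto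

lemma poly_fun_add: "poly_fun \<phi> \<Longrightarrow> poly_fun \<psi> \<Longrightarrow> poly_fun (\<lambda>s. \<phi> s + \<psi> s)"
  unfolding poly_fun_def by (elim exE, rule_tac x = "q + qa" in exI) auto

lemma poly_fun_diff: "poly_fun \<phi> \<Longrightarrow> poly_fun \<psi> \<Longrightarrow> poly_fun (\<lambda>s. \<phi> s - \<psi> s)"
  unfolding poly_fun_def by (elim exE, rule_tac x = "q - qa" in exI) auto

lemma poly_fun_mult: "poly_fun \<phi> \<Longrightarrow> poly_fun \<psi> \<Longrightarrow> poly_fun (\<lambda>s. \<phi> s * \<psi> s)"
  unfolding poly_fun_def by (elim exE, rule_tac x = "q * qa" in exI) auto

lemma poly_fun_sum: "(\<And>a. a \<in> A \<Longrightarrow> poly_fun (\<phi> a)) \<Longrightarrow> poly_fun (\<lambda>s. \<Sum>a\<in>A. \<phi> a s)"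
  by (induction A rule: infinite_finite_induct) (simp_all add: poly_fun_const poly_fun_add)

lemma poly_fun_finite_zeros:
  assumes "poly_fun \<phi>" "\<phi> s0 \<noteq> 0" shows "finite {s. \<phi> s = 0}"
proof -
  obtain q where "\<phi> = poly q" using assms(1) by (auto simp: poly_fun_def)
  moreover from this have "q \<noteq> 0" using assms(2) by auto
  ultimately show ?thesis using poly_roots_finite[of q] by simp
qed

text \<open>Over a finite field the product of all \<open>X - a\<close>, plus 1, has positive degree
  but takes the value 1 everywhere.\<close>

lemma infinite_UNIV_alg_closed: "infinite (UNIV :: 'k::alg_closed_field set)"
proof
  assume fin: "finite (UNIV :: 'k set)"
  define p where "p = (\<Prod>a\<in>(UNIV :: 'k set). [:- a, 1:]) + 1"
  have "poly p a = 1" for a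
  proof -
    have "(\<Prod>b\<in>(UNIV :: 'k set). a - b) = 0"
      using fin by (intro prod_zero) auto
    then show ?thesis by (simp add: p_def poly_prod)
  qed
  moreover have "degree p > 0"
  proof -
    have "degree (\<Prod>a\<in>(UNIV :: 'k set). [:- a, 1:]) = card (UNIV :: 'k set)"
      by (subst degree_prod_sum_eq) auto
    moreover have "card (UNIV :: 'k set) > 0" using fin by (simp add: card_gt_0_iff)
    ultimately show ?thesis by (simp add: p_def degree_add_eq_left)
  qed
  then obtain a where "poly p a = 0" using alg_closed_imp_poly_has_root by blast
  ultimately show False by simp
qed

text \<open>The zeros of a nonzero polynomial are finite in number while the field is infinite. Both
  density arguments end here: sections across an exceptional divisor, and path sums from generic
  vectors to all vectors.\<close>

lemma poly_fun_zero:
  fixes \<phi> :: "'k::alg_closed_field \<Rightarrow> 'k"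
  assumes "poly_fun \<phi>" "finite E" "\<And>s. s \<notin> E \<Longrightarrow> \<phi> s = 0"
  shows "\<phi> s = 0"
proof (rule ccontr)
  assume "\<phi> s \<noteq> 0"
  then have "finite {s. \<phi> s = 0}" by (rule poly_fun_finite_zeros[OF assms(1)])
  moreover have "UNIV \<subseteq> E \<union> {s. \<phi> s = 0}" using assms(3) by blast
  ultimately show False
    using assms(2) infinite_UNIV_alg_closed finite_subset by blast
qed

section \<open>Points in the plane and their blow-up\<close>

locale blown_up_points = blown_up_plane_bases scale t x h y
  for scale :: "'k::alg_closed_field \<Rightarrow> 'v::ab_group_add \<Rightarrow> 'v" and t x h y +
  assumes dim_3: "dim (UNIV :: 'v set) = 3"
    and t_pos: "t > 0"
    and x_point: "\<And>i. i \<in> {1..t} \<Longrightarrow> x i \<in> proj_space scale"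
    and x_inj: "inj_on x {1..t}"
    and h_basis: "\<And>i. i \<in> {1..t} \<Longrightarrow> basis_family 2 (h i) (forms_through scale (x i))"
    and y_basis: "basis_family 3 y (dual_space scale)"
begin

section \<open>Lines, planes and forms in the three-dimensional space\<close>

lemma finite_dimensional: obtains B where "finite_dimensional_vector_space scale B"
proof -
  obtain B where B: "independent B" "UNIV \<subseteq> span B" "card B = 3"
    using basis_exists[of UNIV] dim_3 by metis
  then have "finite B" by (simp add: card_ge_0_finite)
  with B have "finite_dimensional_vector_space scale B"
    by unfold_locales auto
  then show ?thesis by (rule that)
qed

text \<open>The kernel and one vector \<open>w\<close> off it span the whole space of dimension
  3.\<close>

lemma dim_dual_kernel:
  assumes f: "f \<in> dual_space scale" and w: "f w \<noteq> 0"
  shows "dim {u. f u = 0} = 2"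
proof -
  obtain B where "finite_dimensional_vector_space scale B" by (rule finite_dimensional)
  then interpret fd: finite_dimensional_vector_space scale B .
  let ?K = "{u. f u = 0}"
  have K: "subspace ?K" using f by (rule subspace_dual_kernel)
  have "u \<in> span (insert w ?K)" for u
  proof -
    have "f (u - scale (f u / f w) w) = 0"
      using w f by (simp add: dual_diff dual_scale)
    then have "u - scale (f u / f w) w \<in> span ?K" by (simp add: span_base)
    then show ?thesis unfolding span_breakdown_eq by blast
  qed
  then have "span (insert w ?K) = UNIV" by blast
  then have "dim (insert w ?K) = 3" using dim_3 dim_span by metis
  moreover have "span ?K \<subseteq> ?K" using K by (intro span_minimal subset_refl)
  then have "w \<notin> span ?K" using w by blast
  ultimately show ?thesis by (simp add: fd.dim_insert)
qed

text \<open>A form that is zero on \<open>L\<close> and nonzero at some vector off \<open>L\<close>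
  has a kernel that contains \<open>L\<close> and has the same dimension 2.\<close>

lemma plane_is_kernel:
  assumes "subspace L" "dim L = 2"
  obtains f w where "f \<in> dual_space scale" "f w \<noteq> 0" "L = {u. f u = 0}"
proof -
  obtain B where "finite_dimensional_vector_space scale B" by (rule finite_dimensional)
  then interpret fd: finite_dimensional_vector_space scale B .
  have "L \<noteq> UNIV" using assms dim_3 by auto
  then obtain w where "w \<notin> L" by auto
  then obtain f where f: "f \<in> dual_space scale" "f w = 1" "\<And>u. u \<in> L \<Longrightarrow> f u = 0"
    using separating_form assms(1) by metis
  have "L = {u. f u = 0}"
    by (rule fd.subspace_dim_equal[OF assms(1) subspace_dual_kernel[OF f(1)]])
       (use f dim_dual_kernel[of f w] assms(2) in auto)
  then show ?thesis using that[of f w] f(1,2) by (simp only: zero_neq_one[symmetric] not_False_eq_True)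
qed

text \<open>As \<open>p\<close> and \<open>q\<close> may coincide, their span need not be a plane;
  the kernel of a nonzero form that vanishes on both always is one.\<close>

lemma plane_through:
  assumes "p \<in> proj_space scale" "q \<in> proj_space scale"
  obtains L where "subspace L" "dim L = 2" "p \<subseteq> L" "q \<subseteq> L"
proof -
  obtain a where a: "a \<in> p" "a \<noteq> 0" using assms(1) by (rule proj_space_nonzero)
  obtain b where b: "b \<in> q" "b \<noteq> 0" using assms(2) by (rule proj_space_nonzero)
  have "dim (span {a, b}) \<le> card {a, b}"
    by (rule dim_le_card) auto
  also have "\<dots> \<le> 2" by (simp add: card_insert_if)
  finally have "dim (span {a, b}) \<noteq> dim UNIV" using dim_3 by simp
  then have "span {a, b} \<noteq> UNIV" by metis
  then obtain w where "w \<notin> span {a, b}" by auto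
  then obtain f where f: "f \<in> dual_space scale" "f w = 1" "\<And>u. u \<in> span {a, b} \<Longrightarrow> f u = 0"
    using separating_form subspace_span by metis
  have "span {a} \<subseteq> span {a, b}" "span {b} \<subseteq> span {a, b}" by (simp_all add: span_mono)
  then have "p \<subseteq> {u. f u = 0}" "q \<subseteq> {u. f u = 0}"
    using f(3) proj_space_eq_span[OF assms(1) a] proj_space_eq_span[OF assms(2) b] by auto
  then show ?thesis
    using that[of "{u. f u = 0}"] subspace_dual_kernel[OF f(1)] dim_dual_kernel[OF f(1), of w] f(2) by simp
qed

lemma h_through: "i \<in> {1..t} \<Longrightarrow> b < 2 \<Longrightarrow> h i b \<in> forms_through scale (x i)"
  using basis_family_mem h_basis by blast

lemma h_dual: "i \<in> {1..t} \<Longrightarrow> b < 2 \<Longrightarrow> h i b \<in> dual_space scale"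
  and h_vanish: "i \<in> {1..t} \<Longrightarrow> b < 2 \<Longrightarrow> v \<in> x i \<Longrightarrow> h i b v = 0"
  using h_through by (auto simp: forms_through_def)

lemma y_dual: "a < 3 \<Longrightarrow> y a \<in> dual_space scale"
  using basis_family_mem y_basis by blast

lemma form_through_coeffs:
  assumes "i \<in> {1..t}" "f \<in> forms_through scale (x i)"
  obtains \<alpha> \<beta> where "\<And>v. f v = \<alpha> * h i 0 v + \<beta> * h i 1 v"
proof -
  obtain c where "f = (\<lambda>v. \<Sum>b<2. c b * h i b v)"
    using basis_family_coeffs[OF h_basis[OF assms(1)] assms(2)] by blast
  then show ?thesis using that[of "c 0" "c 1"] by (simp add: numeral_2_eq_2)
qed

text \<open>A form separating \<open>v\<close> from \<open>x i\<close> would be a combination of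
  \<open>h i 0\<close> and \<open>h i 1\<close>, which both vanish at \<open>v\<close>.\<close>

lemma in_x_iff:
  assumes "i \<in> {1..t}"
  shows "v \<in> x i \<longleftrightarrow> h i 0 v = 0 \<and> h i 1 v = 0"
proof
  assume "v \<in> x i" then show "h i 0 v = 0 \<and> h i 1 v = 0" using h_vanish assms by simp
next
  assume 0: "h i 0 v = 0 \<and> h i 1 v = 0"
  show "v \<in> x i"
  proof (rule ccontr)
    assume "v \<notin> x i"
    then obtain f where f: "f \<in> dual_space scale" "f v = 1" "\<And>u. u \<in> x i \<Longrightarrow> f u = 0"
      using separating_form[OF proj_space_subspace[OF x_point[OF assms]]] by metis
    then have "f \<in> forms_through scale (x i)" by (simp add: forms_through_def)
    then obtain \<alpha> \<beta> where "\<And>v. f v = \<alpha> * h i 0 v + \<beta> * h i 1 v"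
      using form_through_coeffs assms by metis
    then show False using f(2) 0 by simp
  qed
qed

lemma y_nonzero: assumes "v \<noteq> 0" shows "\<exists>a<3. y a v \<noteq> 0"
proof (rule ccontr)
  assume "\<not> ?thesis"
  then have 0: "y a v = 0" if "a < 3" for a using that by blast
  obtain f where f: "f \<in> dual_space scale" "f v = 1"
    using separating_form[of "{0}" v] assms by auto
  obtain c where "f = (\<lambda>v. \<Sum>a<3. c a * y a v)"
    using basis_family_coeffs[OF y_basis f(1)] by blast
  then have "f v = 0" using 0 by simp
  then show False using f by simp
qed

text \<open>These vectors represent the complement of all exceptional divisors, where every arrow
  acts as multiplication by a number.\<close>

definition generic :: "'v \<Rightarrow> bool" where
  "generic v \<longleftrightarrow> (\<forall>i\<in>{1..t}. v \<notin> x i)"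

text \<open>The zero vector lies in \<open>x 1\<close>. With no blown-up point it would count as
  generic, which is why \<open>t_pos\<close> enters.\<close>

lemma generic_nonzero: "generic v \<Longrightarrow> v \<noteq> 0"
  unfolding generic_def using subspace_0[OF proj_space_subspace[OF x_point[of 1]]] t_pos by auto

lemma poly_fun_line: "f \<in> dual_space scale \<Longrightarrow> poly_fun (\<lambda>s. f (v + scale s w))"
  by (simp add: dual_add dual_scale poly_fun_add poly_fun_mult poly_fun_const poly_fun_ident)

text \<open>Where the line leaves \<open>x j\<close>, one of \<open>h j 0\<close>,
  \<open>h j 1\<close> is nonzero. Restricted to the line this form is a polynomial function with
  finitely many zeros, and \<open>x j\<close> lies among its zeros.\<close>

lemma finite_line_exceptions:
  assumes J: "J \<subseteq> {1..t}" and s: "\<And>j. j \<in> J \<Longrightarrow> \<exists>s. v + scale s w \<notin> x j"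
  shows "finite {s. \<exists>j\<in>J. v + scale s w \<in> x j}"
proof -
  have "finite {s. v + scale s w \<in> x j}" if j: "j \<in> J" for j
  proof -
    have jt: "j \<in> {1..t}" using J j by auto
    obtain s where "v + scale s w \<notin> x j" using s[OF j] by auto
    then obtain b where b: "b < 2" "h j b (v + scale s w) \<noteq> 0"
      using in_x_iff[OF jt] by (metis one_less_numeral_iff semiring_norm(76) zero_less_numeral)
    have "finite {s. h j b (v + scale s w) = 0}"
      by (rule poly_fun_finite_zeros[OF poly_fun_line[OF h_dual[OF jt b(1)]] b(2)])
    then show ?thesis
      by (rule rev_finite_subset) (use h_vanish jt b(1) in auto)
  qed
  moreover have "{s. \<exists>j\<in>J. v + scale s w \<in> x j} = (\<Union>j\<in>J. {s. v + scale s w \<in> x j})" by auto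
  moreover have "finite J" using J finite_subset by blast
  ultimately show ?thesis by simp
qed

lemma x_not_UNIV: "i \<in> {1..t} \<Longrightarrow> x i \<noteq> UNIV"
proof
  assume "i \<in> {1..t}" "x i = UNIV"
  then have "dim (UNIV :: 'v set) = 1" using x_point[of i] by (simp add: proj_space_def)
  then show False using dim_3 by simp
qed

text \<open>The points are avoided one at a time: on the line from a vector avoiding the earlier
  ones to a vector avoiding the new one, only finitely many parameters of the infinite field are
  bad.\<close>

lemma generic_exists: obtains w where "generic w"
proof -
  have "J \<subseteq> {1..t} \<Longrightarrow> \<exists>w. \<forall>j\<in>J. w \<notin> x j" if "finite J" for J
    using that
  proof (induction J rule: finite_induct)
    case (insert j J)
    then obtain w where w: "\<forall>k\<in>J. w \<notin> x k" by auto
    obtain w' where w': "w' \<notin> x j" using x_not_UNIV insert.prems by auto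
    have "\<exists>s. w + scale s (w' - w) \<notin> x k" if "k \<in> insert j J" for k
    proof (cases "k = j")
      case True
      then show ?thesis using w' by (intro exI[of _ 1]) simp
    next
      case False
      then show ?thesis using w that by (intro exI[of _ 0]) simp
    qed
    then have "finite {s. \<exists>k\<in>insert j J. w + scale s (w' - w) \<in> x k}"
      by (intro finite_line_exceptions) (use insert.prems in auto)
    then have "{s. \<exists>k\<in>insert j J. w + scale s (w' - w) \<in> x k} \<noteq> UNIV"
      using infinite_UNIV_alg_closed by metis
    then show ?case by blast
  qed simp
  from this[of "{1..t}"] show ?thesis using that by (auto simp: generic_def)
qed

lemma generic_line: obtains w where "finite {s. \<not> generic (v + scale s w)}"
proof -
  obtain w where w: "generic w" by (rule generic_exists)
  have "finite {s. \<exists>j\<in>{1..t}. v + scale s (w - v) \<in> x j}"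
    by (rule finite_line_exceptions) (use w in \<open>auto simp: generic_def intro!: exI[of _ 1]\<close>)
  then show ?thesis using that[of "w - v"] by (simp add: generic_def)
qed

section \<open>Points of the blow-up and their homogeneous coordinates\<close>

lemma pointsD:
  assumes "z \<in> points"
  shows "fst z \<in> proj_space scale"
    and "i \<in> {1..t} \<Longrightarrow> subspace (snd z i)"
    and "i \<in> {1..t} \<Longrightarrow> dim (snd z i) = 2"
    and "i \<in> {1..t} \<Longrightarrow> x i \<subseteq> snd z i"
    and "i \<in> {1..t} \<Longrightarrow> fst z \<subseteq> snd z i"
proof -
  have z: "fst z \<in> proj_space scale"
    "snd z \<in> (\<Pi>\<^sub>E i\<in>{1..t}. {L. subspace L \<and> dim L = 2 \<and> x i \<subseteq> L \<and> fst z \<subseteq> L})"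
    using assms unfolding points_def mem_Collect_eq case_prod_beta by blast+
  show "fst z \<in> proj_space scale" by (rule z)
  assume "i \<in> {1..t}"
  from PiE_mem[OF z(2) this]
  show "subspace (snd z i)" "dim (snd z i) = 2" "x i \<subseteq> snd z i" "fst z \<subseteq> snd z i" by blast+
qed

lemma pointsI:
  assumes "p \<in> proj_space scale"
    and "\<And>i. i \<in> {1..t} \<Longrightarrow> subspace (l i) \<and> dim (l i) = 2 \<and> x i \<subseteq> l i \<and> p \<subseteq> l i"
  shows "(p, restrict l {1..t}) \<in> points"
  using assms by (auto simp: points_def)

lemma coordsD:
  assumes "c \<in> coords z"
  shows "fst c \<in> fst z" "fst c \<noteq> 0"
    and "i \<in> {1..t} \<Longrightarrow> snd c i \<in> dual_space scale"
    and "i \<in> {1..t} \<Longrightarrow> snd z i = {u. snd c i u = 0}"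
  using assms by (auto simp: coords_def)

lemma coordsI:
  assumes "v \<in> fst z" "v \<noteq> 0"
    and "\<And>i. i \<in> {1..t} \<Longrightarrow> \<eta> i \<in> dual_space scale \<and> snd z i = {u. \<eta> i u = 0}"
  shows "(v, \<eta>) \<in> coords z"
  using assms by (simp add: coords_def)

lemma coords_forms:
  assumes "z \<in> points" "c \<in> coords z" "i \<in> {1..t}"
  shows "snd c i \<in> forms_through scale (x i)" "snd c i (fst c) = 0" "\<exists>u. snd c i u \<noteq> 0"
proof -
  note k = coordsD(4)[OF assms(2,3)]
  show "snd c i \<in> forms_through scale (x i)"
    using coordsD(3)[OF assms(2,3)] pointsD(4)[OF assms(1,3)] k by (auto simp: forms_through_def)
  show "snd c i (fst c) = 0"
    using coordsD(1)[OF assms(2)] pointsD(5)[OF assms(1,3)] k by auto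
  show "\<exists>u. snd c i u \<noteq> 0"
    using pointsD(3)[OF assms(1,3)] k dim_3 by (auto intro: ccontr)
qed

lemma coords_exist:
  assumes "z \<in> points" "v \<in> fst z" "v \<noteq> 0"
  obtains \<eta> where "(v, \<eta>) \<in> coords z"
proof -
  have "\<exists>f. f \<in> dual_space scale \<and> snd z i = {u. f u = 0}" if "i \<in> {1..t}" for i
    using plane_is_kernel[OF pointsD(2,3)[OF assms(1) that]] by metis
  then obtain \<eta> where "\<And>i. i \<in> {1..t} \<Longrightarrow> \<eta> i \<in> dual_space scale \<and> snd z i = {u. \<eta> i u = 0}"
    by metis
  then show ?thesis using that assms coordsI by metis
qed

lemma coords_nonempty: assumes "z \<in> points" shows "\<exists>c. c \<in> coords z"
proof -
  obtain v where "v \<in> fst z" "v \<noteq> 0" using pointsD(1)[OF assms] by (rule proj_space_nonzero)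
  then show ?thesis using coords_exist[OF assms] by metis
qed

lemma point_over:
  assumes "v \<noteq> 0" obtains z where "z \<in> points" "fst z = span {v}" "v \<in> fst z"
proof -
  have p: "span {v} \<in> proj_space scale" using assms by (rule proj_space_span)
  have "\<exists>L. subspace L \<and> dim L = 2 \<and> x i \<subseteq> L \<and> span {v} \<subseteq> L" if "i \<in> {1..t}" for i
    using plane_through[OF x_point[OF that] p] by metis
  then obtain l where "\<And>i. i \<in> {1..t} \<Longrightarrow> subspace (l i) \<and> dim (l i) = 2 \<and> x i \<subseteq> l i \<and> span {v} \<subseteq> l i"
    by metis
  then have "(span {v}, restrict l {1..t}) \<in> points" by (rule pointsI[OF p])
  then show ?thesis using that span_base[of v "{v}"] by simp
qed

lemma point_generic_cases:
  assumes "z \<in> points" "v \<in> fst z" "v \<noteq> 0" "\<not> generic v"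
  obtains i where "i \<in> {1..t}" "fst z = x i" "z \<in> exc i"
proof -
  obtain i where i: "i \<in> {1..t}" "v \<in> x i" using assms(4) by (auto simp: generic_def)
  then have "fst z = x i"
    using proj_space_inter[OF pointsD(1)[OF assms(1)] x_point[OF i(1)]] assms by blast
  then show ?thesis using that i assms by (auto simp: exc_def)
qed

lemma generic_not_exc:
  assumes "v \<in> fst z" "generic v" "i \<in> {1..t}" shows "z \<notin> exc i"
  using assms by (auto simp: exc_def generic_def)

text \<open>As a function of \<open>u\<close> the expression is the equation of the line joining
  \<open>x j\<close> to \<open>v\<close>. Its coefficients with respect to the basis
  \<open>h j 0\<close>, \<open>h j 1\<close> both vanish only for \<open>v\<close> in
  \<open>x j\<close>.\<close>

lemma join_form_nonzero:
  assumes j: "j \<in> {1..t}" and v: "v \<notin> x j"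
  shows "\<exists>u. h j 0 v * h j 1 u - h j 1 v * h j 0 u \<noteq> 0"
proof (rule ccontr)
  assume "\<not> ?thesis"
  then have z: "h j 0 v * h j 1 u - h j 1 v * h j 0 u = 0" for u by blast
  have "(\<Sum>b<2. (if b = 0 then - h j 1 v else h j 0 v) * h j (b :: nat) u) = 0" for u
    using z[of u] by (simp add: numeral_2_eq_2)
  from basis_family_independent[OF h_basis[OF j] this]
  have "(if b = 0 then - h j 1 v else h j 0 v) = 0" if "b < 2" for b :: nat using that by blast
  from this[of 0] this[of 1] have "h j 0 v = 0" "h j 1 v = 0" by simp_all
  then show False using v in_x_iff[OF j] by blast
qed

text \<open>
  Through a point \<open>z\<^sub>0\<close> of \<open>R\<^sub>i\<close>, given by a line \<open>L\<close> through \<open>x\<^sub>i\<close>, passes the strict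
  transform of \<open>L\<close>. Its \<open>j\<close>-th coordinate is the line joining \<open>x\<^sub>j\<close> to the moving point.
\<close>

lemma curve_through_exc:
  assumes z0: "z0 \<in> points" "i \<in> {1..t}" "fst z0 = x i"
  obtains v \<eta> z E where "finite E"
    and "\<And>f. f \<in> dual_space scale \<Longrightarrow> poly_fun (\<lambda>s. f (v s))"
    and "\<And>j u. j \<in> {1..t} \<Longrightarrow> poly_fun (\<lambda>s. \<eta> s j u)"
    and "(v 0, \<eta> 0) \<in> coords z0"
    and "\<And>s. s \<notin> E \<Longrightarrow> z s \<in> points \<and> (v s, \<eta> s) \<in> coords (z s) \<and> generic (v s)"
proof -
  obtain B where "finite_dimensional_vector_space scale B" by (rule finite_dimensional)
  then interpret fd: finite_dimensional_vector_space scale B .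
  obtain v0 where v0: "v0 \<in> x i" "v0 \<noteq> 0" using x_point[OF z0(2)] by (rule proj_space_nonzero)
  obtain \<eta>0 where \<eta>0: "(v0, \<eta>0) \<in> coords z0" using coords_exist[OF z0(1)] z0(3) v0 by metis
  \<comment> \<open>A plane does not fit into a one-dimensional subspace. The direction
    \<open>w\<close> is taken inside the plane of \<open>z0\<close> but off \<open>x i\<close>, so
    that the curve stays on that plane and leaves the exceptional divisor.\<close>
  have "\<not> snd z0 i \<subseteq> x i"
    using fd.dim_subset[of "snd z0 i" "x i"] pointsD(3)[OF z0(1,2)] x_point[OF z0(2)]
    by (auto simp: proj_space_def)
  then obtain w where w: "w \<in> snd z0 i" "w \<notin> x i" by auto
  define v where "v s = v0 + scale s w" for s
  \<comment> \<open>The moving vector remains in the plane \<open>snd z0 i\<close>, so the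
    \<open>i\<close>-th covector is constant. For the other indices the join with \<open>x j\<close>
    is defined at parameter 0 too, because \<open>v0\<close> is off \<open>x j\<close>.\<close>
  define \<eta> where "\<eta> s j = (if j = i then \<eta>0 i else (\<lambda>u. h j 0 (v s) * h j 1 u - h j 1 (v s) * h j 0 u))" for s j
  define E where "E = {s. \<exists>j\<in>{1..t}. v0 + scale s w \<in> x j}"
  define z where "z s = (span {v s}, restrict (\<lambda>j. {u. \<eta> s j u = 0}) {1..t})" for s
  \<comment> \<open>Here the distinctness of the blown-up points enters.\<close>
  have v0j: "v0 \<notin> x j" if "j \<in> {1..t}" "j \<noteq> i" for j
    using proj_space_inter[OF x_point[OF that(1)] x_point[OF z0(2)] _ v0] inj_onD[OF x_inj _ that(1) z0(2)] that(2)
    by blast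
  have "\<exists>s. v0 + scale s w \<notin> x j" if "j \<in> {1..t}" for j
  proof (cases "j = i")
    case True
    have "v0 + w \<in> x i \<Longrightarrow> w \<in> x i"
      using subspace_diff[OF proj_space_subspace[OF x_point[OF z0(2)]], of "v0 + w" v0] v0 by simp
    then show ?thesis using w True by (intro exI[of _ 1]) auto
  next
    case False
    then show ?thesis using v0j that by (intro exI[of _ 0]) simp
  qed
  then have "finite E" unfolding E_def by (rule finite_line_exceptions[OF subset_refl])
  moreover have pv: "poly_fun (\<lambda>s. f (v s))" if "f \<in> dual_space scale" for f
    unfolding v_def using that by (rule poly_fun_line)
  moreover have "poly_fun (\<lambda>s. \<eta> s j u)" if "j \<in> {1..t}" for j u
    using pv[OF h_dual[OF that]]
    by (cases "j = i") (simp_all add: \<eta>_def poly_fun_const poly_fun_diff poly_fun_mult)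
  moreover have "(v 0, \<eta> 0) \<in> coords z0"
  proof (rule coordsI)
    show "v 0 \<in> fst z0" "v 0 \<noteq> 0" using v0 z0(3) by (simp_all add: v_def)
    fix j assume j: "j \<in> {1..t}"
    show "\<eta> 0 j \<in> dual_space scale \<and> snd z0 j = {u. \<eta> 0 j u = 0}"
    proof (cases "j = i")
      case True
      then show ?thesis using coordsD(3,4)[OF \<eta>0 j] by (simp add: \<eta>_def)
    next
      case False
      let ?p = "h j 0 v0" and ?q = "h j 1 v0"
      have pq: "?p \<noteq> 0 \<or> ?q \<noteq> 0" using v0j[OF j False] in_x_iff[OF j] by auto
      have e: "\<eta> 0 j u = ?p * h j 1 u - ?q * h j 0 u" for u using False by (simp add: \<eta>_def v_def)
      have e': "\<eta> 0 j = (\<lambda>u. ?p * h j 1 u + (- ?q) * h j 0 u)" by (simp add: fun_eq_iff e)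
      have "\<eta> 0 j \<in> dual_space scale"
        unfolding e' by (intro dual_space_combine h_dual j) auto
      \<comment> \<open>Both forms vanish on \<open>x j\<close> and at \<open>v0\<close>, hence are
        proportional. The identities are multiplied by \<open>?p\<close> and \<open>?q\<close>
        because either may be zero; one of \<open>?p\<close>, \<open>?q\<close> and one of \<alpha>,
        \<beta> is nonzero, which gives the two directions.\<close>
      moreover have "\<eta>0 j u = 0 \<longleftrightarrow> \<eta> 0 j u = 0" for u
      proof -
        note c = coords_forms[OF z0(1) \<eta>0 j, simplified]
        obtain \<alpha> \<beta> where ab: "\<And>u. \<eta>0 j u = \<alpha> * h j 0 u + \<beta> * h j 1 u"
          using form_through_coeffs[OF j c(1)] by blast
        have 0: "\<alpha> * ?p = - (\<beta> * ?q)" using c(2) by (simp add: ab eq_neg_iff_add_eq_0)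
        have nz: "\<alpha> \<noteq> 0 \<or> \<beta> \<noteq> 0" using c(3) ab by auto
        have 1: "?p * \<eta>0 j u = \<beta> * \<eta> 0 j u"
        proof -
          have "?p * \<eta>0 j u = (\<alpha> * ?p) * h j 0 u + ?p * \<beta> * h j 1 u" by (simp add: ab algebra_simps)
          then show ?thesis unfolding 0 by (simp add: e algebra_simps)
        qed
        have 2: "?q * \<eta>0 j u = - (\<alpha> * \<eta> 0 j u)"
        proof -
          have "\<beta> * ?q = - (\<alpha> * ?p)" using 0 by simp
          moreover have "?q * \<eta>0 j u = \<alpha> * ?q * h j 0 u + (\<beta> * ?q) * h j 1 u" by (simp add: ab algebra_simps)
          ultimately show ?thesis by (simp add: e algebra_simps)
        qed
        show ?thesis using 1 2 pq nz by auto
      qed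
      ultimately show ?thesis using coordsD(4)[OF \<eta>0 j] by simp
    qed
  qed
  moreover have "z s \<in> points \<and> (v s, \<eta> s) \<in> coords (z s) \<and> generic (v s)" if s: "s \<notin> E" for s
  proof -
    have g: "generic (v s)" using s by (simp add: E_def generic_def v_def)
    note vs = generic_nonzero[OF g]
    have \<eta>s: "\<eta> s j \<in> dual_space scale \<and> (\<exists>u. \<eta> s j u \<noteq> 0) \<and> (\<forall>u\<in>x j. \<eta> s j u = 0) \<and> \<eta> s j (v s) = 0"
      if j: "j \<in> {1..t}" for j
    proof (cases "j = i")
      case True
      note c = coords_forms[OF z0(1) \<eta>0 z0(2), simplified]
      have "\<eta>0 i w = 0" using coordsD(4)[OF \<eta>0 z0(2)] w(1) by auto
      then have "\<eta>0 i (v s) = 0"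
        using c(1,2) by (simp add: v_def dual_add dual_scale forms_through_def)
      then show ?thesis using c True by (simp add: \<eta>_def forms_through_def)
    next
      case False
      let ?p = "h j 0 (v s)" and ?q = "h j 1 (v s)"
      have e: "\<eta> s j u = ?p * h j 1 u - ?q * h j 0 u" for u using False by (simp add: \<eta>_def)
      have e': "\<eta> s j = (\<lambda>u. ?p * h j 1 u + (- ?q) * h j 0 u)" by (simp add: fun_eq_iff e)
      have "\<eta> s j \<in> dual_space scale"
        unfolding e' by (intro dual_space_combine h_dual j) auto
      moreover have "\<exists>u. \<eta> s j u \<noteq> 0"
        unfolding e by (rule join_form_nonzero[OF j]) (use g j in \<open>auto simp: generic_def\<close>)
      ultimately show ?thesis using h_vanish[OF j] by (simp add: e)
    qed
    have sub: "subspace {u. \<eta> s j u = 0}" "dim {u. \<eta> s j u = 0} = 2" if "j \<in> {1..t}" for j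
      using \<eta>s[OF that] subspace_dual_kernel dim_dual_kernel by blast+
    have "z s \<in> points"
      unfolding z_def
    proof (rule pointsI)
      show "span {v s} \<in> proj_space scale" using vs by (rule proj_space_span)
      fix j assume j: "j \<in> {1..t}"
      have "span {v s} \<subseteq> {u. \<eta> s j u = 0}" using \<eta>s[OF j] sub(1)[OF j] by (intro span_minimal) auto
      then show "subspace {u. \<eta> s j u = 0} \<and> dim {u. \<eta> s j u = 0} = 2 \<and> x j \<subseteq> {u. \<eta> s j u = 0} \<and>
          span {v s} \<subseteq> {u. \<eta> s j u = 0}"
        using sub[OF j] \<eta>s[OF j] by auto
    qed
    moreover have "(v s, \<eta> s) \<in> coords (z s)"
      using vs \<eta>s by (intro coordsI) (auto simp: z_def intro: span_base)
    ultimately show ?thesis using g by blast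
  qed
  ultimately show ?thesis by (rule that)
qed

end

section \<open>Sections of the invertible sheaves\<close>

context blown_up_points
begin

subsection \<open>Multihomogeneous functions and open sets\<close>

lemma multihom_scale:
  assumes "multihom m e F" "\<And>i. i \<in> {1..t} \<Longrightarrow> \<eta>' i = (\<lambda>u. \<mu> i * \<eta> i u)"
  shows "F (scale a v, \<eta>') = a ^ m * (\<Prod>i\<in>{1..t}. \<mu> i ^ e i) * F (v, \<eta>)"
  using assms(1)
proof induction
  case (covec i u)
  have "(\<Prod>j\<in>{1..t}. \<mu> j ^ (if j = i then 1 else 0)) = (\<Prod>j\<in>{1..t}. if j = i then \<mu> j else 1)"
    by (rule prod.cong) auto
  then show ?case using covec assms(2)[OF covec] by (simp add: prod.delta)
next
  case (vec f)
  then show ?case by (simp add: dual_scale)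
next
  case (mult m e F m' e' G)
  then show ?case by (simp add: power_add prod.distrib algebra_simps)
qed (simp_all add: algebra_simps)

lemma coords_multiple:
  assumes "z \<in> points" "c \<in> coords z" "c' \<in> coords z"
  obtains a \<mu> where "a \<noteq> 0" "\<And>i. i \<in> {1..t} \<Longrightarrow> \<mu> i \<noteq> 0" "fst c' = scale a (fst c)"
    "\<And>i. i \<in> {1..t} \<Longrightarrow> snd c' i = (\<lambda>u. \<mu> i * snd c i u)"
proof -
  have "fst c' \<in> span {fst c}"
    using proj_space_eq_span[OF pointsD(1)[OF assms(1)] coordsD(1,2)[OF assms(2)]]
      coordsD(1)[OF assms(3)] by simp
  then obtain a where l: "fst c' = scale a (fst c)" by (auto simp: span_singleton)
  have "a \<noteq> 0" using l coordsD(2)[OF assms(3)] by auto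
  moreover have "\<exists>m. m \<noteq> 0 \<and> snd c' i = (\<lambda>u. m * snd c i u)" if "i \<in> {1..t}" for i
    using dual_proportional[OF coordsD(3)[OF assms(2) that] coordsD(3)[OF assms(3) that]]
      coordsD(4)[OF assms(2) that] coordsD(4)[OF assms(3) that] by metis
  then obtain \<mu> where "\<And>i. i \<in> {1..t} \<Longrightarrow> \<mu> i \<noteq> 0 \<and> snd c' i = (\<lambda>u. \<mu> i * snd c i u)"
    by metis
  ultimately show ?thesis using that l by blast
qed

text \<open>The factor splits into \<open>a ^ m\<close> and a part depending on \<open>e\<close>
  alone. So a quotient of functions with equal \<open>e\<close> and first degrees
  \<open>m + d\<close> and \<open>m\<close> scales by \<open>a ^ d\<close>, as a section of degree
  \<open>d\<close> must.\<close>

lemma multihom_coords: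
  assumes "z \<in> points" "c \<in> coords z" "c' \<in> coords z"
  obtains a M where "a \<noteq> 0" "\<And>e. M e \<noteq> 0" "fst c' = scale a (fst c)"
    "\<And>m e F. multihom m e F \<Longrightarrow> F c' = a ^ m * M e * F c"
proof -
  obtain a \<mu> where *: "a \<noteq> 0" "\<And>i. i \<in> {1..t} \<Longrightarrow> \<mu> i \<noteq> 0" "fst c' = scale a (fst c)"
    "\<And>i. i \<in> {1..t} \<Longrightarrow> snd c' i = (\<lambda>u. \<mu> i * snd c i u)"
    using coords_multiple[OF assms] by blast
  have "F c' = a ^ m * (\<Prod>i\<in>{1..t}. \<mu> i ^ e i) * F c" if "multihom m e F" for m e F
    using multihom_scale[OF that, of "snd c'" \<mu> "snd c" a "fst c"] *(4) by (simp flip: *(3))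
  moreover have "(\<Prod>i\<in>{1..t}. \<mu> i ^ e i) \<noteq> 0" for e using *(2) by simp
  ultimately show ?thesis using that[of a "\<lambda>e. \<Prod>i\<in>{1..t}. \<mu> i ^ e i"] *(1,3) by blast
qed

lemma multihom_nonzero:
  assumes "z \<in> points" "c \<in> coords z" "c' \<in> coords z" "multihom m e F" "F c \<noteq> 0"
  shows "F c' \<noteq> 0"
proof -
  obtain a M where *: "a \<noteq> 0" "\<And>e. M e \<noteq> 0" "fst c' = scale a (fst c)"
    "\<And>m e F. multihom m e F \<Longrightarrow> F c' = a ^ m * M e * F c"
    using multihom_coords[OF assms(1-3)] by blast
  show ?thesis unfolding *(4)[OF assms(4)] using *(1,2) assms(5) by simp
qed

lemma zopen_subset: "zopen U \<Longrightarrow> U \<subseteq> points"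
  unfolding zopen_def by blast

definition nonvanishing :: "('v \<times> (nat \<Rightarrow> 'v \<Rightarrow> 'k) \<Rightarrow> 'k) \<Rightarrow> 'v bpoint set" where
  "nonvanishing F = {z \<in> points. \<exists>c\<in>coords z. F c \<noteq> 0}"

lemma zopen_nonvanishing: "multihom m e F \<Longrightarrow> zopen (nonvanishing F)"
  unfolding zopen_def nonvanishing_def by (rule exI[of _ "{F}"]) blast

lemma nonvanishing_coords:
  "multihom m e F \<Longrightarrow> z \<in> nonvanishing F \<Longrightarrow> c \<in> coords z \<Longrightarrow> F c \<noteq> 0"
  unfolding nonvanishing_def using multihom_nonzero by blast

lemma zopenE:
  assumes "zopen U" "z \<in> U"
  obtains m e F where "multihom m e F" "z \<in> nonvanishing F" "nonvanishing F \<subseteq> U"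
proof -
  obtain S where S: "\<forall>F\<in>S. \<exists>m e. multihom m e F" "U = {z \<in> points. \<exists>F\<in>S. \<exists>c\<in>coords z. F c \<noteq> 0}"
    using assms(1) unfolding zopen_def by blast
  then obtain F where "F \<in> S" "z \<in> nonvanishing F" using assms(2) by (auto simp: nonvanishing_def)
  moreover from this have "nonvanishing F \<subseteq> U" using S(2) unfolding nonvanishing_def by blast
  ultimately show ?thesis using that S(1) by blast
qed

lemma zopen_Union_nonvanishing:
  assumes "\<And>z. z \<in> U \<Longrightarrow> \<exists>m e F. multihom m e F \<and> z \<in> nonvanishing F \<and> nonvanishing F \<subseteq> U"
  shows "zopen U"
  unfolding zopen_def
proof (intro exI conjI)
  \<comment> \<open>The family of all functions with nonvanishing locus inside \<open>U\<close>, so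
    no neighbourhoods have to be chosen.\<close>
  let ?S = "{F. (\<exists>m e. multihom m e F) \<and> nonvanishing F \<subseteq> U}"
  show "\<forall>F\<in>?S. \<exists>m e. multihom m e F" by blast
  have eq: "\<Union> (nonvanishing ` S) = {z \<in> points. \<exists>F\<in>S. \<exists>c\<in>coords z. F c \<noteq> 0}" for S
    unfolding nonvanishing_def by blast
  have "U = \<Union> (nonvanishing ` ?S)"
  proof (intro subset_antisym subsetI)
    fix z assume "z \<in> U"
    then obtain m e F where "multihom m e F" "z \<in> nonvanishing F" "nonvanishing F \<subseteq> U"
      using assms by meson
    then show "z \<in> \<Union> (nonvanishing ` ?S)" by (intro UN_I[of F]) auto
  qed auto
  also have "\<dots> = {z \<in> points. \<exists>F\<in>?S. \<exists>c\<in>coords z. F c \<noteq> 0}" by (rule eq)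
  finally show "U = {z \<in> points. \<exists>F\<in>?S. \<exists>c\<in>coords z. F c \<noteq> 0}" .
qed

lemma nonvanishing_mult:
  assumes "multihom m e F" "multihom m' e' G"
  shows "nonvanishing (\<lambda>c. F c * G c) = nonvanishing F \<inter> nonvanishing G"
proof (intro subset_antisym subsetI)
  fix z assume z: "z \<in> nonvanishing F \<inter> nonvanishing G"
  then have p: "z \<in> points" by (simp add: nonvanishing_def)
  then obtain c where c: "c \<in> coords z" using coords_nonempty by blast
  then have "F c * G c \<noteq> 0"
    using nonvanishing_coords[OF assms(1) _ c] nonvanishing_coords[OF assms(2) _ c] z by simp
  then show "z \<in> nonvanishing (\<lambda>c. F c * G c)" using p c unfolding nonvanishing_def by blast
qed (auto simp: nonvanishing_def)

lemma zopen_Int: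
  assumes "zopen U" "zopen W" shows "zopen (U \<inter> W)"
proof (rule zopen_Union_nonvanishing)
  fix z assume z: "z \<in> U \<inter> W"
  obtain m e F where F: "multihom m e F" "z \<in> nonvanishing F" "nonvanishing F \<subseteq> U"
    using zopenE[OF assms(1)] z by blast
  obtain m' e' G where G: "multihom m' e' G" "z \<in> nonvanishing G" "nonvanishing G \<subseteq> W"
    using zopenE[OF assms(2)] z by blast
  have "multihom (m + m') (\<lambda>j. e j + e' j) (\<lambda>c. F c * G c)" using F(1) G(1) by (rule mult)
  then show "\<exists>m e F. multihom m e F \<and> z \<in> nonvanishing F \<and> nonvanishing F \<subseteq> U \<inter> W"
    using nonvanishing_mult[OF F(1) G(1)] F G by blast
qed

lemma zopen_points: "zopen points"
proof -
  have "nonvanishing (\<lambda>_. 1) = points" using coords_nonempty by (auto simp: nonvanishing_def)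
  then show ?thesis using zopen_nonvanishing[OF multihom.const[of 1]] by simp
qed

lemma multihom_h: "i \<in> {1..t} \<Longrightarrow> b < 2 \<Longrightarrow> multihom 1 (\<lambda>_. 0) (\<lambda>(v, \<eta>). h i b v)"
  by (rule vec[OF h_dual])

lemma h_nonzero_off_exc:
  assumes "z \<in> points" "z \<notin> exc i" "i \<in> {1..t}" "v \<in> fst z" "v \<noteq> 0"
  shows "\<exists>b<2. h i b v \<noteq> 0"
proof (rule ccontr)
  assume "\<not> ?thesis"
  then have "v \<in> x i" using in_x_iff[OF assms(3)] by auto
  then have "fst z = x i"
    using proj_space_inter[OF pointsD(1)[OF assms(1)] x_point[OF assms(3)] assms(4) _ assms(5)] by simp
  then show False using assms by (simp add: exc_def)
qed

text \<open>Off \<open>exc i\<close> one of the two forms through \<open>x i\<close> is nonzero, and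
  the nonvanishing locus of either form misses \<open>exc i\<close>.\<close>

lemma zopen_diff_exc:
  assumes "zopen U" "i \<in> {1..t}" shows "zopen (U - exc i)"
proof -
  have "zopen (points - exc i)"
  proof (rule zopen_Union_nonvanishing)
    fix z assume z: "z \<in> points - exc i"
    obtain c where c: "c \<in> coords z" using coords_nonempty z by blast
    obtain b where b: "b < 2" "h i b (fst c) \<noteq> 0"
      using h_nonzero_off_exc[OF _ _ assms(2) coordsD(1,2)[OF c]] z by blast
    let ?F = "\<lambda>(v, \<eta> :: nat \<Rightarrow> 'v \<Rightarrow> 'k). h i b v"
    have "z \<in> nonvanishing ?F" using z c b unfolding nonvanishing_def by (auto simp: case_prod_beta)
    moreover have "nonvanishing ?F \<subseteq> points - exc i"
    proof
      fix w assume w: "w \<in> nonvanishing ?F"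
      then obtain c where "w \<in> points" "c \<in> coords w" "h i b (fst c) \<noteq> 0"
        by (auto simp: nonvanishing_def)
      moreover from this have "fst c \<notin> x i" using h_vanish[OF assms(2) b(1)] by blast
      ultimately show "w \<in> points - exc i" using coordsD(1) by (fastforce simp: exc_def)
    qed
    ultimately show "\<exists>m e F. multihom m e F \<and> z \<in> nonvanishing F \<and> nonvanishing F \<subseteq> points - exc i"
      using multihom_h[OF assms(2) b(1)] by blast
  qed
  then have "zopen (U \<inter> (points - exc i))" by (rule zopen_Int[OF assms(1)])
  moreover have "U \<inter> (points - exc i) = U - exc i" using zopen_subset[OF assms(1)] by blast
  ultimately show ?thesis by simp
qed

lemma multihom_poly_fun:
  assumes "multihom m e F"
    and "\<And>f. f \<in> dual_space scale \<Longrightarrow> poly_fun (\<lambda>s. f (v s))"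
    and "\<And>j u. j \<in> {1..t} \<Longrightarrow> poly_fun (\<lambda>s. \<eta> s j u)"
  shows "poly_fun (\<lambda>s. F (v s, \<eta> s))"
  using assms(1) by induction (simp_all add: poly_fun_const poly_fun_add poly_fun_mult assms(2,3))

subsection \<open>The sheaves of the line bundles pulled back from the plane\<close>

definition in_support :: "'v bpoint set \<Rightarrow> 'v bpoint \<Rightarrow> 'v \<Rightarrow> bool" where
  "in_support U z v \<longleftrightarrow> z \<in> U \<and> v \<in> fst z \<and> v \<noteq> 0"

text \<open>A single fraction valid on all of \<open>W\<close>. Sums and products are computed at
  this level, and \<open>line_sheaf\<close> only adds the passage to neighbourhoods.\<close>

definition regular :: "nat \<Rightarrow> 'v bpoint set \<Rightarrow> ('k, 'v) bsection \<Rightarrow> bool" where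
  "regular d W s \<longleftrightarrow> (\<exists>F G m e. multihom (m + d) e F \<and> multihom m e G \<and>
     (\<forall>w\<in>W. \<forall>c\<in>coords w. G c \<noteq> 0 \<and> s w (fst c) = F c / G c))"

lemma line_sheaf_iff:
  "s \<in> line_sheaf d U \<longleftrightarrow> (\<forall>z v. \<not> in_support U z v \<longrightarrow> s z v = 0) \<and>
     (\<forall>z\<in>U. \<exists>W. zopen W \<and> z \<in> W \<and> W \<subseteq> U \<and> regular d W s)"
  unfolding line_sheaf_def in_support_def regular_def by auto

lemma line_sheaf_support: "s \<in> line_sheaf d U \<Longrightarrow> \<not> in_support U z v \<Longrightarrow> s z v = 0"
  unfolding line_sheaf_iff by blast

lemma line_sheaf_local:
  assumes "s \<in> line_sheaf d U" "z \<in> U"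
  obtains W where "zopen W" "z \<in> W" "W \<subseteq> U" "regular d W s"
  using assms unfolding line_sheaf_iff by blast

lemma regular_mono: "regular d W s \<Longrightarrow> W' \<subseteq> W \<Longrightarrow> regular d W' s"
  unfolding regular_def by (elim ex_forward) blast

lemma regular_cong:
  assumes "regular d W s" "\<And>w v. in_support W w v \<Longrightarrow> s w v = s' w v"
  shows "regular d W s'"
proof -
  have "s w (fst c) = s' w (fst c)" if "w \<in> W" "c \<in> coords w" for w c
    using assms(2)[of w "fst c"] that coordsD(1,2)[OF that(2)] by (simp add: in_support_def)
  then show ?thesis using assms(1) unfolding regular_def by (elim ex_forward) simp
qed

lemma regular_add:
  assumes "regular d W s" "regular d W s'"
  shows "regular d W (\<lambda>z v. s z v + s' z v)"
proof -
  obtain F G m e where 1: "multihom (m + d) e F" "multihom m e G"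
    "\<And>w c. w \<in> W \<Longrightarrow> c \<in> coords w \<Longrightarrow> G c \<noteq> 0 \<and> s w (fst c) = F c / G c"
    using assms(1) unfolding regular_def by blast
  obtain F' G' m' e' where 2: "multihom (m' + d) e' F'" "multihom m' e' G'"
    "\<And>w c. w \<in> W \<Longrightarrow> c \<in> coords w \<Longrightarrow> G' c \<noteq> 0 \<and> s' w (fst c) = F' c / G' c"
    using assms(2) unfolding regular_def by blast
  have "multihom (m + m' + d) (\<lambda>j. e j + e' j) (\<lambda>c. F c * G' c)"
    using mult[OF 1(1) 2(2)] by (simp add: ac_simps)
  moreover have "multihom (m + m' + d) (\<lambda>j. e j + e' j) (\<lambda>c. G c * F' c)"
    using mult[OF 1(2) 2(1)] by (simp add: ac_simps)
  ultimately have "multihom (m + m' + d) (\<lambda>j. e j + e' j) (\<lambda>c. F c * G' c + G c * F' c)"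
    by (rule add)
  moreover have "multihom (m + m') (\<lambda>j. e j + e' j) (\<lambda>c. G c * G' c)"
    using 1(2) 2(2) by (rule mult)
  moreover have "G c * G' c \<noteq> 0 \<and> s w (fst c) + s' w (fst c) = (F c * G' c + G c * F' c) / (G c * G' c)"
    if "w \<in> W" "c \<in> coords w" for w c
    using 1(3)[OF that] 2(3)[OF that] by (simp add: field_simps)
  ultimately show ?thesis unfolding regular_def by blast
qed

lemma regular_mult:
  assumes "regular d W s" "regular d' W s'"
  shows "regular (d + d') W (\<lambda>z v. s z v * s' z v)"
proof -
  obtain F G m e where 1: "multihom (m + d) e F" "multihom m e G"
    "\<And>w c. w \<in> W \<Longrightarrow> c \<in> coords w \<Longrightarrow> G c \<noteq> 0 \<and> s w (fst c) = F c / G c"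
    using assms(1) unfolding regular_def by blast
  obtain F' G' m' e' where 2: "multihom (m' + d') e' F'" "multihom m' e' G'"
    "\<And>w c. w \<in> W \<Longrightarrow> c \<in> coords w \<Longrightarrow> G' c \<noteq> 0 \<and> s' w (fst c) = F' c / G' c"
    using assms(2) unfolding regular_def by blast
  have "multihom (m + m' + (d + d')) (\<lambda>j. e j + e' j) (\<lambda>c. F c * F' c)"
    using mult[OF 1(1) 2(1)] by (simp add: ac_simps)
  moreover have "multihom (m + m') (\<lambda>j. e j + e' j) (\<lambda>c. G c * G' c)"
    using 1(2) 2(2) by (rule mult)
  moreover have "G c * G' c \<noteq> 0 \<and> s w (fst c) * s' w (fst c) = (F c * F' c) / (G c * G' c)"
    if "w \<in> W" "c \<in> coords w" for w c
    using 1(3)[OF that] 2(3)[OF that] by simp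
  ultimately show ?thesis unfolding regular_def by blast
qed

lemma line_sheaf_add:
  assumes "s \<in> line_sheaf d U" "s' \<in> line_sheaf d U"
  shows "(\<lambda>z v. s z v + s' z v) \<in> line_sheaf d U"
  unfolding line_sheaf_iff
proof (intro conjI allI impI ballI)
  fix z v assume "\<not> in_support U z v"
  then show "s z v + s' z v = 0"
    using line_sheaf_support[OF assms(1)] line_sheaf_support[OF assms(2)] by simp
next
  fix z assume z: "z \<in> U"
  obtain W where W: "zopen W" "z \<in> W" "W \<subseteq> U" "regular d W s" using line_sheaf_local[OF assms(1) z] .
  obtain W' where W': "zopen W'" "z \<in> W'" "W' \<subseteq> U" "regular d W' s'" using line_sheaf_local[OF assms(2) z] .
  have "regular d (W \<inter> W') (\<lambda>z v. s z v + s' z v)"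
    using W(4) W'(4) by (intro regular_add) (auto elim: regular_mono)
  then show "\<exists>W. zopen W \<and> z \<in> W \<and> W \<subseteq> U \<and> regular d W (\<lambda>z v. s z v + s' z v)"
    using W W' zopen_Int by blast
qed

lemma line_sheaf_mult:
  assumes "s \<in> line_sheaf d U" "s' \<in> line_sheaf d' U"
  shows "(\<lambda>z v. s z v * s' z v) \<in> line_sheaf (d + d') U"
  unfolding line_sheaf_iff
proof (intro conjI allI impI ballI)
  fix z v assume "\<not> in_support U z v"
  then show "s z v * s' z v = 0"
    using line_sheaf_support[OF assms(1)] line_sheaf_support[OF assms(2)] by simp
next
  fix z assume z: "z \<in> U"
  obtain W where W: "zopen W" "z \<in> W" "W \<subseteq> U" "regular d W s" using line_sheaf_local[OF assms(1) z] .
  obtain W' where W': "zopen W'" "z \<in> W'" "W' \<subseteq> U" "regular d' W' s'" using line_sheaf_local[OF assms(2) z] .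
  have "regular (d + d') (W \<inter> W') (\<lambda>z v. s z v * s' z v)"
    using W(4) W'(4) by (intro regular_mult) (auto elim: regular_mono)
  then show "\<exists>W. zopen W \<and> z \<in> W \<and> W \<subseteq> U \<and> regular (d + d') W (\<lambda>z v. s z v * s' z v)"
    using W W' zopen_Int by blast
qed

lemma line_sheaf_restrict:
  assumes "s \<in> line_sheaf d U" "zopen W" "W \<subseteq> U"
  shows "restrict_to W s \<in> line_sheaf d W"
  unfolding line_sheaf_iff
proof (intro conjI allI impI ballI)
  fix z v assume "\<not> in_support W z v"
  then show "restrict_to W s z v = 0"
    using line_sheaf_support[OF assms(1), of z v] assms(3) by (auto simp: restrict_to_def in_support_def)
next
  fix z assume z: "z \<in> W"
  then obtain W' where W': "zopen W'" "z \<in> W'" "W' \<subseteq> U" "regular d W' s"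
    using line_sheaf_local[OF assms(1)] assms(3) by blast
  have "regular d (W \<inter> W') s" using W'(4) by (rule regular_mono) blast
  then have "regular d (W \<inter> W') (restrict_to W s)"
    by (rule regular_cong) (simp add: in_support_def restrict_to_def)
  then show "\<exists>W'. zopen W' \<and> z \<in> W' \<and> W' \<subseteq> W \<and> regular d W' (restrict_to W s)"
    using W' z assms(2) zopen_Int by blast
qed

lemma line_sheaf_glue:
  assumes supp: "\<And>z v. \<not> in_support U z v \<Longrightarrow> s z v = 0"
    and loc: "\<And>z. z \<in> U \<Longrightarrow> \<exists>W r. zopen W \<and> z \<in> W \<and> W \<subseteq> U \<and> r \<in> line_sheaf d W \<and> (\<forall>w\<in>W. s w = r w)"
  shows "s \<in> line_sheaf d U"
  unfolding line_sheaf_iff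
proof (intro conjI allI impI ballI)
  fix z v assume "\<not> in_support U z v"
  then show "s z v = 0" by (rule supp)
next
  fix z assume "z \<in> U"
  then obtain W r where W: "zopen W" "z \<in> W" "W \<subseteq> U" "r \<in> line_sheaf d W" "\<forall>w\<in>W. s w = r w"
    using loc by blast
  then obtain W' where W': "zopen W'" "z \<in> W'" "W' \<subseteq> W" "regular d W' r"
    using line_sheaf_local by blast
  have "regular d W' s"
    by (rule regular_cong[OF W'(4)]) (use W(5) W'(3) in \<open>auto simp: in_support_def\<close>)
  then show "\<exists>W. zopen W \<and> z \<in> W \<and> W \<subseteq> U \<and> regular d W s"
    using W W' by blast
qed

text \<open>A section records values at vectors, whereas \<open>F\<close> and \<open>G\<close> also
  depend on covectors. The covectors are chosen arbitrarily and the quotient does not depend on the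
  choice.\<close>

lemma fraction_section:
  assumes W: "zopen W" and F: "multihom (m + d) e F" and G: "multihom m e G"
    and nz: "\<And>w c. w \<in> W \<Longrightarrow> c \<in> coords w \<Longrightarrow> G c \<noteq> 0"
  obtains s where "s \<in> line_sheaf d W" "\<And>w c. w \<in> W \<Longrightarrow> c \<in> coords w \<Longrightarrow> s w (fst c) = F c / G c"
proof -
  define s where "s = (\<lambda>z v. if in_support W z v
    then (let \<eta> = SOME \<eta>. (v, \<eta>) \<in> coords z in F (v, \<eta>) / G (v, \<eta>)) else 0)"
  have s: "s w (fst c) = F c / G c" if w: "w \<in> W" and c: "c \<in> coords w" for w c
  proof -
    have wp: "w \<in> points" using w zopen_subset[OF W] by blast
    let ?v = "fst c"
    define c' where "c' = (?v, SOME \<eta>. (?v, \<eta>) \<in> coords w)"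
    have "(?v, snd c) \<in> coords w" using c by simp
    then have c': "c' \<in> coords w" unfolding c'_def by (rule someI[of "\<lambda>\<eta>. (?v, \<eta>) \<in> coords w"])
    have "in_support W w ?v" using w coordsD(1,2)[OF c] by (simp add: in_support_def)
    then have "s w ?v = F c' / G c'" by (simp add: s_def c'_def Let_def)
    also have "\<dots> = F c / G c"
    proof -
      obtain a M where *: "a \<noteq> 0" "\<And>e. M e \<noteq> 0" "fst c' = scale a (fst c)"
        "\<And>m e F. multihom m e F \<Longrightarrow> F c' = a ^ m * M e * F c"
        using multihom_coords[OF wp c c'] by blast
      \<comment> \<open>Both coordinates have the same vector, which forces \<open>a = 1\<close>;
        the remaining factor \<open>M e\<close> is common to numerator and denominator.\<close>
      have "scale a ?v = scale 1 ?v" using *(3) by (simp add: c'_def)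
      then have "a = 1" using coordsD(2)[OF c] scale_right_imp_eq by blast
      then show ?thesis using *(2)[of e] by (simp add: *(4)[OF F] *(4)[OF G])
    qed
    finally show ?thesis .
  qed
  have "s \<in> line_sheaf d W"
    unfolding line_sheaf_iff
  proof (intro conjI allI impI ballI)
    fix z v assume "\<not> in_support W z v"
    then show "s z v = 0" by (simp add: s_def)
  next
    fix z assume "z \<in> W"
    moreover have "regular d W s" unfolding regular_def using F G nz s by blast
    ultimately show "\<exists>W'. zopen W' \<and> z \<in> W' \<and> W' \<subseteq> W \<and> regular d W' s" using W by blast
  qed
  then show ?thesis using s by (rule that)
qed

definition form_section :: "'v bpoint set \<Rightarrow> ('v \<Rightarrow> 'k) \<Rightarrow> ('k, 'v) bsection" where
  "form_section U f = (\<lambda>z v. if in_support U z v then f v else 0)"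

lemma form_section_multihom:
  assumes "zopen U" "multihom d (\<lambda>_. 0) (\<lambda>(v, \<eta>). f v)"
  shows "form_section U f \<in> line_sheaf d U"
proof -
  have F: "multihom (0 + d) (\<lambda>_. 0) (\<lambda>(v, \<eta>). f v)" using assms(2) by simp
  obtain s where s: "s \<in> line_sheaf d U"
    "\<And>w c. w \<in> U \<Longrightarrow> c \<in> coords w \<Longrightarrow> s w (fst c) = (case c of (v, \<eta>) \<Rightarrow> f v) / 1"
    using fraction_section[OF assms(1) F multihom.const[of 1]] by auto
  have "s z v = form_section U f z v" for z v
  proof (cases "in_support U z v")
    case True
    then have z: "z \<in> U" "v \<in> fst z" "v \<noteq> 0" by (auto simp: in_support_def)
    then obtain \<eta> where "(v, \<eta>) \<in> coords z" using coords_exist zopen_subset[OF assms(1)] by blast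
    then show ?thesis using s(2)[OF z(1)] True by (force simp: form_section_def)
  next
    case False
    then show ?thesis using line_sheaf_support[OF s(1)] by (simp add: form_section_def)
  qed
  then have "s = form_section U f" by blast
  then show ?thesis using s(1) by simp
qed

lemma form_section_const: "zopen U \<Longrightarrow> form_section U (\<lambda>_. c) \<in> line_sheaf 0 U"
  by (rule form_section_multihom) (simp_all add: split_def multihom.const)

lemma form_section_dual: "zopen U \<Longrightarrow> f \<in> dual_space scale \<Longrightarrow> form_section U f \<in> line_sheaf 1 U"
  using form_section_multihom vec by blast

lemma line_sheaf_form_mult:
  assumes "zopen U" "f \<in> dual_space scale" "s \<in> line_sheaf d U"
  shows "(\<lambda>z v. f v * s z v) \<in> line_sheaf (Suc d) U"
proof -
  have "(\<lambda>z v. form_section U f z v * s z v) \<in> line_sheaf (1 + d) U"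
    using form_section_dual[OF assms(1,2)] assms(3) by (rule line_sheaf_mult)
  moreover have "form_section U f z v * s z v = f v * s z v" for z v
    using line_sheaf_support[OF assms(3)] by (cases "in_support U z v") (simp_all add: form_section_def)
  ultimately show ?thesis by simp
qed

lemma line_sheaf_const_mult:
  assumes "zopen U" "s \<in> line_sheaf d U"
  shows "(\<lambda>z v. c * s z v) \<in> line_sheaf d U"
proof -
  have "(\<lambda>z v. form_section U (\<lambda>_. c) z v * s z v) \<in> line_sheaf (0 + d) U"
    using form_section_const[OF assms(1)] assms(2) by (rule line_sheaf_mult)
  moreover have "form_section U (\<lambda>_. c) z v * s z v = c * s z v" for z v
    using line_sheaf_support[OF assms(2)] by (cases "in_support U z v") (simp_all add: form_section_def)
  ultimately show ?thesis by simp
qed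

text \<open>The rule \<open>const\<close> provides the zero function in degree 0 only;
  multiplication with \<open>y 0\<close> raises its degree.\<close>

lemma multihom_zero: "multihom d (\<lambda>_. 0) (\<lambda>_. 0)"
proof (induction d)
  case (Suc d)
  have "multihom (1 + d) (\<lambda>j. 0 + 0) (\<lambda>c. (case c of (v, \<eta>) \<Rightarrow> y 0 v) * 0)"
    by (rule mult[OF vec Suc]) (simp add: y_dual)
  then show ?case by (simp only: mult_zero_right add_0_left plus_1_eq_Suc)
qed (rule multihom.const)

lemma line_sheaf_zero: assumes "zopen U" shows "0 \<in> line_sheaf d U"
proof -
  have "form_section U (\<lambda>_. 0) \<in> line_sheaf d U"
    using multihom_zero by (intro form_section_multihom[OF assms]) (simp add: split_def)
  moreover have "form_section U (\<lambda>_. 0) = 0" by (simp add: form_section_def fun_eq_iff)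
  ultimately show ?thesis by simp
qed

subsection \<open>Sections are determined off the exceptional divisors\<close>

text \<open>The issue is a point of some \<open>exc i\<close>. Near it \<open>s\<close> is
  \<open>F / G\<close>, and \<open>F\<close> becomes a polynomial function along the curve of
  \<open>curve_through_exc\<close>; it is zero at almost all parameters, hence at parameter
  0.\<close>

lemma section_eq_zero:
  assumes U: "zopen U" and s: "s \<in> line_sheaf d U"
    and 0: "\<And>z v. z \<in> U \<Longrightarrow> v \<in> fst z \<Longrightarrow> generic v \<Longrightarrow> s z v = 0"
  shows "s = 0"
proof (intro ext)
  fix z0 v0
  show "s z0 v0 = 0 z0 v0"
  proof (cases "in_support U z0 v0 \<and> \<not> generic v0")
    case False
    then consider "\<not> in_support U z0 v0" | "z0 \<in> U" "v0 \<in> fst z0" "generic v0"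
      unfolding in_support_def by blast
    then show ?thesis using line_sheaf_support[OF s] 0 by cases simp_all
  next
    case True
    then have z0: "z0 \<in> points" "z0 \<in> U" "v0 \<in> fst z0" "v0 \<noteq> 0" "\<not> generic v0"
      using zopen_subset[OF U] by (auto simp: in_support_def)
    obtain i where i: "i \<in> {1..t}" "fst z0 = x i"
      using point_generic_cases[OF z0(1,3,4,5)] by blast
    obtain W where W: "zopen W" "z0 \<in> W" "W \<subseteq> U" "regular d W s"
      using line_sheaf_local[OF s z0(2)] by blast
    obtain F G m e where FG: "multihom (m + d) e F" "multihom m e G"
      "\<And>w c. w \<in> W \<Longrightarrow> c \<in> coords w \<Longrightarrow> G c \<noteq> 0 \<and> s w (fst c) = F c / G c"
      using W(4) unfolding regular_def by blast
    \<comment> \<open>\<open>P\<close> keeps the curve inside \<open>W\<close>: it is nonzero at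
      parameter 0, so only finitely many parameters leave its nonvanishing locus.\<close>
    obtain m' e' P where P: "multihom m' e' P" "z0 \<in> nonvanishing P" "nonvanishing P \<subseteq> W"
      using zopenE[OF W(1,2)] by blast
    obtain v \<eta> z E where c: "finite E"
      "\<And>f. f \<in> dual_space scale \<Longrightarrow> poly_fun (\<lambda>s. f (v s))"
      "\<And>j u. j \<in> {1..t} \<Longrightarrow> poly_fun (\<lambda>s. \<eta> s j u)"
      "(v 0, \<eta> 0) \<in> coords z0"
      "\<And>s. s \<notin> E \<Longrightarrow> z s \<in> points \<and> (v s, \<eta> s) \<in> coords (z s) \<and> generic (v s)"
      by (rule curve_through_exc[OF z0(1) i], rule that)
    have pc: "poly_fun (\<lambda>r. H (v r, \<eta> r))" if "multihom m e H" for m e H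
      using that c(2,3) by (rule multihom_poly_fun)
    have "P (v 0, \<eta> 0) \<noteq> 0" using nonvanishing_coords[OF P(1,2) c(4)] .
    then have finP: "finite {r. P (v r, \<eta> r) = 0}"
      by (rule poly_fun_finite_zeros[OF pc[OF P(1)]])
    have "F (v r, \<eta> r) = 0" if r: "r \<notin> E \<union> {r. P (v r, \<eta> r) = 0}" for r
    proof -
      have zr: "z r \<in> points" "(v r, \<eta> r) \<in> coords (z r)" "generic (v r)" using c(5) r by auto
      then have "z r \<in> nonvanishing P" using r unfolding nonvanishing_def by blast
      then have w: "z r \<in> W" using P(3) by blast
      have "s (z r) (v r) = 0"
        using w W(3) coordsD(1)[OF zr(2)] zr(3) by (intro 0) auto
      then show ?thesis using FG(3)[OF w zr(2)] by auto
    qed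
    then have F0: "F (v 0, \<eta> 0) = 0"
      by (rule poly_fun_zero[OF pc[OF FG(1)] finite_UnI[OF c(1) finP]])
    obtain \<eta>' where \<eta>': "(v0, \<eta>') \<in> coords z0" using coords_exist[OF z0(1,3,4)] by blast
    \<comment> \<open>The curve starts at other coordinates of the same point; vanishing of
      \<open>F\<close> is independent of the coordinates.\<close>
    have "F (v0, \<eta>') = 0"
      using multihom_nonzero[OF z0(1) \<eta>' c(4) FG(1)] F0 by blast
    then show ?thesis using FG(3)[OF W(2) \<eta>'] by simp
  qed
qed

lemma section_eqI:
  assumes U: "zopen U" and s: "s \<in> line_sheaf d U" "s' \<in> line_sheaf d U"
    and eq: "\<And>z v. z \<in> U \<Longrightarrow> v \<in> fst z \<Longrightarrow> generic v \<Longrightarrow> s z v = s' z v"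
  shows "s = s'"
proof -
  have "(\<lambda>z v. s z v + (- 1) * s' z v) \<in> line_sheaf d U"
    by (rule line_sheaf_add[OF s(1) line_sheaf_const_mult[OF U s(2)]])
  then have "(\<lambda>z v. s z v + (- 1) * s' z v) = 0"
    by (rule section_eq_zero[OF U]) (simp add: eq)
  then show ?thesis by (simp add: fun_eq_iff)
qed

end

context blown_up_points
begin

subsection \<open>The sheaves of the exceptional divisors\<close>

lemma exc_sheaf_line: "s \<in> exc_sheaf i U \<Longrightarrow> s \<in> line_sheaf 0 (U - exc i)"
  by (simp add: exc_sheaf_def)

lemma exc_sheaf_extend:
  assumes "s \<in> exc_sheaf i U" "zopen W" "W \<subseteq> U" "g \<in> exc_ideal i W"
  obtains k where "k \<in> line_sheaf 0 W" "\<And>z v. z \<in> W - exc i \<Longrightarrow> k z v = s z v * g z v"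
proof -
  obtain k where "k \<in> line_sheaf 0 W" "\<forall>z\<in>W - exc i. k z = s z * g z"
    using assms unfolding exc_sheaf_def by blast
  then show ?thesis using that by simp
qed

lemma exc_sheafI:
  assumes "s \<in> line_sheaf 0 (U - exc i)"
    and "\<And>W g. zopen W \<Longrightarrow> W \<subseteq> U \<Longrightarrow> g \<in> exc_ideal i W \<Longrightarrow>
      \<exists>k\<in>line_sheaf 0 W. \<forall>z\<in>W - exc i. \<forall>v. k z v = s z v * g z v"
  shows "s \<in> exc_sheaf i U"
  using assms unfolding exc_sheaf_def by (simp add: fun_eq_iff)

lemma exc_sheaf_restrict:
  assumes U: "zopen U" and i: "i \<in> {1..t}" and s: "s \<in> line_sheaf 0 U"
  shows "restrict_to (U - exc i) s \<in> exc_sheaf i U"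
proof (rule exc_sheafI)
  show "restrict_to (U - exc i) s \<in> line_sheaf 0 (U - exc i)"
    by (rule line_sheaf_restrict[OF s zopen_diff_exc[OF U i]]) blast
  fix W g assume W: "zopen W" "W \<subseteq> U" and "g \<in> exc_ideal i W"
  then have g: "g \<in> line_sheaf 0 W" by (simp add: exc_ideal_def)
  have "(\<lambda>z v. restrict_to W s z v * g z v) \<in> line_sheaf (0 + 0) W"
    by (rule line_sheaf_mult[OF line_sheaf_restrict[OF s W] g])
  then show "\<exists>k\<in>line_sheaf 0 W. \<forall>z\<in>W - exc i. \<forall>v. k z v = restrict_to (U - exc i) s z v * g z v"
    using W(2) by (intro bexI[of _ "\<lambda>z v. restrict_to W s z v * g z v"]) (auto simp: restrict_to_def)
qed

lemma exc_sheaf_add: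
  assumes s: "s \<in> exc_sheaf i U" and s': "s' \<in> exc_sheaf i U"
  shows "(\<lambda>z v. s z v + s' z v) \<in> exc_sheaf i U"
proof (rule exc_sheafI)
  show "(\<lambda>z v. s z v + s' z v) \<in> line_sheaf 0 (U - exc i)"
    using s s' by (intro line_sheaf_add exc_sheaf_line)
  fix W g assume W: "zopen W" "W \<subseteq> U" "g \<in> exc_ideal i W"
  obtain k where k: "k \<in> line_sheaf 0 W" "\<And>z v. z \<in> W - exc i \<Longrightarrow> k z v = s z v * g z v"
    using exc_sheaf_extend[OF s W] by blast
  obtain k' where k': "k' \<in> line_sheaf 0 W" "\<And>z v. z \<in> W - exc i \<Longrightarrow> k' z v = s' z v * g z v"
    using exc_sheaf_extend[OF s' W] by blast
  show "\<exists>k\<in>line_sheaf 0 W. \<forall>z\<in>W - exc i. \<forall>v. k z v = (s z v + s' z v) * g z v"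
    by (rule bexI[OF _ line_sheaf_add[OF k(1) k'(1)]]) (simp add: k(2) k'(2) distrib_right)
qed

lemma exc_sheaf_const_mult:
  assumes U: "zopen U" and i: "i \<in> {1..t}" and s: "s \<in> exc_sheaf i U"
  shows "(\<lambda>z v. c * s z v) \<in> exc_sheaf i U"
proof (rule exc_sheafI)
  show "(\<lambda>z v. c * s z v) \<in> line_sheaf 0 (U - exc i)"
    by (intro line_sheaf_const_mult exc_sheaf_line zopen_diff_exc U i s)
  fix W g assume W: "zopen W" "W \<subseteq> U" "g \<in> exc_ideal i W"
  obtain k where k: "k \<in> line_sheaf 0 W" "\<And>z v. z \<in> W - exc i \<Longrightarrow> k z v = s z v * g z v"
    using exc_sheaf_extend[OF s W] by blast
  show "\<exists>k\<in>line_sheaf 0 W. \<forall>z\<in>W - exc i. \<forall>v. k z v = (c * s z v) * g z v"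
    by (rule bexI[OF _ line_sheaf_const_mult[OF W(1) k(1), of c]]) (simp add: k(2))
qed

text \<open>
  Let \<open>u\<close> be a vector off the line \<open>L\<close> of a point of the blow-up. The forms through \<open>x\<^sub>i\<close> that vanish
  at \<open>u\<close> are the multiples of \<open>\<kappa>\<close>. Subtracting from \<open>h i b\<close> a multiple of the form
  \<open>\<eta> i\<close> of \<open>L\<close>, which vanishes on the point, gives such a multiple \<open>\<rho> * \<kappa>\<close> with \<open>\<rho>\<close> regular.
  Hence \<open>\<kappa>\<close> is a local equation of \<open>R\<^sub>i\<close> which divides \<open>h i b\<close>.
\<close>

lemma lin_extend_local:
  assumes U: "zopen U" and i: "i \<in> {1..t}" and b: "b < 2" and s: "s \<in> exc_sheaf i U" and z0: "z0 \<in> U"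
  shows "\<exists>W g. zopen W \<and> z0 \<in> W \<and> W \<subseteq> U \<and> g \<in> line_sheaf 1 W \<and>
    (\<forall>z\<in>W - exc i. \<forall>v. g z v = h i b v * s z v)"
proof -
  have z0p: "z0 \<in> points" using zopen_subset[OF U] z0 by blast
  obtain c0 where c0: "c0 \<in> coords z0" using coords_nonempty[OF z0p] by blast
  \<comment> \<open>\<open>y a\<close> adjusts degrees: \<open>exc_ideal\<close> consists of
    functions of degree 0, so \<open>s\<close> is tested against \<kappa> divided by
    \<open>y a\<close>, and the final section is multiplied by \<open>y a\<close> again.\<close>
  obtain a where a: "a < 3" "y a (fst c0) \<noteq> 0" using y_nonzero[OF coordsD(2)[OF c0]] by blast
  obtain u where u: "snd c0 i u \<noteq> 0" using coords_forms(3)[OF z0p c0 i] by blast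
  have "u \<notin> x i" using coords_forms(1)[OF z0p c0 i] u by (auto simp: forms_through_def)
  define \<kappa> where "\<kappa> v = h i 0 u * h i 1 v - h i 1 u * h i 0 v" for v
  obtain u' where u': "\<kappa> u' \<noteq> 0" unfolding \<kappa>_def using join_form_nonzero[OF i \<open>u \<notin> x i\<close>] by blast
  have "(\<lambda>v. h i 0 u * h i 1 v + (- h i 1 u) * h i 0 v) \<in> dual_space scale"
    by (intro dual_space_combine h_dual i) auto
  then have \<kappa>_dual: "\<kappa> \<in> dual_space scale" by (simp add: \<kappa>_def[abs_def])
  define e :: "nat \<Rightarrow> nat" where "e = (\<lambda>j. if j = i then 1 else 0)"
  define N where "N w = (\<lambda>(v :: 'v, \<eta> :: nat \<Rightarrow> 'v \<Rightarrow> 'k). \<eta> i w)" for w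
  define Y where "Y = (\<lambda>(v, \<eta> :: nat \<Rightarrow> 'v \<Rightarrow> 'k). y a v)"
  define K where "K = (\<lambda>(v, \<eta> :: nat \<Rightarrow> 'v \<Rightarrow> 'k). \<kappa> v)"
  have N: "multihom 0 e (N w)" for w unfolding N_def e_def using i by (rule covec)
  have Y: "multihom 1 (\<lambda>_. 0) Y" unfolding Y_def by (rule vec[OF y_dual[OF a(1)]])
  have K: "multihom 1 (\<lambda>_. 0) K" unfolding K_def by (rule vec[OF \<kappa>_dual])
  have cN: "multihom 0 e (\<lambda>p. r * N w p)" for r w
    using mult[OF multihom.const[of r] N[of w]] by simp
  define W where "W = U \<inter> (nonvanishing (N u) \<inter> nonvanishing Y)"
  have W: "zopen W" "W \<subseteq> U"
    unfolding W_def using zopen_Int[OF U zopen_Int[OF zopen_nonvanishing[OF N] zopen_nonvanishing[OF Y]]] by auto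
  have "z0 \<in> W"
    unfolding W_def nonvanishing_def using z0 z0p c0 u a(2) by (auto simp: N_def Y_def case_prod_beta)
  have nz: "N u c \<noteq> 0" "Y c \<noteq> 0" if "w \<in> W" "c \<in> coords w" for w c
    using nonvanishing_coords[OF N _ that(2)] nonvanishing_coords[OF Y _ that(2)] that(1) by (auto simp: W_def)
  \<comment> \<open>Numerator of \<rho>. The multiple of \<kappa> is
    \<open>h i b - (h i b u / \<eta> i u) * \<eta> i\<close>; the factor is its value at
    \<open>u'\<close> divided by \<open>\<kappa> u'\<close>, and clearing \<open>\<eta> i u\<close>
    gives two functions of equal degree.\<close>
  have F: "multihom (0 + 0) e (\<lambda>p. h i b u' * N u p + (- h i b u) * N u' p)"
    unfolding add_0 by (rule add[OF cN cN])
  have nz': "\<kappa> u' * N u c \<noteq> 0" if "w \<in> W" "c \<in> coords w" for w c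
    using nz(1)[OF that] u' by simp
  obtain \<rho> where \<rho>: "\<rho> \<in> line_sheaf 0 W"
    "\<And>w c. w \<in> W \<Longrightarrow> c \<in> coords w \<Longrightarrow>
      \<rho> w (fst c) = (h i b u' * N u c + (- h i b u) * N u' c) / (\<kappa> u' * N u c)"
    by (rule fraction_section[OF W(1) F cN], erule (1) nz', rule that)
  have K': "multihom (1 + 0) (\<lambda>_. 0) K" using K by simp
  obtain q where q: "q \<in> line_sheaf 0 W"
    "\<And>w c. w \<in> W \<Longrightarrow> c \<in> coords w \<Longrightarrow> q w (fst c) = K c / Y c"
    by (rule fraction_section[OF W(1) K' Y], erule (1) nz(2), rule that)
  have "q z v = 0" if z: "z \<in> W \<inter> exc i" for z v
  proof (cases "in_support W z v")
    case True
    then have "z \<in> points" "v \<in> fst z" "v \<noteq> 0" using zopen_subset[OF W(1)] by (auto simp: in_support_def)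
    then obtain \<eta> where c: "(v, \<eta>) \<in> coords z" using coords_exist by blast
    have "v \<in> x i" using z \<open>v \<in> fst z\<close> by (simp add: exc_def)
    then have "\<kappa> v = 0" using h_vanish[OF i] by (simp add: \<kappa>_def)
    then show ?thesis using q(2)[OF _ c] z by (simp add: K_def)
  next
    case False
    then show ?thesis by (rule line_sheaf_support[OF q(1)])
  qed
  then have "q \<in> exc_ideal i W" using q(1) by (simp add: exc_ideal_def fun_eq_iff)
  then obtain k where k: "k \<in> line_sheaf 0 W" "\<And>z v. z \<in> W - exc i \<Longrightarrow> k z v = s z v * q z v"
    using exc_sheaf_extend[OF s W] by blast
  let ?g = "\<lambda>z v. y a v * (\<rho> z v * k z v)"
  have "?g \<in> line_sheaf (Suc (0 + 0)) W"
    by (rule line_sheaf_form_mult[OF W(1) y_dual[OF a(1)] line_sheaf_mult[OF \<rho>(1) k(1)]])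
  moreover have "?g z v = h i b v * s z v" if z: "z \<in> W - exc i" for z v
  proof (cases "in_support W z v")
    case True
    then have zp: "z \<in> points" "v \<in> fst z" "v \<noteq> 0" "z \<in> W"
      using zopen_subset[OF W(1)] by (auto simp: in_support_def)
    then obtain \<eta> where c: "(v, \<eta>) \<in> coords z" using coords_exist by blast
    have Y0: "y a v \<noteq> 0" and N0: "\<eta> i u \<noteq> 0" using nz[OF zp(4) c] by (simp_all add: Y_def N_def)
    note cf = coords_forms[OF zp(1) c i, simplified]
    obtain \<alpha> \<beta> where ab: "\<And>w. \<eta> i w = \<alpha> * h i 0 w + \<beta> * h i 1 w"
      using form_through_coeffs[OF i cf(1)] by blast
    have rel: "\<alpha> * h i 0 v = - (\<beta> * h i 1 v)" using cf(2) by (simp add: ab eq_neg_iff_add_eq_0)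
    have rel': "\<beta> * h i 1 v = - (\<alpha> * h i 0 v)" unfolding rel by simp
    \<comment> \<open>This is \<open>\<rho> * \<kappa> = h i b\<close> at \<open>v\<close>, with
      denominators cleared. It holds because \<open>\<eta> i v = 0\<close>, which enters as
      \<open>rel\<close> or \<open>rel'\<close> depending on \<open>b\<close>.\<close>
    have key: "(h i b u' * \<eta> i u - h i b u * \<eta> i u') * \<kappa> v = h i b v * (\<kappa> u' * \<eta> i u)"
    proof (cases "b = 0")
      case True
      have "(h i 0 u' * \<eta> i u - h i 0 u * \<eta> i u') * \<kappa> v =
          \<kappa> u' * (h i 1 u * (\<beta> * h i 0 v) - h i 0 u * (\<beta> * h i 1 v))"
        by (simp add: ab \<kappa>_def algebra_simps)
      also have "\<dots> = h i 0 v * (\<kappa> u' * \<eta> i u)"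
        unfolding rel' by (simp add: ab algebra_simps)
      finally show ?thesis using True by simp
    next
      case False
      have "(h i 1 u' * \<eta> i u - h i 1 u * \<eta> i u') * \<kappa> v =
          \<kappa> u' * (h i 0 u * (\<alpha> * h i 1 v) - h i 1 u * (\<alpha> * h i 0 v))"
        by (simp add: ab \<kappa>_def algebra_simps)
      also have "\<dots> = h i 1 v * (\<kappa> u' * \<eta> i u)"
        unfolding rel by (simp add: ab algebra_simps)
      finally show ?thesis using False b by (cases b) simp_all
    qed
    have "\<rho> z v * (\<kappa> u' * \<eta> i u) = h i b u' * \<eta> i u - h i b u * \<eta> i u'"
      using \<rho>(2)[OF zp(4) c] N0 u' by (simp add: N_def)
    with key have "(\<kappa> u' * \<eta> i u) * (\<rho> z v * \<kappa> v) = (\<kappa> u' * \<eta> i u) * h i b v"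
      by (metis mult.assoc mult.commute)
    then have "\<rho> z v * \<kappa> v = h i b v" using N0 u' by simp
    moreover have "k z v = s z v * (\<kappa> v / y a v)"
      using k(2)[OF z] q(2)[OF zp(4) c] by (simp add: K_def Y_def)
    ultimately show ?thesis using Y0 by (simp add: ac_simps)
  next
    case False
    then have "\<not> in_support (U - exc i) z v" using z by (simp add: in_support_def)
    then show ?thesis
      using False line_sheaf_support[OF k(1)] line_sheaf_support[OF exc_sheaf_line[OF s]] by simp
  qed
  ultimately show ?thesis using W \<open>z0 \<in> W\<close> by (intro exI[of _ W] exI[of _ ?g]) auto
qed

text \<open>Local extensions agree off \<open>exc i\<close>, hence on overlaps by
  \<open>section_eqI\<close>, and so they glue.\<close>

lemma lin_extend:
  assumes U: "zopen U" and i: "i \<in> {1..t}" and b: "b < 2" and s: "s \<in> exc_sheaf i U"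
  obtains g where "g \<in> line_sheaf 1 U" "\<And>z v. z \<in> U - exc i \<Longrightarrow> g z v = h i b v * s z v"
proof -
  have "\<forall>z0\<in>U. \<exists>W g. zopen W \<and> z0 \<in> W \<and> W \<subseteq> U \<and> g \<in> line_sheaf 1 W \<and>
      (\<forall>z\<in>W - exc i. \<forall>v. g z v = h i b v * s z v)"
    using lin_extend_local[OF assms] by blast
  then obtain W gl where *: "\<And>z0. z0 \<in> U \<Longrightarrow> zopen (W z0) \<and> z0 \<in> W z0 \<and> W z0 \<subseteq> U \<and>
      gl z0 \<in> line_sheaf 1 (W z0) \<and> (\<forall>z\<in>W z0 - exc i. \<forall>v. gl z0 z v = h i b v * s z v)"
    by metis
  \<comment> \<open>At \<open>z\<close> the value comes from the extension chosen for
    \<open>z\<close> itself; \<open>agree\<close> shows that the one chosen for any other point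
    gives the same wherever it is defined.\<close>
  define g where "g = (\<lambda>z v. if in_support U z v then gl z z v else 0)"
  have agree: "g w = gl z0 w" if z0: "z0 \<in> U" and w: "w \<in> W z0" for z0 w
  proof
    fix v
    note 1 = *[OF z0]
    have wU: "w \<in> U" using 1 w by blast
    note 2 = *[OF wU]
    show "g w v = gl z0 w v"
    proof (cases "in_support U w v")
      case True
      let ?V = "W w \<inter> W z0"
      have V: "zopen ?V" using 1 2 zopen_Int by blast
      have "restrict_to ?V (gl w) = restrict_to ?V (gl z0)"
      proof (rule section_eqI[OF V])
        show "restrict_to ?V (gl w) \<in> line_sheaf 1 ?V" "restrict_to ?V (gl z0) \<in> line_sheaf 1 ?V"
          using 1 2 V by (auto intro!: line_sheaf_restrict)
        fix z v assume "z \<in> ?V" "v \<in> fst z" "generic v"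
        moreover from this have "z \<notin> exc i" using generic_not_exc i by blast
        ultimately show "restrict_to ?V (gl w) z v = restrict_to ?V (gl z0) z v"
          using 1 2 by (simp add: restrict_to_def)
      qed
      then have "restrict_to ?V (gl w) w v = restrict_to ?V (gl z0) w v" by simp
      then show ?thesis using True 2 w by (simp add: g_def restrict_to_def)
    next
      case False
      then have "\<not> in_support (W z0) w v" using wU by (simp add: in_support_def)
      then have "gl z0 w v = 0" using 1 line_sheaf_support by blast
      then show ?thesis using False by (simp add: g_def)
    qed
  qed
  have "g \<in> line_sheaf 1 U"
  proof (rule line_sheaf_glue)
    fix z v assume "\<not> in_support U z v"
    then show "g z v = 0" by (simp add: g_def)
  next
    fix z assume z: "z \<in> U"
    show "\<exists>W r. zopen W \<and> z \<in> W \<and> W \<subseteq> U \<and> r \<in> line_sheaf 1 W \<and> (\<forall>w\<in>W. g w = r w)"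
      using *[OF z] agree[OF z] by (intro exI[of _ "W z"] exI[of _ "gl z"]) blast
  qed
  moreover have "g z v = h i b v * s z v" if z: "z \<in> U - exc i" for z v
    using *[of z] agree[of z z] z by simp
  ultimately show ?thesis by (rule that)
qed

subsection \<open>Summands and morphisms\<close>

lemma summand_cases:
  assumes "j \<in> {1..t+3}"
  obtains "j \<in> {1..t}" "summand j = exc_sheaf j" | d where "summand j = line_sheaf d"
proof -
  consider "j \<in> {1..t}" | "j = t + 1" | "j = t + 2" | "j = t + 3"
    using assms by fastforce
  then show ?thesis
  proof cases
    case 1
    then show ?thesis by (intro that(1)) (auto simp: summand_def)
  qed (use that(2)[of 0] that(2)[of 1] that(2)[of 2] in \<open>simp_all add: summand_def\<close>)
qed

lemma summand_add:
  "j \<in> {1..t+3} \<Longrightarrow> s \<in> summand j U \<Longrightarrow> s' \<in> summand j U \<Longrightarrow> (\<lambda>z v. s z v + s' z v) \<in> summand j U"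
  by (erule summand_cases) (simp_all add: exc_sheaf_add line_sheaf_add)

lemma summand_const_mult:
  "zopen U \<Longrightarrow> j \<in> {1..t+3} \<Longrightarrow> s \<in> summand j U \<Longrightarrow> (\<lambda>z v. c * s z v) \<in> summand j U"
  by (erule summand_cases) (simp_all add: exc_sheaf_const_mult line_sheaf_const_mult)

lemma summand_zero:
  assumes "zopen U" "j \<in> {1..t+3}" shows "0 \<in> summand j U"
  using assms(2)
proof (cases rule: summand_cases)
  case 1
  have "restrict_to (U - exc j) 0 = (0 :: ('k, 'v) bsection)"
    by (simp add: restrict_to_def fun_eq_iff)
  then show ?thesis
    using exc_sheaf_restrict[OF assms(1) 1(1) line_sheaf_zero[OF assms(1)]] 1(2) by simp
next
  case (2 d)
  then show ?thesis using line_sheaf_zero[OF assms(1)] by simp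
qed

lemma summand_sum:
  assumes "zopen U" "j \<in> {1..t+3}" "\<And>r. r \<in> S \<Longrightarrow> s r \<in> summand j U"
  shows "(\<lambda>z v. \<Sum>r\<in>S. c r * s r z v) \<in> summand j U"
  using assms(3)
proof (induction S rule: infinite_finite_induct)
  case (insert r S)
  have "(\<lambda>z v. c r * s r z v + (\<Sum>r\<in>S. c r * s r z v)) \<in> summand j U"
    using insert by (intro summand_add summand_const_mult assms(1,2)) auto
  then show ?case using insert(1,2) by simp
qed (use summand_zero[OF assms(1,2)] in \<open>simp_all add: zero_fun_def\<close>)

text \<open>A section of an exceptional sheaf is a function on the open set
  \<open>U - exc j\<close>, so the density argument is run on that set.\<close>

lemma summand_eq_zero:
  assumes U: "zopen U" and j: "j \<in> {1..t+3}" and s: "s \<in> summand j U"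
    and 0: "\<And>z v. z \<in> U \<Longrightarrow> v \<in> fst z \<Longrightarrow> generic v \<Longrightarrow> s z v = 0"
  shows "s = 0"
  using j
proof (cases rule: summand_cases)
  case 1
  then have "s \<in> line_sheaf 0 (U - exc j)" using s exc_sheaf_line by simp
  then show ?thesis by (rule section_eq_zero[OF zopen_diff_exc[OF U 1(1)]]) (use 0 in auto)
next
  case (2 d)
  then have "s \<in> line_sheaf d U" using s by simp
  then show ?thesis by (rule section_eq_zero[OF U]) (use 0 in auto)
qed

primrec arrow_form :: "'v \<Rightarrow> arrow \<Rightarrow> 'k" where
  "arrow_form v (Exc i) = 1"
| "arrow_form v (Lin i b) = h i b v"
| "arrow_form v (Coord a) = y a v"

lemma arrow_map_summand:
  assumes U: "zopen U" and a: "a \<in> arcs (quiver t)" and s: "s \<in> summand (tail (quiver t) a) U"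
  shows "arrow_map a U s \<in> summand (head (quiver t) a) U"
    and "\<And>z v. z \<in> U \<Longrightarrow> v \<in> fst z \<Longrightarrow> generic v \<Longrightarrow> arrow_map a U s z v = arrow_form v a * s z v"
proof -
  have "arrow_map a U s \<in> summand (head (quiver t) a) U \<and>
    (\<forall>z v. z \<in> U \<longrightarrow> v \<in> fst z \<longrightarrow> generic v \<longrightarrow> arrow_map a U s z v = arrow_form v a * s z v)"
  proof (cases a)
    case (Exc i)
    then have i: "i \<in> {1..t}" using a by (simp add: quiver_def)
    have "s \<in> line_sheaf 0 U" using s Exc by (simp add: quiver_def summand_def)
    then have "restrict_to (U - exc i) s \<in> exc_sheaf i U" using exc_sheaf_restrict[OF U i] by blast
    moreover have "summand i = exc_sheaf i" using i by (auto simp: summand_def)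
    ultimately show ?thesis using Exc generic_not_exc[OF _ _ i] by (simp add: quiver_def restrict_to_def)
  next
    case (Lin i b)
    then have i: "i \<in> {1..t}" and b: "b < 2" using a by (simp_all add: quiver_def)
    have s: "s \<in> exc_sheaf i U" using s Lin i by (auto simp: quiver_def summand_def split: if_splits)
    let ?P = "\<lambda>g. g \<in> line_sheaf 1 U \<and> (\<forall>z\<in>U - exc i. g z = (\<lambda>v. h i b v * s z v))"
    obtain g where g: "g \<in> line_sheaf 1 U" "\<And>z v. z \<in> U - exc i \<Longrightarrow> g z v = h i b v * s z v"
      using lin_extend[OF U i b s] by blast
    have Pg: "?P g" using g by auto
    have "g' = g" if "?P g'" for g'
    proof (rule section_eqI[OF U])
      fix z v assume "z \<in> U" "v \<in> fst z" "generic v"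
      moreover from this have "z \<notin> exc i" using generic_not_exc i by blast
      ultimately show "g' z v = g z v" using that g(2) by simp
    qed (use that g in auto)
    \<comment> \<open>Existence comes from \<open>lin_extend\<close> and uniqueness from
      \<open>section_eqI\<close>, so the definite description in \<open>arrow_map\<close> denotes
      the extension.\<close>
    with Pg have "(THE g. ?P g) = g" by (rule the_equality)
    then have "arrow_map a U s = g" using Lin by simp
    then show ?thesis using g generic_not_exc[OF _ _ i] Lin by (simp add: quiver_def summand_def)
  next
    case (Coord c)
    then have c: "c < 3" using a by (simp add: quiver_def)
    have "s \<in> line_sheaf 1 U" using s Coord by (simp add: quiver_def summand_def)
    then have "(\<lambda>z v. y c v * s z v) \<in> line_sheaf (Suc 1) U"
      by (rule line_sheaf_form_mult[OF U y_dual[OF c]])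
    then show ?thesis using Coord by (simp add: quiver_def summand_def numeral_2_eq_2)
  qed
  then show "arrow_map a U s \<in> summand (head (quiver t) a) U"
    and "\<And>z v. z \<in> U \<Longrightarrow> v \<in> fst z \<Longrightarrow> generic v \<Longrightarrow> arrow_map a U s z v = arrow_form v a * s z v"
    by blast+
qed

lemma sum_sheafD: "\<sigma> \<in> sum_sheaf U \<Longrightarrow> j \<in> {1..t+3} \<Longrightarrow> \<sigma> j \<in> summand j U"
  by (auto simp: sum_sheaf_def)

lemma sum_sheafI:
  "(\<And>j. j \<in> {1..t+3} \<Longrightarrow> \<sigma> j \<in> summand j U) \<Longrightarrow> (\<And>j. j \<notin> {1..t+3} \<Longrightarrow> \<sigma> j = 0) \<Longrightarrow> \<sigma> \<in> sum_sheaf U"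
  by (simp add: sum_sheaf_def)

lemma sum_sheaf_single:
  assumes "zopen U" "i \<in> {1..t+3}" "s \<in> summand i U"
  shows "(\<lambda>j. if j = i then s else 0) \<in> sum_sheaf U"
  using assms summand_zero by (intro sum_sheafI) auto

end

lemma verts_quiver: "verts (quiver t) = {1..t+3}"
  by (simp add: quiver_def)

lemma wf_quiver: "wf_digraph (quiver t)"
  by unfold_locales (auto simp: quiver_def)

context blown_up_points
begin

section \<open>Endomorphisms attached to paths\<close>

lemma arrow_ends: "a \<in> arcs (quiver t) \<Longrightarrow> tail (quiver t) a \<in> {1..t+3} \<and> head (quiver t) a \<in> {1..t+3}"
  using wf_digraph.tail_in_verts[OF wf_quiver] wf_digraph.head_in_verts[OF wf_quiver]
  by (simp add: quiver_def)

lemma arrow_endo_sum_sheaf: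
  assumes "zopen U" "a \<in> arcs (quiver t)" "\<sigma> \<in> sum_sheaf U"
  shows "arrow_endo a U \<sigma> \<in> sum_sheaf U"
proof -
  have "arrow_map a U (\<sigma> (tail (quiver t) a)) \<in> summand (head (quiver t) a) U"
    using arrow_map_summand(1)[OF assms(1,2)] sum_sheafD[OF assms(3)] arrow_ends[OF assms(2)] by blast
  then show ?thesis
    using sum_sheaf_single[OF assms(1)] arrow_ends[OF assms(2)] assms(1,3) by (simp add: arrow_endo_def)
qed

text \<open>Outside its domain a path yields 0, which the next arrow must preserve. For
  \<open>Lin\<close> this concerns the value of a definite description, so it is derived from
  vanishing at generic vectors.\<close>

lemma arrow_endo_zero:
  assumes "a \<in> arcs (quiver t)" shows "arrow_endo a U 0 = 0"
proof (cases "zopen U")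
  case True
  note ends = arrow_ends[OF assms]
  have 0: "0 \<in> summand (tail (quiver t) a) U" using summand_zero[OF True] ends by blast
  have "arrow_map a U 0 = 0"
    by (rule summand_eq_zero[OF True _ arrow_map_summand(1)[OF True assms 0]])
       (use ends arrow_map_summand(2)[OF True assms 0] in auto)
  then show ?thesis by (simp add: arrow_endo_def fun_eq_iff)
qed (simp add: arrow_endo_def)

definition path_form :: "'v \<Rightarrow> nat \<times> arrow list \<times> nat \<Rightarrow> 'k" where
  "path_form v = (\<lambda>(i, p, j). prod_list (map (arrow_form v) p))"

text \<open>\<open>path_endo\<close> disregards the end vertex of its argument, so \<open>k\<close>
  is arbitrary and can be taken as the tail of \<open>a\<close>.\<close>

lemma path_endo_snoc: "path_endo (i, p @ [a], j) U \<sigma> = arrow_endo a U (path_endo (i, p, k) U \<sigma>)"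
  by simp

lemma path_endo_outside:
  assumes "set p \<subseteq> arcs (quiver t)" "\<not> (zopen U \<and> \<sigma> \<in> sum_sheaf U)"
  shows "path_endo (i, p, j) U \<sigma> = 0"
  using assms(1)
proof (induction p rule: rev_induct)
  case Nil
  then show ?case using assms(2) by (auto simp: vertex_endo_def fun_eq_iff)
next
  case (snoc a p)
  have "path_endo (i, p, j) U \<sigma> = 0" by (rule snoc.IH) (use snoc.prems in simp)
  moreover have "a \<in> arcs (quiver t)" using snoc.prems by simp
  ultimately show ?case unfolding path_endo_snoc[of i p a j U \<sigma> j] by (simp only: arrow_endo_zero)
qed

text \<open>Membership and formula go through one induction, since the formula for the next arrow
  presupposes that the section reached so far lies in the summand at its tail.\<close>

lemma path_endo_inside:
  assumes "zopen U" "\<sigma> \<in> sum_sheaf U" "pre_digraph.awalk (quiver t) i p j"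
  shows "path_endo (i, p, j) U \<sigma> \<in> sum_sheaf U"
    and "\<And>k z v. z \<in> U \<Longrightarrow> v \<in> fst z \<Longrightarrow> generic v \<Longrightarrow>
      path_endo (i, p, j) U \<sigma> k z v = (if k = j then path_form v (i, p, j) * \<sigma> i z v else 0)"
proof -
  interpret wf_digraph "quiver t" by (rule wf_quiver)
  have "path_endo (i, p, j) U \<sigma> \<in> sum_sheaf U \<and> (\<forall>k z v. z \<in> U \<longrightarrow> v \<in> fst z \<longrightarrow> generic v \<longrightarrow>
      path_endo (i, p, j) U \<sigma> k z v = (if k = j then path_form v (i, p, j) * \<sigma> i z v else 0))"
    using assms(3)
  proof (induction p arbitrary: j rule: rev_induct)
    case Nil
    then have i: "i \<in> {1..t+3}" "j = i" by (simp_all add: awalk_Nil_iff verts_quiver)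
    have "path_endo (i, [], j) U \<sigma> = (\<lambda>k. if k = i then \<sigma> i else 0)"
      using assms by (simp add: vertex_endo_def)
    then show ?case
      using sum_sheaf_single[OF assms(1) i(1) sum_sheafD[OF assms(2) i(1)]] i(2) by (simp add: path_form_def)
  next
    case (snoc a p)
    let ?k = "tail (quiver t) a"
    have "awalk i p (awlast i p)" "awalk (awlast i p) [a] j" using snoc.prems by simp_all
    then have a: "awalk i p ?k" "a \<in> arcs (quiver t)" "j = head (quiver t) a"
      by (auto simp: awalk_Cons_iff awalk_Nil_iff)
    define \<tau> where "\<tau> = path_endo (i, p, ?k) U \<sigma>"
    note IH = snoc.IH[OF a(1), folded \<tau>_def]
    have e: "path_endo (i, p @ [a], j) U \<sigma> = arrow_endo a U \<tau>"
      unfolding \<tau>_def by (rule path_endo_snoc)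
    have \<tau>: "\<tau> \<in> sum_sheaf U" using IH by blast
    then have \<tau>k: "\<tau> ?k \<in> summand ?k U" using sum_sheafD arrow_ends[OF a(2)] by blast
    have "arrow_endo a U \<tau> k z v = (if k = j then path_form v (i, p @ [a], j) * \<sigma> i z v else 0)"
      if "z \<in> U" "v \<in> fst z" "generic v" for k z v
    proof -
      have "arrow_endo a U \<tau> k z v = (if k = j then arrow_map a U (\<tau> ?k) z v else 0)"
        using assms(1) \<tau> a(3) by (simp add: arrow_endo_def)
      moreover have "arrow_map a U (\<tau> ?k) z v = arrow_form v a * \<tau> ?k z v"
        by (rule arrow_map_summand(2)[OF assms(1) a(2) \<tau>k that])
      moreover have "\<tau> ?k z v = path_form v (i, p, ?k) * \<sigma> i z v"
        using IH[THEN conjunct2, rule_format, OF that, of ?k] by simp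
      ultimately show ?thesis by (simp add: path_form_def)
    qed
    then show ?case unfolding e using arrow_endo_sum_sheaf[OF assms(1) a(2) \<tau>] by blast
  qed
  then show "path_endo (i, p, j) U \<sigma> \<in> sum_sheaf U"
    and "\<And>k z v. z \<in> U \<Longrightarrow> v \<in> fst z \<Longrightarrow> generic v \<Longrightarrow>
      path_endo (i, p, j) U \<sigma> k z v = (if k = j then path_form v (i, p, j) * \<sigma> i z v else 0)"
    by blast+
qed

end

section \<open>Paths of the quiver\<close>

lemma awalk_quiver_iff:
  "pre_digraph.awalk (quiver t) u [] v \<longleftrightarrow> u = v \<and> u \<in> {1..t+3}"
  "pre_digraph.awalk (quiver t) u (Exc i # p) v \<longleftrightarrow> i \<in> {1..t} \<and> u = t + 1 \<and> pre_digraph.awalk (quiver t) i p v"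
  "pre_digraph.awalk (quiver t) u (Lin i b # p) v \<longleftrightarrow> i \<in> {1..t} \<and> b < 2 \<and> u = i \<and> pre_digraph.awalk (quiver t) (t + 2) p v"
  "pre_digraph.awalk (quiver t) u (Coord a # p) v \<longleftrightarrow> a < 3 \<and> u = t + 2 \<and> pre_digraph.awalk (quiver t) (t + 3) p v"
proof -
  interpret wf_digraph "quiver t" by (rule wf_quiver)
  show "awalk u [] v \<longleftrightarrow> u = v \<and> u \<in> {1..t+3}"
    by (simp add: awalk_Nil_iff verts_quiver)
  show "awalk u (Exc i # p) v \<longleftrightarrow> i \<in> {1..t} \<and> u = t + 1 \<and> awalk i p v"
    "awalk u (Lin i b # p) v \<longleftrightarrow> i \<in> {1..t} \<and> b < 2 \<and> u = i \<and> awalk (t + 2) p v"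
    "awalk u (Coord a # p) v \<longleftrightarrow> a < 3 \<and> u = t + 2 \<and> awalk (t + 3) p v"
    unfolding awalk_Cons_iff by (auto simp: quiver_def)
qed

text \<open>Along a walk the level rises strictly, from \<open>t + 1\<close> to \<open>1..t\<close>
  to \<open>t + 2\<close> to \<open>t + 3\<close>, so there are at most three arrows.\<close>

lemma awalk_quiver_cases:
  assumes "pre_digraph.awalk (quiver t) u p v"
  shows "p = [] \<and> u = v \<and> u \<in> {1..t+3} \<or>
    (\<exists>i\<in>{1..t}. p = [Exc i] \<and> u = t + 1 \<and> v = i) \<or>
    (\<exists>i\<in>{1..t}. \<exists>b<2. p = [Lin i b] \<and> u = i \<and> v = t + 2) \<or>
    (\<exists>a<3. p = [Coord a] \<and> u = t + 2 \<and> v = t + 3) \<or>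
    (\<exists>i\<in>{1..t}. \<exists>b<2. p = [Exc i, Lin i b] \<and> u = t + 1 \<and> v = t + 2) \<or>
    (\<exists>i\<in>{1..t}. \<exists>b<2. \<exists>a<3. p = [Lin i b, Coord a] \<and> u = i \<and> v = t + 3) \<or>
    (\<exists>i\<in>{1..t}. \<exists>b<2. \<exists>a<3. p = [Exc i, Lin i b, Coord a] \<and> u = t + 1 \<and> v = t + 3)"
  using assms
proof (induction p arbitrary: u)
  case Nil
  then show ?case by (simp add: awalk_quiver_iff)
next
  case (Cons e p)
  show ?case
  proof (cases e)
    case (Exc i)
    then have "i \<in> {1..t}" "u = t + 1" "pre_digraph.awalk (quiver t) i p v"
      using Cons.prems by (simp_all add: awalk_quiver_iff)
    then show ?thesis using Cons.IH[of i] Exc by auto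
  next
    case (Lin i b)
    then have "i \<in> {1..t}" "b < 2" "u = i" "pre_digraph.awalk (quiver t) (t + 2) p v"
      using Cons.prems by (simp_all add: awalk_quiver_iff)
    then show ?thesis using Cons.IH[of "t + 2"] Lin by auto
  next
    case (Coord a)
    then have "a < 3" "u = t + 2" "pre_digraph.awalk (quiver t) (t + 3) p v"
      using Cons.prems by (simp_all add: awalk_quiver_iff)
    then show ?thesis using Cons.IH[of "t + 3"] Coord by auto
  qed
qed

definition paths_between :: "nat \<Rightarrow> nat \<Rightarrow> nat \<Rightarrow> (nat \<times> arrow list \<times> nat) set" where
  "paths_between t i j = {r. r \<in> paths (quiver t) \<and> path_start r = i \<and> path_end r = j}"

lemma paths_between_iff: "r \<in> paths_between t i j \<longleftrightarrow> (\<exists>p. r = (i, p, j) \<and> pre_digraph.awalk (quiver t) i p j)"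
  by (cases r) (auto simp: paths_between_def paths_def)

lemma paths_between_trivial:
  assumes "i \<in> {1..t+3}"
  shows "paths_between t i i = {(i, [], i)}"
proof (intro subset_antisym subsetI)
  fix r assume "r \<in> paths_between t i i"
  then obtain p where r: "r = (i, p, i)" and p: "pre_digraph.awalk (quiver t) i p i"
    unfolding paths_between_iff by blast
  from awalk_quiver_cases[OF p] assms show "r \<in> {(i, [], i)}"
    by (elim disjE bexE exE conjE) (simp_all add: r image_iff)
qed (use assms in \<open>auto simp: paths_between_iff awalk_quiver_iff\<close>)

lemma paths_between_exc:
  assumes "i \<in> {1..t}"
  shows "paths_between t (t + 1) i = {(t + 1, [Exc i], i)}"
proof (intro subset_antisym subsetI)
  fix r assume "r \<in> paths_between t (t + 1) i"
  then obtain p where r: "r = ((t + 1), p, i)" and p: "pre_digraph.awalk (quiver t) (t + 1) p i"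
    unfolding paths_between_iff by blast
  from awalk_quiver_cases[OF p] assms show "r \<in> {(t + 1, [Exc i], i)}"
    by (elim disjE bexE exE conjE) (simp_all add: r image_iff)
qed (use assms in \<open>auto simp: paths_between_iff awalk_quiver_iff\<close>)

lemma paths_between_lin:
  assumes "i \<in> {1..t}"
  shows "paths_between t i (t + 2) = (\<lambda>b. (i, [Lin i b], t + 2)) ` {..<2}"
proof (intro subset_antisym subsetI)
  fix r assume "r \<in> paths_between t i (t + 2)"
  then obtain p where r: "r = (i, p, (t + 2))" and p: "pre_digraph.awalk (quiver t) i p (t + 2)"
    unfolding paths_between_iff by blast
  from awalk_quiver_cases[OF p] assms show "r \<in> (\<lambda>b. (i, [Lin i b], t + 2)) ` {..<2}"
    by (elim disjE bexE exE conjE) (simp_all add: r image_iff)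
qed (use assms in \<open>auto simp: paths_between_iff awalk_quiver_iff\<close>)

lemma paths_between_coord: "paths_between t (t + 2) (t + 3) = (\<lambda>a. (t + 2, [Coord a], t + 3)) ` {..<3}"
proof (intro subset_antisym subsetI)
  fix r assume "r \<in> paths_between t (t + 2) (t + 3)"
  then obtain p where r: "r = ((t + 2), p, (t + 3))" and p: "pre_digraph.awalk (quiver t) (t + 2) p (t + 3)"
    unfolding paths_between_iff by blast
  from awalk_quiver_cases[OF p] show "r \<in> (\<lambda>a. (t + 2, [Coord a], t + 3)) ` {..<3}"
    by (elim disjE bexE exE conjE) (simp_all add: r image_iff)
qed (auto simp: paths_between_iff awalk_quiver_iff)

lemma paths_between_exc_lin: "paths_between t (t + 1) (t + 2) = (\<lambda>(i, b). (t + 1, [Exc i, Lin i b], t + 2)) ` ({1..t} \<times> {..<2})"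
proof (intro subset_antisym subsetI)
  fix r assume "r \<in> paths_between t (t + 1) (t + 2)"
  then obtain p where r: "r = ((t + 1), p, (t + 2))" and p: "pre_digraph.awalk (quiver t) (t + 1) p (t + 2)"
    unfolding paths_between_iff by blast
  from awalk_quiver_cases[OF p] show "r \<in> (\<lambda>(i, b). (t + 1, [Exc i, Lin i b], t + 2)) ` ({1..t} \<times> {..<2})"
    by (elim disjE bexE exE conjE) (simp_all add: r image_iff)
qed (auto simp: paths_between_iff awalk_quiver_iff)

lemma paths_between_lin_coord:
  assumes "i \<in> {1..t}"
  shows "paths_between t i (t + 3) = (\<lambda>(b, a). (i, [Lin i b, Coord a], t + 3)) ` ({..<2} \<times> {..<3})"
proof (intro subset_antisym subsetI)
  fix r assume "r \<in> paths_between t i (t + 3)"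
  then obtain p where r: "r = (i, p, (t + 3))" and p: "pre_digraph.awalk (quiver t) i p (t + 3)"
    unfolding paths_between_iff by blast
  from awalk_quiver_cases[OF p] assms show "r \<in> (\<lambda>(b, a). (i, [Lin i b, Coord a], t + 3)) ` ({..<2} \<times> {..<3})"
    by (elim disjE bexE exE conjE) (simp_all add: r image_iff)
qed (use assms in \<open>auto simp: paths_between_iff awalk_quiver_iff\<close>)

lemma paths_between_exc_lin_coord: "paths_between t (t + 1) (t + 3) = (\<lambda>(i, b, a). (t + 1, [Exc i, Lin i b, Coord a], t + 3)) ` ({1..t} \<times> {..<2} \<times> {..<3})"
proof (intro subset_antisym subsetI)
  fix r assume "r \<in> paths_between t (t + 1) (t + 3)"
  then obtain p where r: "r = ((t + 1), p, (t + 3))" and p: "pre_digraph.awalk (quiver t) (t + 1) p (t + 3)"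
    unfolding paths_between_iff by blast
  from awalk_quiver_cases[OF p] show "r \<in> (\<lambda>(i, b, a). (t + 1, [Exc i, Lin i b, Coord a], t + 3)) ` ({1..t} \<times> {..<2} \<times> {..<3})"
    by (elim disjE bexE exE conjE) (simp_all add: r image_iff)
qed (auto simp: paths_between_iff awalk_quiver_iff)

lemma paths_between_empty:
  assumes "paths_between t i j \<noteq> {}"
  shows "i = j \<and> i \<in> {1..t+3} \<or> i = t + 1 \<and> j \<in> {1..t} \<or> i \<in> {1..t} \<and> j = t + 2 \<or> i = t + 2 \<and> j = t + 3 \<or>
    i = t + 1 \<and> j = t + 2 \<or> i \<in> {1..t} \<and> j = t + 3 \<or> i = t + 1 \<and> j = t + 3"
proof -
  obtain p where "pre_digraph.awalk (quiver t) i p j" using assms paths_between_iff by blast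
  from awalk_quiver_cases[OF this] show ?thesis
    by (elim disjE bexE exE conjE) simp_all
qed

lemma finite_paths_between: "finite (paths_between t i j)"
proof (cases "paths_between t i j = {}")
  case False
  from paths_between_empty[OF this] show ?thesis
    by (elim disjE conjE) (simp_all only: paths_between_trivial paths_between_exc paths_between_lin
        paths_between_coord paths_between_exc_lin paths_between_lin_coord paths_between_exc_lin_coord
        finite.emptyI finite_insert finite_imageI finite_lessThan finite_atLeastAtMost finite_cartesian_product)
qed simp

lemma paths_quiver_ends:
  assumes "r \<in> paths (quiver t)" shows "path_start r \<in> {1..t+3} \<and> path_end r \<in> {1..t+3}"
proof -
  obtain u p v where r: "r = (u, p, v)" by (cases r)
  then have "pre_digraph.awalk (quiver t) u p v" using assms by (simp add: paths_def)
  from awalk_quiver_cases[OF this] show ?thesis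
    by (elim disjE bexE exE conjE) (simp_all add: r)
qed

lemma finite_paths_quiver: "finite (paths (quiver t))"
proof (rule finite_subset)
  show "paths (quiver t) \<subseteq> (\<Union>i\<in>{1..t+3}. \<Union>j\<in>{1..t+3}. paths_between t i j)"
    using paths_quiver_ends by (auto simp: paths_between_def)
  show "finite (\<Union>i\<in>{1..t+3}. \<Union>j\<in>{1..t+3}. paths_between t i j)"
    by (intro finite_UN_I finite_atLeastAtMost finite_paths_between)
qed

lemma path_sum_between: "path_sum (quiver t) w f i j = (\<Sum>r\<in>paths_between t i j. f r * w r)"
  by (simp add: path_sum_def paths_between_def)

section \<open>The kernel of the natural map\<close>

context blown_up_points
begin

lemma weighted_quiver_path_form: "weighted_quiver (quiver t) (path_form v)"
proof -
  interpret wf_digraph "quiver t" by (rule wf_quiver)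
  show ?thesis
  proof
    fix b a assume "b \<in> paths (quiver t)" "a \<in> paths (quiver t)" "path_end a = path_start b"
    show "path_form v (path_comp b a) = path_form v b * path_form v a"
      by (cases b; cases a) (simp add: path_form_def mult.commute)
  qed (rule finite_paths_quiver)
qed

lemma poly_fun_path_sum: "poly_fun (\<lambda>s. path_sum (quiver t) (path_form (v + scale s w)) f i j)"
proof -
  have "poly_fun (\<lambda>s. prod_list (map (arrow_form (v + scale s w)) p))" if "set p \<subseteq> arcs (quiver t)" for p
    using that
  proof (induction p)
    case (Cons a p)
    have "poly_fun (\<lambda>s. arrow_form (v + scale s w) a)"
      using Cons.prems by (cases a) (simp_all add: quiver_def poly_fun_const poly_fun_line h_dual y_dual)
    then show ?case using Cons by (simp add: poly_fun_mult)
  qed (simp add: poly_fun_const)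
  then have "poly_fun (\<lambda>s. path_form (v + scale s w) r)" if "r \<in> paths (quiver t)" for r
    using that by (cases r) (simp add: path_form_def paths_def pre_digraph.awalk_def)
  then show ?thesis
    unfolding path_sum_def by (intro poly_fun_sum poly_fun_mult poly_fun_const) auto
qed

section \<open>The natural map evaluated on sections\<close>

lemma natural_map_carrier:
  assumes f: "f \<in> carrier (path_algebra (quiver t))"
  shows "natural_map f = (\<lambda>U \<sigma> j z v. \<Sum>r\<in>paths (quiver t). f r * path_endo r U \<sigma> j z v)"
  unfolding natural_map_def
  by (intro ext sum.mono_neutral_left finite_paths_quiver) (use f in auto)

lemma natural_map_outside:
  assumes "f \<in> carrier (path_algebra (quiver t))" "\<not> (zopen U \<and> \<sigma> \<in> sum_sheaf U)"
  shows "natural_map f U \<sigma> j z v = 0"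
proof -
  have "path_endo r U \<sigma> = 0" if "r \<in> paths (quiver t)" for r
    using path_endo_outside[OF _ assms(2)] that
    by (cases r) (auto simp: paths_def pre_digraph.awalk_def simp del: path_endo.simps)
  then show ?thesis unfolding natural_map_carrier[OF assms(1)] by simp
qed

lemma natural_map_summand:
  assumes f: "f \<in> carrier (path_algebra (quiver t))" and U: "zopen U" and \<sigma>: "\<sigma> \<in> sum_sheaf U"
    and j: "j \<in> {1..t+3}"
  shows "natural_map f U \<sigma> j \<in> summand j U"
proof -
  have "path_endo r U \<sigma> j \<in> summand j U" if "r \<in> paths (quiver t)" for r
    using path_endo_inside(1)[OF U \<sigma>] sum_sheafD[OF _ j] that
    by (cases r) (simp add: paths_def del: path_endo.simps)
  then show ?thesis unfolding natural_map_carrier[OF f] by (rule summand_sum[OF U j])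
qed

text \<open>A path reads only the component at its start vertex and writes only to its end vertex;
  grouping the paths by start vertex gives the matrix entries.\<close>

lemma natural_map_generic:
  assumes f: "f \<in> carrier (path_algebra (quiver t))" and U: "zopen U" and \<sigma>: "\<sigma> \<in> sum_sheaf U"
    and z: "z \<in> U" "v \<in> fst z" "generic v"
  shows "natural_map f U \<sigma> j z v = (\<Sum>i\<in>{1..t+3}. path_sum (quiver t) (path_form v) f i j * \<sigma> i z v)"
proof -
  let ?P = "paths (quiver t)"
  have pe: "path_endo r U \<sigma> j z v = (if path_end r = j then path_form v r * \<sigma> (path_start r) z v else 0)"
    if "r \<in> ?P" for r
    using path_endo_inside(2)[OF U \<sigma> _ z] that by (cases r) (simp add: paths_def del: path_endo.simps)
  have "natural_map f U \<sigma> j z v =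
      (\<Sum>r\<in>?P. if path_end r = j then f r * path_form v r * \<sigma> (path_start r) z v else 0)"
    unfolding natural_map_carrier[OF f] by (rule sum.cong) (simp_all add: pe)
  also have "\<dots> = (\<Sum>i\<in>{1..t+3}. \<Sum>r | r \<in> ?P \<and> path_start r = i.
      if path_end r = j then f r * path_form v r * \<sigma> (path_start r) z v else 0)"
    by (rule sum.group[symmetric]) (use finite_paths_quiver paths_quiver_ends in auto)
  also have "\<dots> = (\<Sum>i\<in>{1..t+3}. path_sum (quiver t) (path_form v) f i j * \<sigma> i z v)"
  proof (rule sum.cong[OF refl])
    fix i
    have "(\<Sum>r | r \<in> ?P \<and> path_start r = i.
        if path_end r = j then f r * path_form v r * \<sigma> (path_start r) z v else 0) =
      (\<Sum>r | r \<in> ?P \<and> path_start r = i \<and> path_end r = j. f r * path_form v r * \<sigma> i z v)"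
      by (rule sum.mono_neutral_cong_right) (use finite_paths_quiver in auto)
    then show "(\<Sum>r | r \<in> ?P \<and> path_start r = i.
        if path_end r = j then f r * path_form v r * \<sigma> (path_start r) z v else 0) =
      path_sum (quiver t) (path_form v) f i j * \<sigma> i z v"
      by (simp add: path_sum_def sum_distrib_right)
  qed
  finally show ?thesis .
qed

lemma natural_map_zero:
  assumes f: "f \<in> carrier (path_algebra (quiver t))"
    and 0: "\<And>v i j. path_sum (quiver t) (path_form v) f i j = 0"
  shows "natural_map f = 0"
proof -
  have "natural_map f U \<sigma> j z v = 0" for U \<sigma> j z v
  proof (cases "zopen U \<and> \<sigma> \<in> sum_sheaf U")
    case True
    then have U: "zopen U" and \<sigma>: "\<sigma> \<in> sum_sheaf U" by auto
    show ?thesis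
    proof (cases "j \<in> {1..t+3}")
      case j: True
      have "natural_map f U \<sigma> j = 0"
        by (rule summand_eq_zero[OF U j natural_map_summand[OF f U \<sigma> j]])
           (simp add: natural_map_generic[OF f U \<sigma>] 0)
      then show ?thesis by simp
    next
      case False
      have "path_endo r U \<sigma> j = 0" if "r \<in> paths (quiver t)" for r
      proof -
        have "path_endo r U \<sigma> \<in> sum_sheaf U"
          using path_endo_inside(1)[OF U \<sigma>] that by (cases r) (simp add: paths_def del: path_endo.simps)
        then show ?thesis using False by (simp add: sum_sheaf_def del: path_endo.simps)
      qed
      then show ?thesis unfolding natural_map_carrier[OF f] by simp
    qed
  qed (rule natural_map_outside[OF f])
  then show ?thesis by (simp add: fun_eq_iff)
qed

text \<open>These sections probe one summand at a time. Global ones suffice: the constant 1, a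
  coordinate \<open>y a\<close> nonzero at \<open>v\<close>, and the square of
  \<open>y a\<close>.\<close>

lemma summand_nonzero_section:
  assumes i: "i \<in> {1..t+3}" and z: "z \<in> points" "v \<in> fst z" "generic v"
  obtains s where "s \<in> summand i points" "s z v \<noteq> 0"
proof -
  have sup: "in_support points z v" using z generic_nonzero by (simp add: in_support_def)
  consider "i \<in> {1..t}" | "i = t + 1" | "i = t + 2" | "i = t + 3" using i by fastforce
  then show ?thesis
  proof cases
    case 1
    have "restrict_to (points - exc i) (form_section points (\<lambda>_. 1)) \<in> exc_sheaf i points"
      by (rule exc_sheaf_restrict[OF zopen_points 1 form_section_const[OF zopen_points]])
    moreover have "summand i = exc_sheaf i" using 1 by (auto simp: summand_def)
    moreover have "restrict_to (points - exc i) (form_section points (\<lambda>_. 1)) z v \<noteq> 0"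
      using sup z generic_not_exc[OF z(2,3) 1] by (simp add: restrict_to_def form_section_def)
    ultimately show ?thesis using that by simp
  next
    case 2
    then show ?thesis
      using that[of "form_section points (\<lambda>_. 1)"] form_section_const[OF zopen_points] sup
      by (simp add: summand_def form_section_def)
  next
    case 3
    obtain a where "a < 3" "y a v \<noteq> 0" using y_nonzero generic_nonzero[OF z(3)] by blast
    then show ?thesis
      using that[of "form_section points (y a)"] form_section_dual[OF zopen_points y_dual] sup 3
      by (simp add: summand_def form_section_def)
  next
    case 4
    obtain a where a: "a < 3" "y a v \<noteq> 0" using y_nonzero generic_nonzero[OF z(3)] by blast
    have "(\<lambda>z v. y a v * form_section points (y a) z v) \<in> line_sheaf (Suc 1) points"
      by (intro line_sheaf_form_mult form_section_dual zopen_points y_dual a)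
    then show ?thesis
      using that[of "\<lambda>z v. y a v * form_section points (y a) z v"] sup 4 a
      by (simp add: summand_def form_section_def numeral_2_eq_2)
  qed
qed

text \<open>A section concentrated in summand \<open>i\<close> and nonzero over \<open>v\<close>
  isolates the entry from \<open>i\<close> to \<open>j\<close>, as long as \<open>v\<close> is
  generic.\<close>

lemma natural_map_zero_imp:
  assumes f: "f \<in> carrier (path_algebra (quiver t))" and 0: "natural_map f = 0"
  shows "path_sum (quiver t) (path_form v) f i j = 0"
proof -
  have gen: "path_sum (quiver t) (path_form v) f i j = 0" if v: "generic v" for v
  proof (cases "i \<in> {1..t+3}")
    case True
    obtain z where z: "z \<in> points" "v \<in> fst z"
      using point_over[OF generic_nonzero[OF v]] by metis
    obtain s where s: "s \<in> summand i points" "s z v \<noteq> 0"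
      using summand_nonzero_section[OF True z v] by blast
    let ?\<sigma> = "\<lambda>j. if j = i then s else 0"
    have \<sigma>: "?\<sigma> \<in> sum_sheaf points" by (rule sum_sheaf_single[OF zopen_points True s(1)])
    have "0 = natural_map f points ?\<sigma> j z v" by (simp add: 0)
    also have "\<dots> = (\<Sum>k\<in>{1..t+3}. path_sum (quiver t) (path_form v) f k j * ?\<sigma> k z v)"
      by (rule natural_map_generic[OF f zopen_points \<sigma> z v])
    also have "\<dots> = (\<Sum>k\<in>{1..t+3}. if k = i then path_sum (quiver t) (path_form v) f i j * s z v else 0)"
      by (rule sum.cong) auto
    also have "\<dots> = path_sum (quiver t) (path_form v) f i j * s z v"
      using True by (simp add: sum.delta')
    finally show ?thesis using s(2) by simp
  next
    case False
    then have "{r. r \<in> paths (quiver t) \<and> path_start r = i \<and> path_end r = j} = {}"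
      using paths_quiver_ends by blast
    then show ?thesis unfolding path_sum_def by (simp only: sum.empty)
  qed
  \<comment> \<open>Almost every vector on this line is generic and the path sum is polynomial in
    the parameter; \<open>v\<close> itself has parameter 0.\<close>
  obtain w where "finite {s. \<not> generic (v + scale s w)}" by (rule generic_line)
  then have "path_sum (quiver t) (path_form (v + scale 0 w)) f i j = 0"
    by (rule poly_fun_zero[OF poly_fun_path_sum]) (use gen in blast)
  then show ?thesis by simp
qed

lemma I_X_eq:
  "I_X = {f \<in> carrier (path_algebra (quiver t)). \<forall>v\<in>UNIV. \<forall>i j. path_sum (quiver t) (path_form v) f i j = 0}"
proof -
  have "I_X = {f \<in> carrier (path_algebra (quiver t)). natural_map f = 0}"
    by (simp add: I_X_def a_kernel_def' end_algebra_def)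
  then show ?thesis using natural_map_zero natural_map_zero_imp by blast
qed

lemma ideal_I_X: "ideal I_X (path_algebra (quiver t))"
  unfolding I_X_eq
  by (rule ideal_path_sum_kernel[OF weighted_quiver_path_form wf_quiver]) (simp add: verts_quiver)

section \<open>The relations\<close>

lemma path_sum_trivial: "i \<in> {1..t+3} \<Longrightarrow> path_sum (quiver t) (path_form v) f i i = f (i, [], i)"
  by (simp add: path_sum_between paths_between_trivial path_form_def)

lemma path_sum_exc: "i \<in> {1..t} \<Longrightarrow> path_sum (quiver t) (path_form v) f (t + 1) i = f (t + 1, [Exc i], i)"
  by (simp only: path_sum_between paths_between_exc) (simp add: path_form_def)

lemma path_sum_lin:
  "i \<in> {1..t} \<Longrightarrow> path_sum (quiver t) (path_form v) f i (t + 2) = (\<Sum>b<2. f (i, [Lin i b], t + 2) * h i b v)"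
  by (simp only: path_sum_between paths_between_lin)
     (subst sum.reindex; simp add: inj_on_def path_form_def)

lemma path_sum_coord:
  "path_sum (quiver t) (path_form v) f (t + 2) (t + 3) = (\<Sum>a<3. f (t + 2, [Coord a], t + 3) * y a v)"
  by (simp only: path_sum_between paths_between_coord)
     (subst sum.reindex; simp add: inj_on_def path_form_def)

lemma path_sum_exc_lin:
  "path_sum (quiver t) (path_form v) f (t + 1) (t + 2) =
    (\<Sum>i=1..t. \<Sum>b<2. f (t + 1, [Exc i, Lin i b], t + 2) * h i b v)"
  unfolding path_sum_between paths_between_exc_lin sum.cartesian_product
  by (subst sum.reindex) (auto simp: inj_on_def path_form_def intro!: sum.cong)

lemma path_sum_lin_coord:
  "i \<in> {1..t} \<Longrightarrow> path_sum (quiver t) (path_form v) f i (t + 3) =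
    (\<Sum>b<2. \<Sum>a<3. f (i, [Lin i b, Coord a], t + 3) * (h i b v * y a v))"
  unfolding path_sum_between paths_between_lin_coord sum.cartesian_product
  by (subst sum.reindex) (auto simp: inj_on_def path_form_def intro!: sum.cong)

lemma path_sum_exc_lin_coord:
  "path_sum (quiver t) (path_form v) f (t + 1) (t + 3) =
    (\<Sum>i=1..t. \<Sum>b<2. \<Sum>a<3. f (t + 1, [Exc i, Lin i b, Coord a], t + 3) * (h i b v * y a v))"
  unfolding path_sum_between paths_between_exc_lin_coord sum.cartesian_product
  by (subst sum.reindex) (auto simp: inj_on_def path_form_def intro!: sum.cong)

section \<open>The relations as parts of \<open>I_X\<close> between two vertices\<close>

lemma path_sum_path_space:
  assumes "f \<in> path_space (quiver t) i j" "(i', j') \<noteq> (i, j)"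
  shows "path_sum (quiver t) w f i' j' = 0"
proof -
  have "f r * w r = 0" if "r \<in> paths_between t i' j'" for r
  proof -
    have "f r \<noteq> 0 \<Longrightarrow> path_start r = i \<and> path_end r = j"
      using assms(1) unfolding path_space_def by blast
    then show ?thesis using that assms(2) by (auto simp: paths_between_def)
  qed
  then show ?thesis unfolding path_sum_between by (intro sum.neutral ballI)
qed

lemma path_space_I_X_iff:
  assumes "f \<in> path_space (quiver t) i j"
  shows "f \<in> I_X \<longleftrightarrow> (\<forall>v. path_sum (quiver t) (path_form v) f i j = 0)"
proof -
  have "f \<in> carrier (path_algebra (quiver t))" using assms unfolding path_space_def by blast
  moreover have "path_sum (quiver t) (path_form v) f i' j' = 0"
    if "\<forall>v. path_sum (quiver t) (path_form v) f i j = 0" for v i' j'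
    using that path_sum_path_space[OF assms, of i' j'] by (cases "(i', j') = (i, j)") auto
  ultimately show ?thesis unfolding I_X_eq by blast
qed

text \<open>Identifying a family of relations with the whole part of \<open>I_X\<close> between its
  vertices serves both inclusions: relations lie in \<open>I_X\<close>, and the components of an
  element of \<open>I_X\<close> are relations.\<close>

lemma relations_lin_eq: "relations_lin = path_space (quiver t) (t + 1) (t + 2) \<inter> I_X"
proof (rule Set.set_eqI)
  fix f
  have "(\<Sum>i=1..t. \<Sum>b<2. fscale (f (t + 1, [Exc i, Lin i b], t + 2)) (h i b)) = 0 \<longleftrightarrow>
      (\<forall>v. path_sum (quiver t) (path_form v) f (t + 1) (t + 2) = 0)"
    unfolding path_sum_exc_lin fun_eq_iff by (simp add: sum_fun_apply fscale_def)
  then show "f \<in> relations_lin \<longleftrightarrow> f \<in> path_space (quiver t) (t + 1) (t + 2) \<inter> I_X"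
    using path_space_I_X_iff[of f "t + 1" "t + 2"] unfolding relations_lin_def by blast
qed

text \<open>One index set \<open>S\<close> covers both the double and the triple sums of the
  relations, once these are flattened to sums over products.\<close>

lemma tensor_sum_sym2_iff:
  assumes "finite S" "\<And>s. s \<in> S \<Longrightarrow> f s \<in> dual_space scale \<and> g s \<in> dual_space scale"
  shows "(\<Sum>s\<in>S. fscale (c s) (tensor (f s) (g s))) \<in> sym2_kernel scale \<longleftrightarrow>
    (\<forall>v. (\<Sum>s\<in>S. c s * (f s v * g s v)) = 0)"
proof
  assume "(\<Sum>s\<in>S. fscale (c s) (tensor (f s) (g s))) \<in> sym2_kernel scale"
  from sym2_kernel_diagonal[OF this] show "\<forall>v. (\<Sum>s\<in>S. c s * (f s v * g s v)) = 0"
    by (simp add: sum_fun_apply fscale_def tensor_def)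
next
  assume "\<forall>v. (\<Sum>s\<in>S. c s * (f s v * g s v)) = 0"
  then show "(\<Sum>s\<in>S. fscale (c s) (tensor (f s) (g s))) \<in> sym2_kernel scale"
    by (intro alternating_in_sym2_kernel[OF vector_space_axioms dim_3 assms]) auto
qed

lemma relations_exc_eq:
  assumes i: "i \<in> {1..t}"
  shows "relations_exc i = path_space (quiver t) i (t + 3) \<inter> I_X"
proof (rule Set.set_eqI)
  fix f
  have "(\<Sum>b<2. \<Sum>a<3. fscale (f (i, [Lin i b, Coord a], t + 3)) (tensor (h i b) (y a))) \<in> sym2_kernel scale \<longleftrightarrow>
      (\<forall>v. path_sum (quiver t) (path_form v) f i (t + 3) = 0)"
    unfolding path_sum_lin_coord[OF i] sum.cartesian_product case_prod_beta
    by (rule tensor_sum_sym2_iff) (use i in \<open>auto intro!: h_dual y_dual\<close>)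
  then show "f \<in> relations_exc i \<longleftrightarrow> f \<in> path_space (quiver t) i (t + 3) \<inter> I_X"
    using path_space_I_X_iff[of f i "t + 3"] unfolding relations_exc_def by blast
qed

lemma relations_quad_eq: "relations_quad = path_space (quiver t) (t + 1) (t + 3) \<inter> I_X"
proof (rule Set.set_eqI)
  fix f
  have "(\<Sum>i=1..t. \<Sum>b<2. \<Sum>a<3. fscale (f (t + 1, [Exc i, Lin i b, Coord a], t + 3)) (tensor (h i b) (y a)))
        \<in> sym2_kernel scale \<longleftrightarrow>
      (\<forall>v. path_sum (quiver t) (path_form v) f (t + 1) (t + 3) = 0)"
    unfolding path_sum_exc_lin_coord sum.cartesian_product case_prod_beta
    by (rule tensor_sum_sym2_iff) (auto intro!: h_dual y_dual)
  then show "f \<in> relations_quad \<longleftrightarrow> f \<in> path_space (quiver t) (t + 1) (t + 3) \<inter> I_X"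
    using path_space_I_X_iff[of f "t + 1" "t + 3"] unfolding relations_quad_def by blast
qed

text \<open>Between the other pairs of vertices the sections carried by the arrows are linearly independent.\<close>

lemma I_X_support:
  assumes f: "f \<in> I_X" and nz: "f (i, p, j) \<noteq> 0"
  shows "i \<in> {1..t} \<and> j = t + 3 \<or> i = t + 1 \<and> j = t + 2 \<or> i = t + 1 \<and> j = t + 3"
proof -
  have fc: "f \<in> carrier (path_algebra (quiver t))" and 0: "\<And>v i j. path_sum (quiver t) (path_form v) f i j = 0"
    using f unfolding I_X_eq by auto
  have "(i, p, j) \<in> paths (quiver t)" using fc nz by auto
  then have "pre_digraph.awalk (quiver t) i p j" by (simp add: paths_def)
  from awalk_quiver_cases[OF this] show ?thesis
  proof (elim disjE bexE exE conjE)
    assume *: "p = []" "i = j" "i \<in> {1..t+3}"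
    \<comment> \<open>A trivial path carries the constant 1, so any vector may be inserted; the same
      holds for the arrow \<open>Exc\<close> below.\<close>
    then have "f (i, p, j) = 0" using path_sum_trivial[OF *(3), of undefined f] 0 by simp
    then show ?thesis using nz by simp
  next
    fix i' assume *: "p = [Exc i']" "i = t + 1" "j = i'" "i' \<in> {1..t}"
    then have "f (i, p, j) = 0" using path_sum_exc[OF *(4), of undefined f] 0 by simp
    then show ?thesis using nz by simp
  next
    fix i' b assume *: "b < 2" "p = [Lin i' b]" "i = i'" "j = t + 2" "i' \<in> {1..t}"
    have "(\<Sum>b<2. f (i', [Lin i' b], t + 2) * h i' b v) = 0" for v
      using path_sum_lin[OF *(5), of v f] 0 by simp
    from basis_family_independent[OF h_basis[OF *(5)] this *(1)]
    show ?thesis using * nz by simp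
  next
    fix a assume *: "a < 3" "p = [Coord a]" "i = t + 2" "j = t + 3"
    have "(\<Sum>a<3. f (t + 2, [Coord a], t + 3) * y a v) = 0" for v
      using path_sum_coord[of v f] 0 by simp
    from basis_family_independent[OF y_basis this *(1)]
    show ?thesis using * nz by simp
  qed auto
qed

text \<open>This is the product \<open>e_j f e_i\<close> with the idempotents at both ends, given
  directly by its coefficients.\<close>

definition component :: "nat \<Rightarrow> nat \<Rightarrow> (nat \<times> arrow list \<times> nat \<Rightarrow> 'k) \<Rightarrow> (nat \<times> arrow list \<times> nat \<Rightarrow> 'k)" where
  "component i j f = (\<lambda>(u, p, v). if u = i \<and> v = j then f (u, p, v) else 0)"

text \<open>A component keeps the matrix entry from \<open>i\<close> to \<open>j\<close> and
  replaces all others by zero, so a vanishing matrix stays vanishing.\<close>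

lemma component_I_X:
  assumes f: "f \<in> I_X" shows "component i j f \<in> path_space (quiver t) i j \<inter> I_X"
proof -
  have fc: "f \<in> carrier (path_algebra (quiver t))" and 0: "\<And>v i j. path_sum (quiver t) (path_form v) f i j = 0"
    using f unfolding I_X_eq by auto
  have sub: "{r. component i j f r \<noteq> 0} \<subseteq> {r. f r \<noteq> 0}"
    by (auto simp: component_def split: if_splits)
  then have "component i j f \<in> carrier (path_algebra (quiver t))"
    using fc finite_subset[OF sub] by auto
  moreover have "path_start r = i \<and> path_end r = j" if "component i j f r \<noteq> 0" for r
    using that by (cases r) (auto simp: component_def split: if_splits)
  ultimately have c: "component i j f \<in> path_space (quiver t) i j" unfolding path_space_def by blast
  have "component i j f r = f r" if "r \<in> paths_between t i j" for r
    using that unfolding paths_between_iff by (auto simp: component_def)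
  then have "path_sum (quiver t) (path_form v) (component i j f) i j = path_sum (quiver t) (path_form v) f i j" for v
    unfolding path_sum_between by (intro sum.cong) auto
  then show ?thesis using c path_space_I_X_iff[OF c] 0 by simp
qed

lemma I_X_decomposition:
  assumes f: "f \<in> I_X"
  shows "f = component (t + 1) (t + 2) f + component (t + 1) (t + 3) f + (\<Sum>i=1..t. component i (t + 3) f)"
proof
  fix r :: "nat \<times> arrow list \<times> nat"
  obtain i p j where r: "r = (i, p, j)" by (cases r)
  have "(\<Sum>k=1..t. component k (t + 3) f r) = (\<Sum>k=1..t. if k = i then (if j = t + 3 then f r else 0) else 0)"
    by (rule sum.cong) (auto simp: component_def r)
  also have "\<dots> = (if i \<in> {1..t} \<and> j = t + 3 then f r else 0)"
    by (simp add: sum.delta)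
  finally have s: "(\<Sum>k=1..t. component k (t + 3) f r) = (if i \<in> {1..t} \<and> j = t + 3 then f r else 0)" .
  show "f r = (component (t + 1) (t + 2) f + component (t + 1) (t + 3) f + (\<Sum>i=1..t. component i (t + 3) f)) r"
    using I_X_support[OF f, of i p j]
    unfolding plus_fun_apply sum_fun_apply s by (auto simp: component_def r)
qed

text \<open>Every element of \<open>I_X\<close> is a sum of relations, namely of its components, so
  the relations already span \<open>I_X\<close> additively. The reverse inclusion holds because
  \<open>I_X\<close> is an ideal containing them.\<close>

lemma I_X_generated:
  "I_X = genideal (path_algebra (quiver t)) ((\<Union>i\<in>{1..t}. relations_exc i) \<union> relations_lin \<union> relations_quad)"
    (is "_ = genideal ?A ?R")
proof
  interpret ring ?A
    by (rule wf_digraph.ring_path_algebra[OF wf_quiver]) (simp add: verts_quiver)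
  have R: "?R \<subseteq> I_X" using relations_exc_eq relations_lin_eq relations_quad_eq by blast
  then show "genideal ?A ?R \<subseteq> I_X" by (rule genideal_minimal[OF ideal_I_X])
  have "?R \<subseteq> carrier ?A" using R unfolding I_X_eq by blast
  then interpret J: ideal "genideal ?A ?R" ?A by (rule genideal_ideal)
  have RJ: "?R \<subseteq> genideal ?A ?R" using \<open>?R \<subseteq> carrier ?A\<close> by (rule genideal_self)
  have add: "a + b \<in> genideal ?A ?R" if "a \<in> genideal ?A ?R" "b \<in> genideal ?A ?R" for a b
    using J.a_closed[OF that] by simp
  have zero: "0 \<in> genideal ?A ?R" using J.zero_closed by simp
  show "I_X \<subseteq> genideal ?A ?R"
  proof
    fix f assume f: "f \<in> I_X"
    have "component (t + 1) (t + 2) f \<in> genideal ?A ?R" "component (t + 1) (t + 3) f \<in> genideal ?A ?R"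
      using component_I_X[OF f] RJ relations_lin_eq relations_quad_eq by blast+
    moreover have "(\<Sum>i\<in>S. component i (t + 3) f) \<in> genideal ?A ?R" if "finite S" "S \<subseteq> {1..t}" for S
      using that
    proof (induction S rule: finite_induct)
      case (insert i S)
      have "component i (t + 3) f \<in> genideal ?A ?R"
        using component_I_X[OF f, of i "t + 3"] RJ relations_exc_eq[of i] insert.prems by blast
      moreover have "(\<Sum>i\<in>S. component i (t + 3) f) \<in> genideal ?A ?R"
        using insert.IH insert.prems by blast
      ultimately show ?case unfolding sum.insert[OF insert.hyps] by (rule add)
    qed (simp only: sum.empty zero)
    ultimately have "component (t + 1) (t + 2) f + component (t + 1) (t + 3) f +
        (\<Sum>i=1..t. component i (t + 3) f) \<in> genideal ?A ?R"
      by (intro add) auto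
    then show "f \<in> genideal ?A ?R" using I_X_decomposition[OF f] by metis
  qed
qed

end

theorem theorem7p2:
  fixes scale :: "'k::alg_closed_field \<Rightarrow> 'v::ab_group_add \<Rightarrow> 'v"
    and t :: nat
    and x :: "nat \<Rightarrow> 'v set"
    and h :: "nat \<Rightarrow> nat \<Rightarrow> 'v \<Rightarrow> 'k"
    and y :: "nat \<Rightarrow> 'v \<Rightarrow> 'k"
  assumes "vector_space scale"
    and "vector_space.dim scale (UNIV :: 'v set) = 3"
    and "t > 1"
    and "\<forall>i\<in>{1..t}. x i \<in> proj_space scale"
    and "inj_on x {1..t}"
    and "\<forall>i\<in>{1..t}. basis_family 2 (h i) (forms_through scale (x i))"
    and "basis_family 3 y (dual_space scale)"
  shows "blown_up_plane_bases.I_X scale t x h y =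
    genideal (path_algebra (quiver t))
      ((\<Union>i\<in>{1..t}. blown_up_plane_bases.relations_exc scale t h y i)
        \<union> blown_up_plane_bases.relations_lin t h
        \<union> blown_up_plane_bases.relations_quad scale t h y)"
proof -
  interpret vector_space scale by fact
  interpret blown_up_points scale t x h y
    by unfold_locales (use assms in auto)
  show ?thesis by (rule I_X_generated)
qed

end
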